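(* Let $\epsilon>0$. With high probability, the König process satisfies the following properties. (i) $G_{(1+\epsilon)n\log n}$ contains a perfect matching. (ii) $G_{4n\log n}$ has a unique optimal vertex cover $C$. (iii) There are $O(n)$ vertex pairs incident to $C$ (i.e. pairs $\{u,v\}\subset V$, $u\neq v$, with $\{u,v\}\cap C\neq\emptyset$) that are not present as edges in $G_N$.
   Context: Let $n$ be an even integer, $V$ a set of $n$ vertices, $N=\binom n2$. For a graph $G$, $\nu(G)$ is the size of a maximum matching and $\tau(G)$ the minimum cardinality of a vertex cover (a set of vertices incident to every edge); an optimal vertex cover is a vertex cover of cardinality $\tau(G)$. $G$ is a König graph if $\nu(G)=\tau(G)$. The König process: let $e_1,\dots,e_N$ be a uniformly random ordering of the edges of the complete graph on $V$. $G_0$ is the empty graph on $V$. For $0\le m<N$, $G_{m+1}=G_m+e_{m+1}$ if $G_m+e_{m+1}$ is König, and $G_{m+1}=G_m$ otherwise. An event holds with high probability if its probability tends to $1$ as $n\to\infty$ (through even integers). $\log$ is the natural logarithm; rounding of time indices to integers is ignored. In (iii), $O(n)$ means at most $Kn$ for some absolute constant $K$. *)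

theory Defs
  imports "HOL-Probability.Probability" "HOL-Combinatorics.Multiset_Permutations"
    "HOL-Library.Ramsey" "HOL-Library.Disjoint_Sets"
begin

text \<open>
  A simple graph on a finite vertex set \<open>V\<close> is given by its edge set \<open>E \<subseteq> nsets V 2\<close>, where
  \<open>nsets V 2\<close> is the set of all two-element subsets of \<open>V\<close>, i.e. the edge set of the complete
  graph on \<open>V\<close>.
\<close>

definition is_matching :: "'a set set \<Rightarrow> 'a set set \<Rightarrow> bool" where
  "is_matching E M \<longleftrightarrow> M \<subseteq> E \<and> disjoint M"

definition matching_number :: "'a set set \<Rightarrow> nat" where
  "matching_number E = Max (card ` {M. is_matching E M})"

definition has_perfect_matching :: "'a set \<Rightarrow> 'a set set \<Rightarrow> bool" where
  "has_perfect_matching V E \<longleftrightarrow> (\<exists>M. is_matching E M \<and> \<Union>M = V)"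

definition is_vertex_cover :: "'a set \<Rightarrow> 'a set set \<Rightarrow> 'a set \<Rightarrow> bool" where
  "is_vertex_cover V E C \<longleftrightarrow> C \<subseteq> V \<and> (\<forall>e\<in>E. e \<inter> C \<noteq> {})"

definition vertex_cover_number :: "'a set \<Rightarrow> 'a set set \<Rightarrow> nat" where
  "vertex_cover_number V E = Min (card ` {C. is_vertex_cover V E C})"

definition is_optimal_vertex_cover :: "'a set \<Rightarrow> 'a set set \<Rightarrow> 'a set \<Rightarrow> bool" where
  "is_optimal_vertex_cover V E C \<longleftrightarrow>
     is_vertex_cover V E C \<and> card C = vertex_cover_number V E"

definition konig_graph :: "'a set \<Rightarrow> 'a set set \<Rightarrow> bool" where
  "konig_graph V E \<longleftrightarrow> matching_number E = vertex_cover_number V E"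

text \<open>
  The list \<open>es\<close> is the ordering \<open>e\<^sub>1, \<dots>, e\<^sub>N\<close> of the edges of the complete graph; since lists are
  indexed from 0, \<open>es ! m\<close> is \<open>e\<^bsub>m+1\<^esub>\<close>. Once all edges have been processed the graph stays
  constant, so that \<open>G\<^sub>m = G\<^sub>N\<close> for \<open>m \<ge> N\<close>. (A time such as \<open>4 n log n\<close> exceeds \<open>N\<close> only for
  finitely many \<open>n\<close>.)
\<close>

primrec konig_process :: "'a set \<Rightarrow> 'a set list \<Rightarrow> nat \<Rightarrow> 'a set set" where
  "konig_process V es 0 = {}"
| "konig_process V es (Suc m) =
     (if m < length es \<and> konig_graph V (insert (es ! m) (konig_process V es m))
      then insert (es ! m) (konig_process V es m)
      else konig_process V es m)"

definition random_edge_ordering :: "'a set \<Rightarrow> 'a set list pmf" where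
  "random_edge_ordering V = pmf_of_set (permutations_of_set (nsets V 2))"

definition even_at_top :: "nat filter" where
  "even_at_top = inf at_top (principal {n. even n})"

end

theory Submission
  imports Defs "HOL-Real_Asymp.Real_Asymp"
begin

text \<open>
  An offered edge is accepted if it meets an optimal cover, or if it is missed by some maximum
  matching, in which case the matching number grows. Hence pairs inside the unmatched set, and
  more generally pairs reached from it by alternating paths, can be offered only \<open>n / 2\<close> times;
  this keeps the matching number close to \<open>n / 2\<close> after linearly many steps. From then on every
  vertex receives an accepted edge at rate about \<open>1 / n\<close>, since pairs meeting the current cover
  are accepted. By local sparsity of the offered pairs, a set of unmatched-side vertices closed
  under alternating paths is large unless most of its vertices have low degree. So the number of
  unmatched vertices is governed by that of low-degree vertices, which decays exponentially in
  \<open>m / n\<close> and vanishes by time \<open>(1 + \<epsilon>) n log n\<close>.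

  For the final cover \<open>C\<close>, a rejected pair meeting \<open>C\<close> must meet \<open>C - C\<^sub>m\<close>, where \<open>C\<^sub>m\<close> is any
  optimal cover of \<open>G\<^sub>m\<close>. For a fixed candidate \<open>C\<close> no offered pair may lie outside \<open>C\<close> and
  meet \<open>C\<^sub>m\<close>, so \<open>C\<close> survives with probability at most the exponential of minus a constant times
  \<open>\<Sum>\<^sub>m |C\<^sub>m - C| / n\<close>; summing over all \<open>2\<^sup>n\<close> candidates shows that this sum is \<open>O(n)\<close>,
  and with it the number of missing pairs. Once the matching is perfect, optimal covers can only
  disappear. After \<open>O(n)\<close> more steps they agree up to a small fraction of the vertices, and each
  undecided vertex is then decided by its first edge to a vertex lying in no optimal cover.
\<close>

section \<open>Matchings and vertex covers\<close>

text \<open>Acceptance depends on the whole history, so the accepted graph has no independent edges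
  and no uniform law. What stays uniform is the next offered pair: given the prefix, it is equally
  likely to be any pair not yet offered. So every probabilistic estimate is a tail bound for the
  number of times the offered pair falls into a set determined by the prefix; the rest is
  deterministic. Up to time 4 n log n a vanishing fraction of the pairs has been offered, so between
  n^2/4 and n^2/2 pairs remain. The bound n^2/2 is sharp to first order, as (i) requires; n^2/4
  serves only upper tails, where constants do not matter.

  Whatever \<epsilon> is in (i), parts (ii) and (iii) start from the matching result with 1/2 in its
  place, which makes the constant in (iii) absolute. This leaves about 5/2 n log n steps before time
  4 n log n. An undecided vertex survives them with probability about n to the power -7/4, which
  beats a union over n vertices.\<close>

lemma finite_edges: "finite V \<Longrightarrow> finite (nsets V 2)"
  by (simp add: finite_imp_finite_nsets)

lemma nsets_2_nonempty: "e \<in> nsets V 2 \<Longrightarrow> e \<noteq> {}"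
  by (auto simp: nsets_def)

lemma finite_matchings: "finite E \<Longrightarrow> finite {M. is_matching E M}"
  by (rule finite_subset[of _ "Pow E"]) (auto simp: is_matching_def)

lemma finite_covers: "finite V \<Longrightarrow> finite {C. is_vertex_cover V E C}"
  by (rule finite_subset[of _ "Pow V"]) (auto simp: is_vertex_cover_def)

lemma empty_matching: "is_matching E {}"
  by (simp add: is_matching_def disjoint_def)

lemma matching_number_ge: "finite E \<Longrightarrow> is_matching E M \<Longrightarrow> card M \<le> matching_number E"
  unfolding matching_number_def by (intro Max_ge finite_imageI finite_matchings) auto

lemma maximum_matching_exists:
  assumes "finite E" shows "\<exists>M. is_matching E M \<and> card M = matching_number E"
proof -
  have "matching_number E \<in> card ` {M. is_matching E M}"
    unfolding matching_number_def
    using assms empty_matching by (intro Max_in finite_imageI finite_matchings) auto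
  then show ?thesis by auto
qed

lemma vertex_cover_number_le:
  "finite V \<Longrightarrow> is_vertex_cover V E C \<Longrightarrow> vertex_cover_number V E \<le> card C"
  unfolding vertex_cover_number_def by (intro Min_le finite_imageI finite_covers) auto

lemma full_vertex_cover: "E \<subseteq> nsets V 2 \<Longrightarrow> is_vertex_cover V E V"
  using nsets_2_nonempty by (fastforce simp: is_vertex_cover_def nsets_def Int_absorb2)

lemma optimal_cover_exists:
  assumes "finite V" "E \<subseteq> nsets V 2" shows "\<exists>C. is_optimal_vertex_cover V E C"
proof -
  have "vertex_cover_number V E \<in> card ` {C. is_vertex_cover V E C}"
    unfolding vertex_cover_number_def
    using assms full_vertex_cover by (intro Min_in finite_imageI finite_covers) auto
  then show ?thesis by (auto simp: is_optimal_vertex_cover_def)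
qed

text \<open>Matching edges are disjoint, so choosing one covered endpoint of each gives distinct
  vertices. This is weak duality; when both sizes agree, the injection becomes a bijection.\<close>

lemma matching_cover_injection:
  assumes "is_matching E M" "is_vertex_cover V E C"
  obtains f where "inj_on f M" "\<And>e. e \<in> M \<Longrightarrow> f e \<in> e \<inter> C"
proof -
  have "\<exists>x. x \<in> e \<inter> C" if "e \<in> M" for e
    using assms that unfolding is_matching_def is_vertex_cover_def by blast
  then obtain f where f: "\<And>e. e \<in> M \<Longrightarrow> f e \<in> e \<inter> C" by metis
  have "inj_on f M"
  proof (rule inj_onI)
    fix d e assume "d \<in> M" "e \<in> M" "f d = f e"
    then have "d \<inter> e \<noteq> {}" using f[of d] f[of e] by auto
    then show "d = e" using assms(1) \<open>d \<in> M\<close> \<open>e \<in> M\<close>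
      by (auto simp: is_matching_def disjoint_def)
  qed
  then show thesis using f that by blast
qed

lemma card_matching_le_card_cover:
  assumes "finite V" "is_matching E M" "is_vertex_cover V E C"
  shows "card M \<le> card C"
proof -
  obtain f where f: "inj_on f M" "\<And>e. e \<in> M \<Longrightarrow> f e \<in> e \<inter> C"
    using matching_cover_injection[OF assms(2,3)] by blast
  have "finite C" using assms(1,3) finite_subset by (auto simp: is_vertex_cover_def)
  then show ?thesis using f by (intro card_inj_on_le[of f]) auto
qed

lemma matching_number_le_cover_number:
  assumes "finite V" "E \<subseteq> nsets V 2"
  shows "matching_number E \<le> vertex_cover_number V E"
proof -
  have "finite E" using assms finite_edges finite_subset by blast
  then show ?thesis
    using maximum_matching_exists[of E] optimal_cover_exists[OF assms]
      card_matching_le_card_cover[OF assms(1)]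
    by (metis is_optimal_vertex_cover_def)
qed

lemma matching_number_mono:
  assumes "finite F" "E \<subseteq> F" shows "matching_number E \<le> matching_number F"
proof -
  obtain M where "is_matching E M" "card M = matching_number E"
    using maximum_matching_exists[of E] assms finite_subset by metis
  then show ?thesis using matching_number_ge[OF assms(1), of M] assms(2)
    by (auto simp: is_matching_def)
qed

lemma optimal_cover_same_number:
  assumes "finite V" "F \<subseteq> nsets V 2" "E \<subseteq> F" "vertex_cover_number V E = vertex_cover_number V F"
    "is_optimal_vertex_cover V F C"
  shows "is_optimal_vertex_cover V E C"
  using assms by (auto simp: is_optimal_vertex_cover_def is_vertex_cover_def)

text \<open>The old cover still covers, which closes the chain nu(E) <= nu(E+e) <= tau(E+e) <=
  tau(E) = nu(E).\<close>

lemma konig_insert_covered: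
  assumes V: "finite V" and E: "E \<subseteq> nsets V 2" and K: "konig_graph V E"
    and C: "is_optimal_vertex_cover V E C" and e: "e \<in> nsets V 2" "e \<inter> C \<noteq> {}"
  shows "konig_graph V (insert e E)" "matching_number (insert e E) = matching_number E"
proof -
  have "is_vertex_cover V (insert e E) C"
    using C e by (auto simp: is_optimal_vertex_cover_def is_vertex_cover_def)
  then have 1: "vertex_cover_number V (insert e E) \<le> vertex_cover_number V E"
    using vertex_cover_number_le[OF V] C by (metis is_optimal_vertex_cover_def)
  have fin: "finite (insert e E)" using E V finite_edges finite_subset by auto
  have 2: "matching_number E \<le> matching_number (insert e E)"
    by (rule matching_number_mono[OF fin]) auto
  have 3: "matching_number (insert e E) \<le> vertex_cover_number V (insert e E)"
    using matching_number_le_cover_number[OF V, of "insert e E"] E e by auto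
  show "konig_graph V (insert e E)" "matching_number (insert e E) = matching_number E"
    using 1 2 3 K by (auto simp: konig_graph_def)
qed

text \<open>Each pair may use its own maximum matching as witness. The set can therefore be much
  larger than the set of pairs left uncovered by any single matching.\<close>

definition augmenting_pairs :: "'a set \<Rightarrow> 'a set set \<Rightarrow> 'a set set" where
  "augmenting_pairs V E = {e \<in> nsets V 2.
     \<exists>M. is_matching E M \<and> card M = matching_number E \<and> \<Union>M \<inter> e = {}}"

text \<open>Both numbers rise by exactly one: \<open>e\<close> extends the matching that misses it,
  and one endpoint of \<open>e\<close> added to an optimal cover repairs that cover.\<close>

lemma konig_insert_augmenting:
  assumes V: "finite V" and E: "E \<subseteq> nsets V 2" and K: "konig_graph V E"
    and e: "e \<in> augmenting_pairs V E"
  shows "konig_graph V (insert e E)" "matching_number (insert e E) = Suc (matching_number E)"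
proof -
  obtain M where M: "is_matching E M" "card M = matching_number E" "\<Union>M \<inter> e = {}"
    and e2: "e \<in> nsets V 2"
    using e by (auto simp: augmenting_pairs_def)
  have fE: "finite E" using E V finite_edges finite_subset by auto
  then have fM: "finite M" using M(1) finite_subset by (auto simp: is_matching_def)
  have ne: "e \<noteq> {}" using e2 nsets_2_nonempty by blast
  then have "e \<notin> M" using M(3) by auto
  have "is_matching (insert e E) (insert e M)"
    using M(1,3) by (auto simp: is_matching_def disjoint_def)
  then have 1: "Suc (matching_number E) \<le> matching_number (insert e E)"
    using matching_number_ge[of "insert e E" "insert e M"] fE fM \<open>e \<notin> M\<close> M(2) by simp
  obtain C where C: "is_optimal_vertex_cover V E C"
    using optimal_cover_exists[OF V E] by blast
  obtain x where x: "x \<in> e" "x \<in> V" using ne e2 by (auto simp: nsets_def)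
  have fC: "finite C" using C V finite_subset
    by (auto simp: is_optimal_vertex_cover_def is_vertex_cover_def)
  have "is_vertex_cover V (insert e E) (insert x C)"
    using C x by (auto simp: is_optimal_vertex_cover_def is_vertex_cover_def)
  then have "vertex_cover_number V (insert e E) \<le> card (insert x C)"
    by (rule vertex_cover_number_le[OF V])
  also have "\<dots> \<le> Suc (card C)" using fC by (simp add: card_insert_if)
  finally have 2: "vertex_cover_number V (insert e E) \<le> Suc (vertex_cover_number V E)"
    using C by (simp add: is_optimal_vertex_cover_def)
  have 3: "matching_number (insert e E) \<le> vertex_cover_number V (insert e E)"
    using matching_number_le_cover_number[OF V, of "insert e E"] E e2 by auto
  show "konig_graph V (insert e E)" "matching_number (insert e E) = Suc (matching_number E)"
    using 1 2 3 K by (auto simp: konig_graph_def)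
qed

section \<open>Tight pairs of a cover and a matching; alternating paths\<close>

locale konig_matching =
  fixes V :: "'a set" and E C M
  assumes finite_V: "finite V" and edges: "E \<subseteq> nsets V 2" and konig: "konig_graph V E"
    and optimal: "is_optimal_vertex_cover V E C"
    and matching: "is_matching E M" and card_M: "card M = matching_number E"
begin

text \<open>Complementary slackness: since \<open>C\<close> and \<open>M\<close> have equal size,
  the injection of \<open>M\<close> into \<open>C\<close> is onto. A second covered endpoint of an
  edge would then be the image of another edge, which would share that vertex.\<close>

lemma matching_edge: "e \<in> M \<Longrightarrow> \<exists>c w. e = {c, w} \<and> c \<in> C \<and> w \<notin> C \<and> w \<in> V"
  and cover_subset: "C \<subseteq> \<Union>M"
proof -
  have cov: "is_vertex_cover V E C" and cC: "card C = card M"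
    using optimal konig card_M by (auto simp: is_optimal_vertex_cover_def konig_graph_def)
  obtain f where f: "inj_on f M" "\<And>e. e \<in> M \<Longrightarrow> f e \<in> e \<inter> C"
    using matching_cover_injection[OF matching cov] by blast
  have fC: "finite C" using cov finite_V finite_subset by (auto simp: is_vertex_cover_def)
  have "card (f ` M) = card C" using f(1) cC by (simp add: card_image)
  moreover have "f ` M \<subseteq> C" using f(2) by auto
  ultimately have img: "f ` M = C" using fC by (simp add: card_subset_eq)
  then show "C \<subseteq> \<Union>M" using f(2) by auto
  assume e: "e \<in> M"
  then have e2: "e \<in> nsets V 2" using matching edges by (auto simp: is_matching_def)
  have "card e = 2" using e2 by (auto simp: nsets_def)
  then obtain x y where xy: "e = {x, y}" "x \<noteq> y" by (auto simp: card_2_iff)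
  have "f e = x \<or> f e = y" using f(2)[OF e] xy by simp
  then obtain c w where cw: "e = {c, w}" "c \<noteq> w" "c = f e"
    using xy by (metis insert_commute)
  have "w \<notin> C"
  proof
    assume "w \<in> C"
    then obtain d where d: "d \<in> M" "w = f d" using img by auto
    then have "d \<inter> e \<noteq> {}" using f(2)[of d] cw by auto
    then have "d = e" using matching d(1) e by (auto simp: is_matching_def disjoint_def)
    then show False using d(2) cw(2,3) by simp
  qed
  then show "\<exists>c w. e = {c, w} \<and> c \<in> C \<and> w \<notin> C \<and> w \<in> V"
    using cw(1,3) f(2)[OF e] e2 by (intro exI[of _ c] exI[of _ w]) (auto simp: nsets_def)
qed

lemma cover_edge: "e \<in> E \<Longrightarrow> e \<inter> C \<noteq> {}"
  using optimal by (auto simp: is_optimal_vertex_cover_def is_vertex_cover_def)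

lemma M_subset: "M \<subseteq> E" and M_disjoint: "d \<in> M \<Longrightarrow> e \<in> M \<Longrightarrow> d \<inter> e \<noteq> {} \<Longrightarrow> d = e"
  using matching by (auto simp: is_matching_def disjoint_def)

lemma mate_exists: "c \<in> C \<Longrightarrow> \<exists>w. {c, w} \<in> M \<and> w \<notin> C"
proof -
  assume c: "c \<in> C"
  then obtain e where e: "e \<in> M" "c \<in> e" using cover_subset by auto
  then obtain c' w where w: "e = {c', w}" "c' \<in> C" "w \<notin> C" using matching_edge by blast
  with e c have "c' = c" by auto
  with w e show ?thesis by auto
qed

lemma mate_not_cover: "{c, w} \<in> M \<Longrightarrow> c \<in> C \<Longrightarrow> w \<notin> C"
  using matching_edge[of "{c, w}"] by (auto simp: doubleton_eq_iff)

lemma mate_unique: "{c, w} \<in> M \<Longrightarrow> {c', w} \<in> M \<Longrightarrow> c = c'"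
  using M_disjoint[of "{c, w}" "{c', w}"] by (auto simp: doubleton_eq_iff)

lemma mate_unique': "{c, w} \<in> M \<Longrightarrow> {c, w'} \<in> M \<Longrightarrow> w = w'"
  using M_disjoint[of "{c, w}" "{c, w'}"] by (auto simp: doubleton_eq_iff)

lemma matched_in_V: "\<Union>M \<subseteq> V"
  using M_subset edges by (auto simp: nsets_def)

lemma card_matched: "card (\<Union>M) = 2 * matching_number E"
proof -
  have "card (\<Union>M) = sum card M"
    using matching finite_V edges M_subset finite_subset
    by (intro card_Union_disjoint) (auto simp: is_matching_def disjoint_def pairwise_def disjnt_def nsets_def)
  also have "\<dots> = sum (\<lambda>_. 2) M"
    using M_subset edges by (intro sum.cong) (auto simp: nsets_def)
  finally show ?thesis using card_M by simp
qed

lemma card_unmatched: "card (V - \<Union>M) = card V - 2 * matching_number E"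
  using card_Diff_subset[OF finite_subset[OF matched_in_V finite_V] matched_in_V] card_matched by simp

text \<open>An alternating path, recorded only at its vertices outside the cover: one step is a
  graph edge into \<open>C\<close> followed by the matching edge leading out again.\<close>

inductive alternating_reach :: "'a \<Rightarrow> 'a set \<Rightarrow> 'a \<Rightarrow> bool" for u where
  start: "alternating_reach u {} u"
| step: "alternating_reach u F x \<Longrightarrow> {x, c} \<in> E \<Longrightarrow> c \<in> C \<Longrightarrow> c \<notin> F \<Longrightarrow> {c, w} \<in> M
    \<Longrightarrow> alternating_reach u (insert c F) w"

definition reachable :: "'a \<Rightarrow> 'a set" where
  "reachable u = {x. \<exists>F. alternating_reach u F x}"

text \<open>The path passed through each used cover vertex, and its initial segment ends at that
  vertex's partner. Forbidding reuse of cover vertices thus does not shrink the reachable set, which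
  is why the set is closed.\<close>

lemma reach_used: "alternating_reach u F x \<Longrightarrow> c \<in> F \<Longrightarrow> {c, w} \<in> M \<Longrightarrow> w \<in> reachable u"
proof (induction rule: alternating_reach.induct)
  case (step F x c' w')
  show ?case
  proof (cases "c = c'")
    case True
    then have "w = w'" using step mate_unique' by metis
    then show ?thesis using alternating_reach.step[OF step.hyps] by (auto simp: reachable_def)
  qed (use step in auto)
qed auto

lemma reachable_start: "u \<in> reachable u"
  using alternating_reach.start by (auto simp: reachable_def)

lemma reachable_closed:
  assumes "x \<in> reachable u" "{x, c} \<in> E" "c \<in> C"
  shows "\<exists>w \<in> reachable u. {c, w} \<in> M"
proof -
  obtain F where F: "alternating_reach u F x" using assms(1) by (auto simp: reachable_def)
  obtain w where w: "{c, w} \<in> M" using mate_exists assms(3) by blast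
  have "w \<in> reachable u"
  proof (cases "c \<in> F")
    case True then show ?thesis using reach_used F w by blast
  next
    case False
    then show ?thesis using alternating_reach.step[OF F assms(2,3) False w]
      by (auto simp: reachable_def)
  qed
  then show ?thesis using w by blast
qed

lemma reach_matched: "alternating_reach u F x \<Longrightarrow> x = u \<or> x \<in> \<Union>M"
  by (induction rule: alternating_reach.induct) auto

text \<open>The matching is switched along the alternating path; the set \<open>F\<close> of cover vertices already
  used keeps the path simple.\<close>

lemma reach_exchange:
  assumes "alternating_reach u F x" "u \<in> V - \<Union>M"
  shows "\<exists>M'. is_matching E M' \<and> card M' = card M \<and> V - \<Union>M' = insert x (V - \<Union>M - {u}) \<and>
    (\<forall>c \<in> C - F. \<forall>w. {c, w} \<in> M \<longrightarrow> {c, w} \<in> M')"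
  using assms
proof (induction rule: alternating_reach.induct)
  case start
  then show ?case using matching by (intro exI[of _ M]) auto
next
  case (step F x c w)
  then obtain M' where M': "is_matching E M'" "card M' = card M"
    "V - \<Union>M' = insert x (V - \<Union>M - {u})"
    "\<And>c w. c \<in> C - F \<Longrightarrow> {c, w} \<in> M \<Longrightarrow> {c, w} \<in> M'" by auto
  have fE: "finite E" using edges finite_V finite_edges finite_subset by blast
  have fM': "finite M'" using M'(1) fE finite_subset by (auto simp: is_matching_def)
  have sub: "\<Union>M' \<subseteq> V" using M'(1) edges by (auto simp: is_matching_def nsets_def)
  have cw: "{c, w} \<in> M'" using M'(4) step.hyps by auto
  have xM': "x \<notin> \<Union>M'" "x \<in> V" using M'(3) by auto
  have dis: "\<And>d e. d \<in> M' \<Longrightarrow> e \<in> M' \<Longrightarrow> d \<inter> e \<noteq> {} \<Longrightarrow> d = e"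
    using M'(1) by (auto simp: is_matching_def disjoint_def)
  have wC: "w \<notin> C" using mate_not_cover step.hyps by blast
  then have cnw: "c \<noteq> w" using step.hyps by auto
  have cx: "c \<noteq> x" "w \<noteq> x" using xM' cw by auto
  define M'' where "M'' = insert {x, c} (M' - {{c, w}})"
  have notin: "c \<notin> \<Union>(M' - {{c, w}})" "w \<notin> \<Union>(M' - {{c, w}})" using dis[OF _ cw] by auto
  have "is_matching E M''"
  proof -
    have "M'' \<subseteq> E" using M'(1) step.hyps(2) by (auto simp: M''_def is_matching_def)
    moreover have "{x, c} \<inter> e = {}" if "e \<in> M' - {{c, w}}" for e
    proof -
      have "c \<notin> e" "x \<notin> e" using notin(1) xM'(1) that by blast+
      then show ?thesis by blast
    qed
    moreover have "disjoint (M' - {{c, w}})"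
      using M'(1) by (auto simp: is_matching_def pairwise_def)
    ultimately show ?thesis
      unfolding is_matching_def M''_def by (simp add: pairwise_insert disjnt_def Int_commute)
  qed
  moreover have "card M'' = card M"
  proof -
    have "{x, c} \<notin> M'" using xM' by auto
    then have "card M'' = Suc (card (M' - {{c, w}}))" using fM' by (simp add: M''_def)
    also have "\<dots> = card M'" using fM' cw by (metis card_Suc_Diff1)
    finally show ?thesis using M'(2) by simp
  qed
  moreover have "V - \<Union>M'' = insert w (V - \<Union>M - {u})"
  proof -
    have un: "\<Union>M'' = insert x (\<Union>M' - {w})"
    proof -
      have "\<Union>M' = {c, w} \<union> \<Union>(M' - {{c, w}})" using cw by auto
      then have "\<Union>M' - {w} = insert c (\<Union>(M' - {{c, w}}))" using notin cnw by auto
      then show ?thesis by (auto simp: M''_def)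
    qed
    have wV: "w \<in> V" using cw sub by auto
    have "x = u \<or> x \<in> \<Union>M" using reach_matched step.hyps(1) by blast
    then have xU: "x \<notin> V - \<Union>M - {u}" by auto
    have "V - \<Union>M'' = insert w (V - \<Union>M' - {x})" using un wV cx by auto
    also have "\<dots> = insert w (V - \<Union>M - {u})" using M'(3) xU by auto
    finally show ?thesis .
  qed
  moreover have "\<forall>c' \<in> C - insert c F. \<forall>w'. {c', w'} \<in> M \<longrightarrow> {c', w'} \<in> M''"
  proof (intro ballI allI impI)
    fix c' w' assume c': "c' \<in> C - insert c F" "{c', w'} \<in> M"
    then have "{c', w'} \<in> M'" using M'(4)[of c' w'] by auto
    moreover have "{c', w'} \<noteq> {c, w}" using c' wC by (auto simp: doubleton_eq_iff)
    ultimately show "{c', w'} \<in> M''" by (auto simp: M''_def)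
  qed
  ultimately show ?case by blast
qed

text \<open>The partner map embeds the neighbourhood of such a set into the set itself, so it does
  not expand. No starting vertex is mentioned, so unions of reachable sets qualify too.\<close>

definition closed_set :: "'a set \<Rightarrow> bool" where
  "closed_set D \<longleftrightarrow> D \<subseteq> V - C \<and> (\<forall>x\<in>D. \<forall>c. {x, c} \<in> E \<longrightarrow> (\<exists>w\<in>D. {c, w} \<in> M))"

lemma reachable_closed_set:
  assumes "u \<in> V - \<Union>M" shows "closed_set (reachable u)"
proof -
  have "x \<in> V - C" if "alternating_reach u F x" for F x
    using that
  proof cases
    case start then show ?thesis using assms cover_subset by auto
  next
    case (step F x' c)
    then show ?thesis using mate_not_cover[of c x] matched_in_V by auto
  qed
  then have 1: "reachable u \<subseteq> V - C" by (auto simp: reachable_def)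
  have "\<exists>w\<in>reachable u. {c, w} \<in> M" if "x \<in> reachable u" "{x, c} \<in> E" for x c
  proof -
    have "x \<notin> C" using 1 that by auto
    then have "c \<in> C" using cover_edge[OF that(2)] by auto
    then show ?thesis using reachable_closed that by blast
  qed
  then show ?thesis using 1 by (auto simp: closed_set_def)
qed

lemma closed_set_Union: "(\<And>D. D \<in> \<D> \<Longrightarrow> closed_set D) \<Longrightarrow> closed_set (\<Union>\<D>)"
  unfolding closed_set_def by blast

lemma closed_set_card_neighbours:
  assumes "closed_set D"
  shows "card {c. \<exists>x\<in>D. {x, c} \<in> E} \<le> card D"
proof -
  let ?N = "{c. \<exists>x\<in>D. {x, c} \<in> E}"
  have "\<exists>w. w \<in> D \<and> {c, w} \<in> M" if "c \<in> ?N" for c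
    using assms that unfolding closed_set_def by blast
  then obtain f where f: "f c \<in> D \<and> {c, f c} \<in> M" if "c \<in> ?N" for c
    using that[of "\<lambda>c. SOME w. w \<in> D \<and> {c, w} \<in> M"] by (meson someI_ex)
  have "inj_on f ?N"
  proof (rule inj_onI)
    fix c d assume "c \<in> ?N" "d \<in> ?N" "f c = f d"
    then show "c = d" using f[of c] f[of d] mate_unique[of c "f c" d] by simp
  qed
  moreover have "finite D" using assms finite_V finite_subset by (auto simp: closed_set_def)
  ultimately show ?thesis using f by (intro card_inj_on_le[of f]) auto
qed

end

section \<open>Closed sets in locally sparse graphs\<close>

definition low_vertices :: "'a set \<Rightarrow> 'a set set \<Rightarrow> real \<Rightarrow> 'a set" where
  "low_vertices V E d = {v \<in> V. real (card {e \<in> E. v \<in> e}) < d}"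

definition locally_sparse :: "'a set \<Rightarrow> 'a set set \<Rightarrow> real \<Rightarrow> real \<Rightarrow> bool" where
  "locally_sparse V F a h \<longleftrightarrow>
     (\<forall>A\<subseteq>V. A \<noteq> {} \<longrightarrow> real (card A) \<le> a \<longrightarrow> real (card {e \<in> F. e \<subseteq> A}) < h * real (card A))"

lemma finite_low: "finite V \<Longrightarrow> finite (low_vertices V E d)"
  by (simp add: low_vertices_def)

lemma doubleton_other:
  assumes "e \<in> nsets V 2" "x \<in> e" obtains y where "e = {x, y}" "y \<noteq> x" "y \<in> V" "x \<in> V"
proof -
  have c: "card e = 2" and s: "e \<subseteq> V" using assms by (auto simp: nsets_def)
  obtain a b where ab: "e = {a, b}" "a \<noteq> b" using c by (auto simp: card_2_iff)
  show thesis
  proof (cases "x = a")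
    case True
    then show thesis using that[of b] ab s by auto
  next
    case False
    then have "x = b" using ab assms by auto
    then show thesis using that[of a] ab s by auto
  qed
qed

context konig_matching
begin

text \<open>A closed set has at most as many neighbours as elements, so if most of its vertices had
  large degree, it would span too many edges together with its neighbourhood.\<close>

lemma closed_set_small:
  assumes D: "closed_set D" "D \<noteq> {}" and a: "2 * real (card D) \<le> a"
    and sparse: "locally_sparse V E a (d / 4)" and d: "d > 0"
  shows "card D \<le> 2 * card (low_vertices V E d)"
proof (rule ccontr)
  assume neg: "\<not> ?thesis"
  define J where "J = low_vertices V E d"
  define N where "N = {c. \<exists>x\<in>D. {x, c} \<in> E}"
  have finE: "finite E" using edges finite_V finite_edges finite_subset by blast
  have DV: "D \<subseteq> V - C" using D by (simp add: closed_set_def)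
  then have finD: "finite D" using finite_V finite_subset by blast
  have NV: "N \<subseteq> V" using edges by (auto simp: N_def)
  have cN: "card N \<le> card D" using closed_set_card_neighbours[OF D(1)] by (simp add: N_def)
  have cA: "card (D \<union> N) \<le> 2 * card D" using card_Un_le[of D N] cN by simp
  have fJ: "finite J" using finite_low finite_V by (simp add: J_def)
  have "card D \<le> card (D - J) + card J"
    using card_Un_le[of "D - J" J] card_mono[of "(D - J) \<union> J" D] finD fJ by auto
  then have cDJ: "real (card D) \<le> 2 * real (card (D - J))" using neg by (simp add: J_def)
  have deg: "d \<le> real (card {e \<in> E. x \<in> e})" if "x \<in> D - J" for x
    using that DV by (auto simp: J_def low_vertices_def)
  have sub: "(\<Union>x\<in>D - J. {e \<in> E. x \<in> e}) \<subseteq> {e \<in> E. e \<subseteq> D \<union> N}"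
  proof
    fix e assume "e \<in> (\<Union>x\<in>D - J. {e \<in> E. x \<in> e})"
    then obtain x where e: "e \<in> E" "x \<in> e" "x \<in> D" by blast
    then obtain y where "e = {x, y}" using doubleton_other edges by (metis subsetD)
    then show "e \<in> {e \<in> E. e \<subseteq> D \<union> N}" using e by (auto simp: N_def)
  qed
  \<comment> \<open>\<open>D\<close> avoids the cover, so no edge joins two of its vertices and the
    degree sum counts every edge once.\<close>
  have dis: "{e \<in> E. x \<in> e} \<inter> {e \<in> E. y \<in> e} = {}" if "x \<in> D - J" "y \<in> D - J" "x \<noteq> y" for x y
  proof (rule ccontr)
    assume "\<not> ?thesis"
    then obtain e where e: "e \<in> E" "x \<in> e" "y \<in> e" by auto
    then obtain z where "e = {x, z}" using doubleton_other edges by (metis subsetD)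
    then have "e = {x, y}" using e that by auto
    then show False using cover_edge[OF e(1)] DV that by auto
  qed
  have "d * real (card (D - J)) = (\<Sum>x\<in>D - J. d)" by simp
  also have "\<dots> \<le> (\<Sum>x\<in>D - J. real (card {e \<in> E. x \<in> e}))" using deg by (intro sum_mono)
  also have "\<dots> = real (card (\<Union>x\<in>D - J. {e \<in> E. x \<in> e}))"
    using finD finE dis by (subst card_UN_disjoint) auto
  also have "\<dots> \<le> real (card {e \<in> E. e \<subseteq> D \<union> N})"
    using sub finE by (intro of_nat_mono card_mono) auto
  also have "\<dots> < d / 4 * real (card (D \<union> N))"
  proof -
    have "real (card (D \<union> N)) \<le> a" using cA a by linarith
    moreover have "D \<union> N \<subseteq> V" "D \<union> N \<noteq> {}" using DV NV D(2) by auto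
    ultimately show ?thesis using sparse by (simp add: locally_sparse_def)
  qed
  also have "\<dots> \<le> d / 4 * (2 * real (card D))"
    using cA d by (intro mult_left_mono) auto
  finally have "2 * real (card (D - J)) < real (card D)" using d by (simp add: field_simps)
  then show False using cDJ by simp
qed

text \<open>A bootstrap over unions. With \<open>J\<close> the set of low vertices, a closed set of
  size at most \<open>b\<close> has at most 2|J| elements. Adding one more small reachable set gives
  at most 4|J| <= \<open>b\<close>, so the union is again in range and drops back to 2|J|.\<close>

lemma few_unmatched_small_reach:
  assumes sparse: "locally_sparse V E (2 * b) (d / 4)" and d: "d > 0"
    and J: "4 * real (card (low_vertices V E d)) \<le> b"
  shows "card {u \<in> V - \<Union>M. real (card (reachable u)) \<le> b} \<le> 2 * card (low_vertices V E d)"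
proof -
  let ?S = "{u \<in> V - \<Union>M. real (card (reachable u)) \<le> b}"
  let ?J = "low_vertices V E d"
  have finS: "finite ?S" using finite_V by simp
  have reach: "closed_set (reachable u)" "reachable u \<noteq> {}" if "u \<in> ?S" for u
    using that reachable_closed_set reachable_start by auto
  have small: "card D \<le> 2 * card ?J" if "closed_set D" "D \<noteq> {}" "real (card D) \<le> b" for D
    using closed_set_small[OF that(1,2) _ sparse d] that(3) by simp
  have "card (\<Union>(reachable ` T)) \<le> 2 * card ?J" if "finite T" "T \<subseteq> ?S" for T
    using that
  proof (induction T rule: finite_induct)
    case (insert u T)
    have "card (reachable u) \<le> 2 * card ?J" using insert.prems reach[of u] by (intro small) auto
    then have "card (\<Union>(reachable ` insert u T)) \<le> 4 * card ?J"
      using card_Un_le[of "reachable u" "\<Union>(reachable ` T)"] insert by auto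
    then have "real (card (\<Union>(reachable ` insert u T))) \<le> b" using J by linarith
    moreover have "closed_set (\<Union>(reachable ` insert u T))"
      using reach insert.prems by (intro closed_set_Union) blast
    moreover have "\<Union>(reachable ` insert u T) \<noteq> {}" using reachable_start by blast
    ultimately show ?case using small by blast
  qed simp
  from this[OF finS order_refl] have c: "card (\<Union>(reachable ` ?S)) \<le> 2 * card ?J" .
  have "?S \<subseteq> \<Union>(reachable ` ?S)" using reachable_start by auto
  moreover have "finite (\<Union>(reachable ` ?S))"
  proof (rule finite_subset[OF _ finite_V])
    show "\<Union>(reachable ` ?S) \<subseteq> V" using reach by (auto simp: closed_set_def)
  qed
  ultimately have "card ?S \<le> card (\<Union>(reachable ` ?S))" by (intro card_mono)
  then show ?thesis using c by simp
qed

text \<open>At least 2|J| + 2 vertices are unmatched and at most 2|J| of them have small reach, so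
  one choice \<open>x\<close> can be excluded. The exclusion is needed when the lemma is applied a
  second time, after \<open>x\<close> has been freed.\<close>

lemma large_reach_exists:
  assumes sparse: "locally_sparse V E (2 * b) (d / 4)" and d: "d > 0"
    and J: "4 * real (card (low_vertices V E d)) \<le> b"
    and U: "2 * matching_number E + 2 * card (low_vertices V E d) + 2 \<le> card V"
  shows "\<exists>u \<in> V - \<Union>M. u \<noteq> x \<and> b < real (card (reachable u))"
proof (rule ccontr)
  assume neg: "\<not> ?thesis"
  let ?S = "{u \<in> V - \<Union>M. real (card (reachable u)) \<le> b}"
  have "V - \<Union>M \<subseteq> insert x ?S" using neg by auto
  then have "card (V - \<Union>M) \<le> card (insert x ?S)" using finite_V by (intro card_mono) auto
  also have "\<dots> \<le> Suc (card ?S)" using finite_V by (simp add: card_insert_if)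
  also have "\<dots> \<le> Suc (2 * card (low_vertices V E d))"
    using few_unmatched_small_reach[OF sparse d J] by simp
  finally show False using card_unmatched U by simp
qed

end

lemma konig_matching_exists:
  assumes V: "finite V" and E: "E \<subseteq> nsets V 2" and K: "konig_graph V E"
  shows "\<exists>C M. konig_matching V E C M"
proof -
  obtain C where "is_optimal_vertex_cover V E C" using optimal_cover_exists[OF V E] by blast
  moreover obtain M where "is_matching E M" "card M = matching_number E"
    using maximum_matching_exists finite_subset[OF E finite_edges[OF V]] by blast
  ultimately show ?thesis using assms unfolding konig_matching_def by blast
qed

text \<open>There are at least b^2 ordered pairs, and each unordered pair arises from at most two of
  them.\<close>

lemma card_doubletons_ge:
  assumes fin: "finite P" and b: "b \<ge> 0" and X: "b \<le> real (card X)" "finite X"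
    and Y: "\<And>x. x \<in> X \<Longrightarrow> b \<le> real (card (Y x)) \<and> finite (Y x)"
    and P: "\<And>x y. x \<in> X \<Longrightarrow> y \<in> Y x \<Longrightarrow> {x, y} \<in> P"
  shows "b\<^sup>2 / 2 \<le> real (card P)"
proof -
  define P' where "P' = P \<inter> {e. \<exists>x y. e = {x, y}}"
  have "b\<^sup>2 \<le> real (card X) * b" using X b by (simp add: power2_eq_square mult_right_mono)
  also have "\<dots> = (\<Sum>x\<in>X. b)" by simp
  also have "\<dots> \<le> (\<Sum>x\<in>X. real (card (Y x)))" using Y by (intro sum_mono) auto
  also have "\<dots> = real (card (Sigma X Y))" using X Y by (subst card_SigmaI) auto
  also have "\<dots> \<le> real (card (\<Union>e\<in>P'. {p. {fst p, snd p} = e}))"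
  proof (intro of_nat_mono card_mono)
    have "finite {p. {fst p, snd p} = e}" if "e \<in> P'" for e
    proof (rule finite_subset)
      show "{p. {fst p, snd p} = e} \<subseteq> e \<times> e" by auto
      show "finite (e \<times> e)" using that by (auto simp: P'_def)
    qed
    then show "finite (\<Union>e\<in>P'. {p. {fst p, snd p} = e})" using fin by (auto simp: P'_def)
    show "Sigma X Y \<subseteq> (\<Union>e\<in>P'. {p. {fst p, snd p} = e})" using P by (auto simp: P'_def) blast
  qed
  also have "\<dots> \<le> real (\<Sum>e\<in>P'. card {p. {fst p, snd p} = e})"
    using fin by (intro of_nat_mono card_UN_le) (auto simp: P'_def)
  also have "\<dots> \<le> real (\<Sum>e\<in>P'. 2)"
  proof (intro of_nat_mono sum_mono)
    fix e assume "e \<in> P'"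
    then obtain x y where e: "e = {x, y}" by (auto simp: P'_def)
    have "{p. {fst p, snd p} = e} \<subseteq> set [(x, y), (y, x)]"
      unfolding e doubleton_eq_iff by (auto simp: prod_eq_iff)
    then have "card {p. {fst p, snd p} = e} \<le> card (set [(x, y), (y, x)])"
      by (intro card_mono) auto
    also have "\<dots> \<le> 2" using card_length[of "[(x, y), (y, x)]"] by simp
    finally show "card {p. {fst p, snd p} = e} \<le> 2" .
  qed
  also have "\<dots> \<le> real (2 * card P)"
    using fin card_mono[of P P'] by (auto simp: P'_def)
  finally show ?thesis by simp
qed

lemma finite_augmenting: "finite V \<Longrightarrow> finite (augmenting_pairs V E)"
  unfolding augmenting_pairs_def by (rule finite_subset[OF _ finite_edges]) auto

text \<open>Two successive switches. The first frees an arbitrary \<open>x\<close> in a large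
  reachable set. In the resulting matching a second unmatched vertex \<open>v\<close> different from
  \<open>x\<close> has large reach, and switching from \<open>v\<close> to \<open>y\<close> keeps
  \<open>x\<close> free, so {x, y} is missed by a maximum matching. Recomputing reachability after
  the first switch avoids any question of the two paths crossing.\<close>

lemma many_augmenting_pairs:
  assumes V: "finite V" and E: "E \<subseteq> nsets V 2" and K: "konig_graph V E"
    and sparse: "locally_sparse V E (2 * b) (d / 4)" and d: "d > 0" and b: "b \<ge> 0"
    and J: "4 * real (card (low_vertices V E d)) \<le> b"
    and U: "2 * matching_number E + 2 * card (low_vertices V E d) + 2 \<le> card V"
  shows "b\<^sup>2 / 2 \<le> real (card (augmenting_pairs V E))"
proof -
  obtain C M where "konig_matching V E C M" using konig_matching_exists[OF V E K] by blast
  then interpret konig_matching V E C M .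
  note M = matching card_M and C = optimal
  obtain u where u: "u \<in> V - \<Union>M" "b < real (card (reachable u))"
    using large_reach_exists[OF sparse d J U] by blast
  have finr: "finite (reachable u)" if "u \<in> V - \<Union>M" for u
    using reachable_closed_set[OF that] V finite_subset by (fastforce simp: closed_set_def)
  have "\<exists>Y. finite Y \<and> b \<le> real (card Y) \<and> (\<forall>y\<in>Y. {x, y} \<in> augmenting_pairs V E)"
    if x: "x \<in> reachable u" for x
  proof -
    obtain F where "alternating_reach u F x" using x by (auto simp: reachable_def)
    then obtain M' where M': "is_matching E M'" "card M' = card M"
      "V - \<Union>M' = insert x (V - \<Union>M - {u})"
      using reach_exchange u(1) by blast
    interpret M': konig_matching V E C M' using V E K C M' M by unfold_locales auto
    obtain v where v: "v \<in> V - \<Union>M'" "v \<noteq> x" "b < real (card (M'.reachable v))"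
      using M'.large_reach_exists[OF sparse d J U] by blast
    have xM': "x \<in> V - \<Union>M'" using M'(3) by auto
    have "{x, y} \<in> augmenting_pairs V E" if y: "y \<in> M'.reachable v" for y
    proof -
      obtain F where F: "M'.alternating_reach v F y" using y by (auto simp: M'.reachable_def)
      obtain M'' where M'': "is_matching E M''" "card M'' = card M'"
        "V - \<Union>M'' = insert y (V - \<Union>M' - {v})"
        using M'.reach_exchange[OF F v(1)] by blast
      have "x \<in> V - \<Union>M''" "y \<in> V - \<Union>M''" using M''(3) xM' v(2) by auto
      moreover have "x \<noteq> y" using M'.reach_matched[OF F] v(2) xM' by auto
      ultimately show ?thesis
        using M'' M' M by (auto simp: augmenting_pairs_def intro!: exI[of _ M''])
    qed
    moreover have "finite (M'.reachable v)"
      using M'.reachable_closed_set[OF v(1)] V finite_subset by (fastforce simp: M'.closed_set_def)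
    ultimately show ?thesis using v(3) by (intro exI[of _ "M'.reachable v"]) auto
  qed
  then obtain Y where "\<And>x. x \<in> reachable u \<Longrightarrow> finite (Y x) \<and> b \<le> real (card (Y x)) \<and>
    (\<forall>y\<in>Y x. {x, y} \<in> augmenting_pairs V E)" by metis
  then show ?thesis using u finr[OF u(1)] b finite_augmenting[OF V]
    by (intro card_doubletons_ge[of _ _ "reachable u" Y]) auto
qed

text \<open>This crude count needs no sparsity or degree information, so it serves the initial
  phase, when the deficiency is still linear.\<close>

lemma augmenting_pairs_unmatched:
  assumes V: "finite V" and E: "E \<subseteq> nsets V 2" and K: "konig_graph V E"
  shows "(card V - 2 * matching_number E) choose 2 \<le> card (augmenting_pairs V E)"
proof -
  obtain C M where "konig_matching V E C M" using konig_matching_exists[OF V E K] by blast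
  then interpret konig_matching V E C M .
  note M = matching card_M and C = optimal
  have "nsets (V - \<Union>M) 2 \<subseteq> augmenting_pairs V E"
    using M by (auto simp: augmenting_pairs_def nsets_def intro!: exI[of _ M])
  then have "card (nsets (V - \<Union>M) 2) \<le> card (augmenting_pairs V E)"
    using V by (intro card_mono finite_augmenting)
  then show ?thesis using V by (simp add: card_unmatched)
qed

lemma double_matching_number_le:
  assumes V: "finite V" and E: "E \<subseteq> nsets V 2" and K: "konig_graph V E"
  shows "2 * matching_number E \<le> card V"
proof -
  obtain C M where "konig_matching V E C M" using konig_matching_exists[OF V E K] by blast
  then interpret konig_matching V E C M .
  note M = matching card_M and C = optimal
  show ?thesis using card_matched card_mono[OF V matched_in_V] by simp
qed

lemma perfect_matching_if_double:
  assumes V: "finite V" and E: "E \<subseteq> nsets V 2" and K: "konig_graph V E"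
    and "2 * matching_number E = card V"
  shows "has_perfect_matching V E"
proof -
  obtain C M where "konig_matching V E C M" using konig_matching_exists[OF V E K] by blast
  then interpret konig_matching V E C M .
  note M = matching card_M and C = optimal
  have "\<Union>M = V" using card_matched matched_in_V assms by (intro card_subset_eq) auto
  then show ?thesis using M by (auto simp: has_perfect_matching_def)
qed

section \<open>The process along prefixes of the edge ordering\<close>

text \<open>Making the graph a function of the revealed list alone lets it enter weights that depend
  on a prefix, and turns the process into an induction on appended elements.\<close>

definition process_graph :: "'a set \<Rightarrow> 'a set list \<Rightarrow> 'a set set" where
  "process_graph V xs = konig_process V xs (length xs)"

lemma konig_process_append:
  "m \<le> length xs \<Longrightarrow> konig_process V (xs @ ys) m = konig_process V xs m"
  by (induction m) (auto simp: nth_append)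

lemma konig_process_take: "m \<le> length es \<Longrightarrow> konig_process V es m = process_graph V (take m es)"
  using konig_process_append[of m "take m es" V "drop m es"] by (simp add: process_graph_def)

lemma konig_process_ge_length: "konig_process V es (length es + k) = process_graph V es"
  by (induction k) (auto simp: process_graph_def)

lemma process_graph_Nil [simp]: "process_graph V [] = {}"
  by (simp add: process_graph_def)

lemma process_graph_snoc:
  "process_graph V (xs @ [e]) =
    (if konig_graph V (insert e (process_graph V xs)) then insert e (process_graph V xs)
     else process_graph V xs)"
  by (simp add: process_graph_def konig_process_append nth_append)

lemma process_graph_subset: "process_graph V xs \<subseteq> set xs"
  by (induction xs rule: rev_induct) (auto simp: process_graph_snoc)

lemma process_graph_mono: "process_graph V xs \<subseteq> process_graph V (xs @ ys)"
  by (induction ys rule: rev_induct)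
    (auto simp: process_graph_snoc simp flip: append_assoc)

lemma konig_empty:
  fixes V :: "'a set" assumes V: "finite V" shows "konig_graph V {}"
proof -
  have "vertex_cover_number V {} \<le> card ({} :: 'a set)"
    by (rule vertex_cover_number_le[OF V]) (simp add: is_vertex_cover_def)
  then show ?thesis using matching_number_le_cover_number[OF V, of "{}"]
    by (simp add: konig_graph_def)
qed

lemma process_graph_konig: "finite V \<Longrightarrow> konig_graph V (process_graph V xs)"
  by (induction xs rule: rev_induct) (auto simp: process_graph_snoc konig_empty)

lemma process_graph_edges: "set xs \<subseteq> nsets V 2 \<Longrightarrow> process_graph V xs \<subseteq> nsets V 2"
  using process_graph_subset by blast

lemma process_accepts:
  assumes "finite V" "set xs \<subseteq> nsets V 2" "e \<in> nsets V 2"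
    "is_optimal_vertex_cover V (process_graph V xs) C" "e \<inter> C \<noteq> {}"
  shows "e \<in> process_graph V (xs @ [e])"
  using konig_insert_covered(1)[OF assms(1) process_graph_edges process_graph_konig] assms
  by (auto simp: process_graph_snoc)

abbreviation "nu V xs \<equiv> matching_number (process_graph V xs)"

lemma nu_augment:
  assumes "finite V" "set xs \<subseteq> nsets V 2" "e \<in> augmenting_pairs V (process_graph V xs)"
  shows "nu V (xs @ [e]) = Suc (nu V xs)"
  using konig_insert_augmenting[OF assms(1) process_graph_edges[OF assms(2)]
      process_graph_konig[OF assms(1)] assms(3)]
  by (simp add: process_graph_snoc)

lemma nu_le: "finite V \<Longrightarrow> set xs \<subseteq> nsets V 2 \<Longrightarrow> 2 * nu V xs \<le> card V"
  by (intro double_matching_number_le process_graph_konig process_graph_edges)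

text \<open>The choice depends on the prefix only, so sets built from this cover are known before
  the next pair is offered.\<close>

definition canonical_cover :: "'a set \<Rightarrow> 'a set list \<Rightarrow> 'a set" where
  "canonical_cover V xs = (SOME C. is_optimal_vertex_cover V (process_graph V xs) C)"

lemma canonical_cover:
  assumes "finite V" "set xs \<subseteq> nsets V 2"
  shows "is_optimal_vertex_cover V (process_graph V xs) (canonical_cover V xs)"
    "canonical_cover V xs \<subseteq> V" "card (canonical_cover V xs) = nu V xs"
proof -
  show 1: "is_optimal_vertex_cover V (process_graph V xs) (canonical_cover V xs)"
    unfolding canonical_cover_def
    by (rule someI_ex[OF optimal_cover_exists[OF assms(1) process_graph_edges[OF assms(2)]]])
  show "canonical_cover V xs \<subseteq> V" "card (canonical_cover V xs) = nu V xs"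
    using 1 process_graph_konig[OF assms(1), of xs]
    by (auto simp: is_optimal_vertex_cover_def is_vertex_cover_def konig_graph_def)
qed

section \<open>Exponential tail bounds for a random ordering\<close>

text \<open>Revealing the ordering one element at a time, the product of the weights is a
  supermartingale.\<close>

lemma sum_permutations_prod_le:
  fixes W :: "'b list \<Rightarrow> 'b \<Rightarrow> real"
  assumes "finite A" "t \<le> card A" "\<And>xs e. 0 \<le> W xs e"
    "\<And>xs. distinct xs \<Longrightarrow> set xs \<subseteq> A \<Longrightarrow> length xs < t \<Longrightarrow>
       (\<Sum>e\<in>A - set xs. W xs e) \<le> real (card (A - set xs))"
  shows "(\<Sum>es\<in>permutations_of_set A. \<Prod>i<t. W (take i es) (es ! i)) \<le> fact (card A)"
  using assms
proof (induction t arbitrary: A W)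
  case 0
  then show ?case by simp
next
  case (Suc t)
  have ne: "A \<noteq> {}" using Suc.prems by auto
  have "(\<Sum>es\<in>permutations_of_set A. \<Prod>i<Suc t. W (take i es) (es ! i)) =
    (\<Sum>x\<in>A. \<Sum>es\<in>(#) x ` permutations_of_set (A - {x}). \<Prod>i<Suc t. W (take i es) (es ! i))"
    unfolding permutations_of_set_nonempty[OF ne]
    by (rule sum.UNION_disjoint) (use Suc.prems in auto)
  also have "\<dots> = (\<Sum>x\<in>A. W [] x *
      (\<Sum>es\<in>permutations_of_set (A - {x}). \<Prod>i<t. W (x # take i es) (es ! i)))"
    by (subst sum.reindex) (auto simp: prod.lessThan_Suc_shift sum_distrib_left simp del: prod.lessThan_Suc)
  also have "\<dots> \<le> (\<Sum>x\<in>A. W [] x * fact (card A - 1))"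
  proof (intro sum_mono mult_left_mono)
    fix x assume x: "x \<in> A"
    have cA: "card (A - {x}) = card A - 1" using x Suc.prems(1) by simp
    have "(\<Sum>es\<in>permutations_of_set (A - {x}). \<Prod>i<t. W (x # take i es) (es ! i))
      \<le> fact (card (A - {x}))"
    proof (rule Suc.IH)
      fix xs assume xs: "distinct xs" "set xs \<subseteq> A - {x}" "length xs < t"
      have "A - {x} - set xs = A - set (x # xs)" by auto
      moreover have "(\<Sum>e\<in>A - set (x # xs). W (x # xs) e) \<le> real (card (A - set (x # xs)))"
        by (rule Suc.prems(4)) (use xs x in auto)
      ultimately show "(\<Sum>e\<in>A - {x} - set xs. W (x # xs) e) \<le> real (card (A - {x} - set xs))"
        by (simp only:)
    qed (use Suc.prems cA in auto)
    then show "(\<Sum>es\<in>permutations_of_set (A - {x}). \<Prod>i<t. W (x # take i es) (es ! i))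
      \<le> fact (card A - 1)" using cA by simp
  qed (use Suc.prems in auto)
  also have "\<dots> = (\<Sum>x\<in>A. W [] x) * fact (card A - 1)" by (simp add: sum_distrib_right)
  also have "\<dots> \<le> real (card A) * fact (card A - 1)"
    using Suc.prems(4)[of "[]"] by (intro mult_right_mono) auto
  also have "\<dots> = fact (card A)"
    using ne Suc.prems(1) by (subst (2) fact_reduce) (auto simp: card_gt_0_iff)
  finally show ?case .
qed

abbreviation edge_orders :: "'a set \<Rightarrow> 'a set list set" where
  "edge_orders V \<equiv> permutations_of_set (nsets V 2)"

abbreviation edge_prob :: "'a set \<Rightarrow> 'a set list set \<Rightarrow> real" where
  "edge_prob V S \<equiv> measure_pmf.prob (random_edge_ordering V) S"

lemma edge_prob_eq:
  assumes "finite V"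
  shows "edge_prob V S = real (card (edge_orders V \<inter> S)) / fact (card (nsets V 2))"
  using finite_edges[OF assms]
  by (simp add: random_edge_ordering_def measure_pmf_of_set)

lemma edge_prob_mono:
  assumes "finite V" "\<And>es. es \<in> edge_orders V \<Longrightarrow> es \<in> S \<Longrightarrow> es \<in> T"
  shows "edge_prob V S \<le> edge_prob V T"
  unfolding edge_prob_eq[OF assms(1)]
  by (intro divide_right_mono of_nat_mono card_mono) (use assms(2) in auto)

lemma edge_prob_UN:
  "finite I \<Longrightarrow> edge_prob V (\<Union>i\<in>I. S i) \<le> (\<Sum>i\<in>I. edge_prob V (S i))"
  by (rule measure_pmf.finite_measure_subadditive_finite) auto

lemma edge_prob_UN_le:
  assumes "finite I" "\<And>i. i \<in> I \<Longrightarrow> edge_prob V (S i) \<le> b"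
  shows "edge_prob V (\<Union>i\<in>I. S i) \<le> real (card I) * b"
  using edge_prob_UN[OF assms(1), of V S] sum_mono[of I "\<lambda>i. edge_prob V (S i)" "\<lambda>_. b"] assms(2)
  by simp

abbreviation fresh :: "'a set \<Rightarrow> 'a set list \<Rightarrow> 'a set set" where
  "fresh V xs \<equiv> nsets V 2 - set xs"

definition prefix_of :: "'a set \<Rightarrow> nat \<Rightarrow> 'a set list \<Rightarrow> bool" where
  "prefix_of V t xs \<longleftrightarrow> distinct xs \<and> set xs \<subseteq> nsets V 2 \<and> length xs < t"

text \<open>Markov's inequality: the expected product of the weights is at most 1.\<close>

lemma edge_markov:
  assumes V: "finite V" and t: "t \<le> card (nsets V 2)" and W0: "\<And>xs e. 0 \<le> W xs e"
    and W: "\<And>xs. prefix_of V t xs \<Longrightarrow>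
       (\<Sum>e\<in>fresh V xs. W xs e) \<le> real (card (fresh V xs))"
    and b: "b > 0"
    and S: "\<And>es. es \<in> edge_orders V \<Longrightarrow> es \<in> S \<Longrightarrow>
       b \<le> (\<Prod>i<t. W (take i es) (es ! i))"
  shows "edge_prob V S \<le> 1 / b"
proof -
  let ?P = "edge_orders V"
  have "real (card (?P \<inter> S)) * b = (\<Sum>es\<in>?P \<inter> S. b)" by simp
  also have "\<dots> \<le> (\<Sum>es\<in>?P \<inter> S. \<Prod>i<t. W (take i es) (es ! i))"
    using S by (intro sum_mono) auto
  also have "\<dots> \<le> (\<Sum>es\<in>?P. \<Prod>i<t. W (take i es) (es ! i))"
    using W0 by (intro sum_mono2) (auto intro!: prod_nonneg)
  also have "\<dots> \<le> fact (card (nsets V 2))"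
    using finite_edges[OF V] t W0 W by (intro sum_permutations_prod_le) (auto simp: prefix_of_def)
  finally show ?thesis using b unfolding edge_prob_eq[OF V]
    by (simp add: field_simps)
qed

text \<open>The target set may change with time but is fixed by the prefix before the offered pair
  is seen, as for a predictable process.\<close>

definition hits :: "('a set list \<Rightarrow> 'a set set) \<Rightarrow> nat \<Rightarrow> 'a set list \<Rightarrow> nat" where
  "hits S t es = card {i. i < t \<and> es ! i \<in> S (take i es)}"

lemma sum_two_valued:
  fixes a b :: real
  assumes "finite B"
  shows "(\<Sum>e\<in>B. if e \<in> S then a else b) = a * real (card (S \<inter> B)) + b * (real (card B) - real (card (S \<inter> B)))"
proof -
  have "card B = card (S \<inter> B) + card (B - S)"
    using card_Int_Diff[OF assms, of S] by (simp add: Int_commute)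
  then show ?thesis using assms
    by (subst sum.If_cases) (auto simp: Int_commute Diff_eq)
qed

lemma prod_hits:
  fixes a :: real
  shows "(\<Prod>i<t. (if es ! i \<in> S (take i es) then a else 1) * exp (g (take i es))) =
     a ^ hits S t es * exp (\<Sum>i<t. g (take i es))"
proof -
  have "(\<Prod>i<t. if es ! i \<in> S (take i es) then a else 1) = a ^ hits S t es"
    unfolding hits_def by (subst prod.If_cases) (auto intro!: arg_cong[of _ _ "\<lambda>x. a ^ card x"])
  then show ?thesis by (simp add: prod.distrib exp_sum)
qed

text \<open>Each hit has weight \<open>z\<close>, and the factor exp((1-z) p) compensates, since (1
  - (1-z) p) exp((1-z) p) <= 1. The condition \<open>z ^ D > 0\<close> still admits z = 0 with D =
  0, where 0^0 = 1; that case handles events with no hit at all.\<close>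

lemma hits_lower_tail:
  fixes z l :: real
  assumes V: "finite V" and t: "t \<le> card (nsets V 2)"
    and z: "0 \<le> z" "z \<le> 1" "z ^ D > 0"
    and p: "\<And>xs. prefix_of V t xs \<Longrightarrow>
       p xs * real (card (fresh V xs)) \<le> real (card (S xs \<inter> (fresh V xs)))"
    and E: "\<And>es. es \<in> edge_orders V \<Longrightarrow> es \<in> E \<Longrightarrow>
       hits S t es \<le> D \<and> l \<le> (\<Sum>i<t. p (take i es))"
  shows "edge_prob V E \<le> exp (- (1 - z) * l) / z ^ D"
proof -
  define W where "W xs e = (if e \<in> S xs then z else 1) * exp ((1 - z) * p xs)" for xs e
  have "edge_prob V E \<le> 1 / (z ^ D * exp ((1 - z) * l))"
  proof (rule edge_markov[OF V t, of W])
    fix xs assume xs: "prefix_of V t xs"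
    let ?B = "fresh V xs"
    have fin: "finite ?B" using finite_edges V by auto
    have "(\<Sum>e\<in>?B. W xs e) = (\<Sum>e\<in>?B. if e \<in> S xs then z else 1) * exp ((1 - z) * p xs)"
      by (simp add: W_def sum_distrib_right)
    also have "\<dots> = (real (card ?B) - (1 - z) * real (card (S xs \<inter> ?B))) * exp ((1 - z) * p xs)"
      unfolding sum_two_valued[OF fin] by (simp add: algebra_simps)
    also have "\<dots> \<le> (real (card ?B) - (1 - z) * (p xs * real (card ?B))) * exp ((1 - z) * p xs)"
      using p[OF xs] z by (intro mult_right_mono diff_left_mono mult_left_mono) auto
    also have "\<dots> = real (card ?B) * ((1 - (1 - z) * p xs) * exp ((1 - z) * p xs))"
      by (simp add: algebra_simps)
    also have "\<dots> \<le> real (card ?B) * 1"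
    proof (intro mult_left_mono)
      have "(1 - (1 - z) * p xs) * exp ((1 - z) * p xs) \<le> exp (- ((1 - z) * p xs)) * exp ((1 - z) * p xs)"
        using exp_ge_add_one_self[of "- ((1 - z) * p xs)"] by (intro mult_right_mono) auto
      then show "(1 - (1 - z) * p xs) * exp ((1 - z) * p xs) \<le> 1" by (simp flip: exp_add)
    qed auto
    finally show "(\<Sum>e\<in>?B. W xs e) \<le> real (card ?B)" by simp
  next
    fix es assume es: "es \<in> edge_orders V" "es \<in> E"
    have "z ^ D * exp ((1 - z) * l) \<le> z ^ hits S t es * exp (\<Sum>i<t. (1 - z) * p (take i es))"
      using E[OF es] z unfolding sum_distrib_left[symmetric]
      by (intro mult_mono power_decreasing) (auto intro!: mult_left_mono)
    then show "z ^ D * exp ((1 - z) * l) \<le> (\<Prod>i<t. W (take i es) (es ! i))"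
      unfolding W_def prod_hits[where g = "\<lambda>xs. (1 - z) * p xs"] .
  qed (use z in \<open>auto simp: W_def\<close>)
  also have "\<dots> = exp (- (1 - z) * l) / z ^ D"
  proof -
    have "exp (- (1 - z) * l) = 1 / exp ((1 - z) * l)"
      using exp_minus[of "(1 - z) * l"] by (simp only: mult_minus_left inverse_eq_divide)
    then show ?thesis by simp
  qed
  finally show ?thesis .
qed

text \<open>The same argument with weight exp(u) for a hit, compensated through 1 + x <=
  exp(x).\<close>

lemma hits_upper_tail:
  fixes u l D :: real
  assumes V: "finite V" and t: "t \<le> card (nsets V 2)"
    and u: "0 \<le> u"
    and p: "\<And>xs. prefix_of V t xs \<Longrightarrow>
       real (card (S xs \<inter> (fresh V xs))) \<le> p xs * real (card (fresh V xs))"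
    and E: "\<And>es. es \<in> edge_orders V \<Longrightarrow> es \<in> E \<Longrightarrow>
       D \<le> real (hits S t es) \<and> (exp u - 1) * (\<Sum>i<t. p (take i es)) \<le> l"
  shows "edge_prob V E \<le> exp (l - u * D)"
proof -
  define W where "W xs e = (if e \<in> S xs then exp u else 1) * exp (- (exp u - 1) * p xs)" for xs e
  have eu: "exp u - 1 \<ge> 0" using u by simp
  have "edge_prob V E \<le> 1 / (exp (u * D - l))"
  proof (rule edge_markov[OF V t, of W])
    fix xs assume xs: "prefix_of V t xs"
    let ?B = "fresh V xs"
    have fin: "finite ?B" using finite_edges V by auto
    have "(\<Sum>e\<in>?B. W xs e) = (\<Sum>e\<in>?B. if e \<in> S xs then exp u else 1) * exp (- (exp u - 1) * p xs)"
      by (simp add: W_def sum_distrib_right)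
    also have "\<dots> = (real (card ?B) + (exp u - 1) * real (card (S xs \<inter> ?B))) * exp (- (exp u - 1) * p xs)"
      unfolding sum_two_valued[OF fin] by (simp add: algebra_simps)
    also have "\<dots> \<le> (real (card ?B) + (exp u - 1) * (p xs * real (card ?B))) * exp (- (exp u - 1) * p xs)"
      using p[OF xs] eu by (intro mult_right_mono add_left_mono mult_left_mono) auto
    also have "\<dots> = real (card ?B) * ((1 + (exp u - 1) * p xs) * exp (- (exp u - 1) * p xs))"
      by (simp add: algebra_simps)
    also have "\<dots> \<le> real (card ?B) * 1"
    proof (intro mult_left_mono)
      have "(1 + (exp u - 1) * p xs) * exp (- (exp u - 1) * p xs)
          \<le> exp ((exp u - 1) * p xs) * exp (- (exp u - 1) * p xs)"
        using exp_ge_add_one_self[of "(exp u - 1) * p xs"] by (intro mult_right_mono) auto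
      also have "\<dots> = exp ((exp u - 1) * p xs + - (exp u - 1) * p xs)" by (rule exp_add[symmetric])
      also have "\<dots> = 1" by (simp add: algebra_simps)
      finally show "(1 + (exp u - 1) * p xs) * exp (- (exp u - 1) * p xs) \<le> 1" .
    qed auto
    finally show "(\<Sum>e\<in>?B. W xs e) \<le> real (card ?B)" by simp
  next
    fix es assume es: "es \<in> edge_orders V" "es \<in> E"
    have "exp (u * D - l) \<le> exp (u * real (hits S t es) + (\<Sum>i<t. - (exp u - 1) * p (take i es)))"
    proof -
      have "u * D \<le> u * real (hits S t es)" using E[OF es] u by (intro mult_left_mono) auto
      moreover have "(\<Sum>i<t. - (exp u - 1) * p (take i es)) = - ((exp u - 1) * (\<Sum>i<t. p (take i es)))"
        by (simp only: sum_distrib_left mult_minus_left sum_negf)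
      ultimately show ?thesis using E[OF es] by (simp only: exp_le_cancel_iff) linarith
    qed
    also have "\<dots> = exp u ^ hits S t es * exp (\<Sum>i<t. - (exp u - 1) * p (take i es))"
      by (simp add: exp_add exp_of_nat2_mult)
    finally show "exp (u * D - l) \<le> (\<Prod>i<t. W (take i es) (es ! i))"
      unfolding W_def prod_hits[where g = "\<lambda>xs. - (exp u - 1) * p xs"] .
  qed (auto simp: W_def)
  also have "\<dots> = exp (l - u * D)" by (simp add: exp_diff)
  finally show ?thesis .
qed

section \<open>Events holding with high probability\<close>

definition vertex_sets :: "(nat \<Rightarrow> 'a set) \<Rightarrow> bool" where
  "vertex_sets V \<longleftrightarrow> (\<forall>n. even n \<longrightarrow> finite (V n) \<and> card (V n) = n)"

definition whp :: "(nat \<Rightarrow> 'a set) \<Rightarrow> (nat \<Rightarrow> 'a set list \<Rightarrow> bool) \<Rightarrow> bool" where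
  "whp V Q \<longleftrightarrow> ((\<lambda>n. edge_prob (V n) {es. \<not> Q n es}) \<longlongrightarrow> 0) even_at_top"

lemma eventually_even_at_top:
  "eventually P even_at_top \<longleftrightarrow> eventually (\<lambda>n. even n \<longrightarrow> P n) at_top"
  by (simp add: even_at_top_def eventually_inf_principal)

lemma tendsto_even_at_top: "(f \<longlongrightarrow> l) at_top \<Longrightarrow> (f \<longlongrightarrow> l) even_at_top"
  unfolding even_at_top_def by (rule tendsto_mono[of _ at_top]) auto

lemma whpI:
  assumes "\<forall>\<^sub>F n in at_top. even n \<longrightarrow> edge_prob (V n) {es. \<not> Q n es} \<le> r n"
    and "r \<longlonglongrightarrow> 0"
  shows "whp V Q"
  unfolding whp_def
proof (rule tendsto_sandwich[of "\<lambda>_. 0" _ _ r])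
  show "\<forall>\<^sub>F n in even_at_top. edge_prob (V n) {es. \<not> Q n es} \<le> r n"
    using assms(1) by (simp add: eventually_even_at_top)
qed (use assms(2) tendsto_even_at_top in auto)

lemma whp_conj:
  assumes "whp V P" "whp V Q" shows "whp V (\<lambda>n es. P n es \<and> Q n es)"
  unfolding whp_def
proof (rule tendsto_sandwich[of "\<lambda>_. 0"])
  show "((\<lambda>n. edge_prob (V n) {es. \<not> P n es} + edge_prob (V n) {es. \<not> Q n es}) \<longlongrightarrow> 0) even_at_top"
    using tendsto_add[OF assms[unfolded whp_def]] by simp
  have "edge_prob (V n) {es. \<not> (P n es \<and> Q n es)}
      \<le> edge_prob (V n) {es. \<not> P n es} + edge_prob (V n) {es. \<not> Q n es}" for n
  proof -
    have "{es. \<not> (P n es \<and> Q n es)} = {es. \<not> P n es} \<union> {es. \<not> Q n es}" by auto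
    then show ?thesis by (simp add: measure_Un_le)
  qed
  then show "\<forall>\<^sub>F n in even_at_top. edge_prob (V n) {es. \<not> (P n es \<and> Q n es)}
      \<le> edge_prob (V n) {es. \<not> P n es} + edge_prob (V n) {es. \<not> Q n es}" by simp
qed auto

lemma whp_mono:
  assumes V: "vertex_sets V" and Q: "whp V Q"
    and "\<forall>\<^sub>F n in at_top. even n \<longrightarrow>
       (\<forall>es \<in> edge_orders (V n). Q n es \<longrightarrow> R n es)"
  shows "whp V R"
  unfolding whp_def
proof (rule tendsto_sandwich[of "\<lambda>_. 0"])
  show "((\<lambda>n. edge_prob (V n) {es. \<not> Q n es}) \<longlongrightarrow> 0) even_at_top"
    using Q by (simp add: whp_def)
  show "\<forall>\<^sub>F n in even_at_top. edge_prob (V n) {es. \<not> R n es} \<le> edge_prob (V n) {es. \<not> Q n es}"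
    unfolding eventually_even_at_top using assms(3)
  proof eventually_elim
    case (elim n)
    then show ?case using V by (auto simp: vertex_sets_def intro!: edge_prob_mono)
  qed
qed auto

section \<open>Probability estimates for the process\<close>

lemma real_choose_two: "real (m choose 2) = real m * (real m - 1) / 2"
proof -
  have "even (m * (m - 1))" by auto
  then have "real (m * (m - 1) div 2) = real (m * (m - 1)) / 2" using real_of_nat_div by fastforce
  then show ?thesis by (cases m) (simp_all add: choose_two algebra_simps)
qed

text \<open>It is applied to the offered pairs, accepted or not: it bounds how many pairs at a
  vertex are already spent and can no longer be hit.\<close>

definition max_degree_le :: "'a set \<Rightarrow> 'a set list \<Rightarrow> real \<Rightarrow> bool" where
  "max_degree_le V xs d \<longleftrightarrow> (\<forall>v\<in>V. real (card {e \<in> set xs. v \<in> e}) \<le> d)"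

lemma max_degree_le_take:
  assumes "max_degree_le V (take t es) d" "i \<le> t" shows "max_degree_le V (take i es) d"
  unfolding max_degree_le_def
proof
  fix v assume v: "v \<in> V"
  have "card {e \<in> set (take i es). v \<in> e} \<le> card {e \<in> set (take t es). v \<in> e}"
    using set_take_subset_set_take[OF assms(2), of es] by (intro card_mono) auto
  also have "real \<dots> \<le> d" using assms(1) v by (simp add: max_degree_le_def)
  finally show "real (card {e \<in> set (take i es). v \<in> e}) \<le> d" by simp
qed

lemma card_incident_le:
  assumes "finite F" "finite S" "\<And>v. v \<in> S \<Longrightarrow> real (card {e \<in> F. v \<in> e}) \<le> d"
  shows "real (card {e \<in> F. e \<inter> S \<noteq> {}}) \<le> real (card S) * d"
proof -
  have "{e \<in> F. e \<inter> S \<noteq> {}} \<subseteq> (\<Union>v\<in>S. {e \<in> F. v \<in> e})" by auto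
  then have "card {e \<in> F. e \<inter> S \<noteq> {}} \<le> card (\<Union>v\<in>S. {e \<in> F. v \<in> e})"
    using assms by (intro card_mono) auto
  also have "\<dots> \<le> (\<Sum>v\<in>S. card {e \<in> F. v \<in> e})"
    using assms(2) by (rule card_UN_le)
  finally have "real (card {e \<in> F. e \<inter> S \<noteq> {}}) \<le> (\<Sum>v\<in>S. real (card {e \<in> F. v \<in> e}))"
    by (simp flip: of_nat_sum)
  also have "\<dots> \<le> (\<Sum>v\<in>S. d)" using assms(3) by (rule sum_mono)
  finally show ?thesis by simp
qed

lemma card_edges_at_le:
  assumes "finite V" shows "card {e \<in> nsets V 2. v \<in> e} \<le> card V"
proof -
  have "{e \<in> nsets V 2. v \<in> e} \<subseteq> (\<lambda>w. {v, w}) ` V"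
  proof
    fix e assume "e \<in> {e \<in> nsets V 2. v \<in> e}"
    then have "e \<in> nsets V 2" "v \<in> e" by auto
    then obtain w where "e = {v, w}" "w \<in> V" by (rule doubleton_other)
    then show "e \<in> (\<lambda>w. {v, w}) ` V" by blast
  qed
  then show ?thesis by (rule surj_card_le[OF assms])
qed

lemma card_pairs_between:
  assumes "finite A" "finite B" "A \<inter> B = {}"
  shows "card {e. \<exists>a\<in>A. \<exists>b\<in>B. e = {a, b}} = card A * card B"
proof -
  have "inj_on (\<lambda>(a, b). {a, b}) (A \<times> B)"
    using assms(3) by (auto simp: inj_on_def doubleton_eq_iff)
  moreover have "{e. \<exists>a\<in>A. \<exists>b\<in>B. e = {a, b}} = (\<lambda>(a, b). {a, b}) ` (A \<times> B)" by auto
  ultimately show ?thesis by (simp add: card_image card_cartesian_product)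
qed

lemma permutation_prefix:
  assumes "es \<in> edge_orders V"
  shows "distinct (take i es)" "set (take i es) \<subseteq> nsets V 2" "length es = card (nsets V 2)"
  using assms set_take_subset[of i es] length_finite_permutations_of_set[OF assms]
  by (auto simp: permutations_of_set_def simp del: card_nsets)

lemma hits_eq_card_images:
  assumes "distinct es" "t \<le> length es"
  shows "hits S t es = card {e. \<exists>i<t. e = es ! i \<and> es ! i \<in> S (take i es)}"
proof -
  have "inj_on ((!) es) {i. i < t \<and> es ! i \<in> S (take i es)}"
    using assms by (auto simp: inj_on_def nth_eq_iff_index_eq)
  then have "hits S t es = card ((!) es ` {i. i < t \<and> es ! i \<in> S (take i es)})"
    by (simp add: hits_def card_image)
  also have "(!) es ` {i. i < t \<and> es ! i \<in> S (take i es)}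
      = {e. \<exists>i<t. e = es ! i \<and> es ! i \<in> S (take i es)}" by auto
  finally show ?thesis .
qed

lemma hits_const:
  assumes "distinct es" "t \<le> length es"
  shows "hits (\<lambda>_. S) t es = card {e \<in> set (take t es). e \<in> S}"
proof -
  have "{e. \<exists>i<t. e = es ! i \<and> es ! i \<in> S} = {e \<in> set (take t es). e \<in> S}"
    using assms(2) by (auto simp: in_set_conv_nth min_def)
  then show ?thesis using hits_eq_card_images[OF assms, of "\<lambda>_. S"] by simp
qed

lemma process_graph_take_mono: "i \<le> t \<Longrightarrow> process_graph V (take i es) \<subseteq> process_graph V (take t es)"
  using process_graph_mono[of V "take i es" "drop i (take t es)"]
  by (metis append_take_drop_id min.absorb1 take_take)

text \<open>This turns hits into edges: a pair meeting any optimal cover of the current graph is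
  accepted, and edges are never removed.\<close>

lemma accepted_in_later:
  assumes V: "finite V" and es: "es \<in> edge_orders V"
    and i: "i < t" "t \<le> card (nsets V 2)"
    and C: "is_optimal_vertex_cover V (process_graph V (take i es)) C" "es ! i \<inter> C \<noteq> {}"
  shows "es ! i \<in> process_graph V (take t es)"
proof -
  have len: "length es = card (nsets V 2)" using permutation_prefix es by blast
  have "es ! i \<in> nsets V 2" using es i len
    by (metis nth_mem order_less_le_trans permutations_of_setD(1))
  then have "es ! i \<in> process_graph V (take i es @ [es ! i])"
    using process_accepts[OF V permutation_prefix(2)[OF es] _ C] by blast
  also have "take i es @ [es ! i] = take (Suc i) es"
    using i len by (simp add: take_Suc_conv_app_nth)
  finally show ?thesis using process_graph_take_mono[of "Suc i" t V es] i by auto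
qed

lemma nu_take_mono:
  assumes "finite V" "es \<in> edge_orders V" "i \<le> t"
  shows "nu V (take i es) \<le> nu V (take t es)"
  by (intro matching_number_mono process_graph_take_mono
      finite_subset[OF process_graph_edges finite_edges] permutation_prefix assms)

lemma nu_take_le:
  assumes "finite V" "es \<in> edge_orders V"
  shows "2 * nu V (take t es) \<le> card V"
  by (intro nu_le permutation_prefix assms)

section \<open>Estimates up to a fixed time horizon\<close>

locale horizon =
  fixes V :: "'a set" and n T :: nat
  assumes finV: "finite V" and card_V: "card V = n" and n8: "8 \<le> n" and T: "8 * T \<le> n\<^sup>2"
begin

lemma card_edges: "real (card (nsets V 2)) = real n * (real n - 1) / 2"
  by (simp add: card_V real_choose_two)

lemma T_le: "T \<le> card (nsets V 2)"
proof -
  have "8 * real T \<le> real n * real n" using T by (simp add: power2_eq_square flip: of_nat_mult of_nat_le_iff)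
  moreover have "8 * real n \<le> real n * real n" using n8 by (intro mult_right_mono) auto
  ultimately have "real T \<le> real (card (nsets V 2))" unfolding card_edges
    by (simp add: algebra_simps)
  then show ?thesis by simp
qed

lemma available:
  assumes "prefix_of V t xs" "t \<le> T"
  shows "real (card (fresh V xs)) \<le> (real n)\<^sup>2 / 2"
    "(real n)\<^sup>2 / 4 \<le> real (card (fresh V xs))"
proof -
  have 1: "8 * real T \<le> real n * real n" using T by (simp add: power2_eq_square flip: of_nat_mult of_nat_le_iff)
  have 2: "8 * real n \<le> real n * real n" using n8 by (intro mult_right_mono) auto
  have c: "card (set xs) = length xs" "set xs \<subseteq> nsets V 2" "length xs < T"
    using assms by (auto simp: prefix_of_def distinct_card)
  have "card (fresh V xs) = card (nsets V 2) - length xs"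
    using card_Diff_subset[of "set xs" "nsets V 2"] c by simp
  then have "real (card (fresh V xs)) = real n * (real n - 1) / 2 - real (length xs)"
    using T_le c card_edges by simp
  then show "real (card (fresh V xs)) \<le> (real n)\<^sup>2 / 2"
    "(real n)\<^sup>2 / 4 \<le> real (card (fresh V xs))"
    using 1 2 c by (auto simp: power2_eq_square algebra_simps)
qed

text \<open>Target sets are counted against n^2/2, an upper bound on the number of unoffered pairs,
  so \<open>p\<close> underestimates the chance of a hit.\<close>

lemma prob_lower:
  assumes "t \<le> T" "0 \<le> z" "z \<le> 1" "z ^ D > 0"
    and p: "\<And>xs. prefix_of V t xs \<Longrightarrow>
       0 \<le> p xs \<and> p xs * ((real n)\<^sup>2 / 2) \<le> real (card (S xs \<inter> (fresh V xs)))"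
    and "\<And>es. es \<in> edge_orders V \<Longrightarrow> es \<in> E \<Longrightarrow>
       hits S t es \<le> D \<and> l \<le> (\<Sum>i<t. p (take i es))"
  shows "edge_prob V E \<le> exp (- (1 - z) * l) / z ^ D"
proof (rule hits_lower_tail[OF finV, of t z D p S])
  fix xs assume xs: "prefix_of V t xs"
  have "p xs * real (card (fresh V xs)) \<le> p xs * ((real n)\<^sup>2 / 2)"
    using p[OF xs] available[OF xs assms(1)] by (intro mult_left_mono) auto
  then show "p xs * real (card (fresh V xs)) \<le> real (card (S xs \<inter> (fresh V xs)))"
    using p[OF xs] by linarith
qed (use assms T_le in auto)

lemma prob_upper:
  assumes "t \<le> T" "0 \<le> u"
    and p: "\<And>xs. prefix_of V t xs \<Longrightarrow>
       0 \<le> p xs \<and> real (card (S xs \<inter> (fresh V xs))) \<le> p xs * ((real n)\<^sup>2 / 4)"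
    and "\<And>es. es \<in> edge_orders V \<Longrightarrow> es \<in> E \<Longrightarrow>
       D \<le> real (hits S t es) \<and> (exp u - 1) * (\<Sum>i<t. p (take i es)) \<le> l"
  shows "edge_prob V E \<le> exp (l - u * D)"
proof (rule hits_upper_tail[OF finV, of t u S p])
  fix xs assume xs: "prefix_of V t xs"
  have "p xs * ((real n)\<^sup>2 / 4) \<le> p xs * real (card (fresh V xs))"
    using p[OF xs] available[OF xs assms(1)] by (intro mult_left_mono) auto
  then show "real (card (S xs \<inter> (fresh V xs))) \<le> p xs * real (card (fresh V xs))"
    using p[OF xs] by linarith
qed (use assms T_le in auto)

lemma prob_max_degree:
  "edge_prob V {es. \<not> max_degree_le V (take T es) d} \<le> real n * exp (7 * real T / real n - d)"
proof -
  define E where "E v = {es :: 'a set list. d \<le> real (card {e \<in> set (take T es). v \<in> e})}" for v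
  have "edge_prob V (E v) \<le> exp (7 * real T / real n - 1 * d)" if "v \<in> V" for v
  proof (rule prob_upper[of T 1 "\<lambda>_. 4 / real n" "\<lambda>_. {e. v \<in> e}"])
    fix xs assume "prefix_of V T xs"
    have "card ({e. v \<in> e} \<inter> (fresh V xs)) \<le> card {e \<in> nsets V 2. v \<in> e}"
      using finite_edges[OF finV] by (intro card_mono) auto
    also have "\<dots> \<le> n" using card_edges_at_le[OF finV] card_V by simp
    finally show "0 \<le> 4 / real n \<and> real (card ({e. v \<in> e} \<inter> (fresh V xs)))
        \<le> 4 / real n * ((real n)\<^sup>2 / 4)"
      using n8 by (simp add: power2_eq_square)
  next
    fix es assume es: "es \<in> edge_orders V" "es \<in> E v"
    have h: "hits (\<lambda>_. {e. v \<in> e}) T es = card {e \<in> set (take T es). v \<in> e}"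
      using hits_const[of es T "{e. v \<in> e}"] permutation_prefix[OF es(1)] T_le es(1)
      by (auto simp: permutations_of_set_def)
    \<comment> \<open>The rate 4/n comes from at most n pairs at \<open>v\<close> among at least
      n^2/4 unoffered ones. As e - 1 < 7/4, the compensator is at most 7T/n.\<close>
    have "(exp 1 - 1) * (real T * (4 / real n)) \<le> 7 / 4 * (real T * (4 / real n))"
      using e_less_272 by (intro mult_right_mono) auto
    then show "d \<le> real (hits (\<lambda>_. {e. v \<in> e}) T es) \<and>
        (exp 1 - 1) * (\<Sum>i<T. 4 / real n) \<le> 7 * real T / real n"
      using es(2) h by (simp add: E_def)
  qed auto
  then have "edge_prob V (\<Union>v\<in>V. E v) \<le> real (card V) * exp (7 * real T / real n - d)"
    by (intro edge_prob_UN_le finV) simp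
  moreover have "edge_prob V {es. \<not> max_degree_le V (take T es) d} \<le> edge_prob V (\<Union>v\<in>V. E v)"
    by (intro edge_prob_mono finV) (auto simp: max_degree_le_def E_def not_le intro: less_imp_le)
  ultimately show ?thesis using card_V by simp
qed

text \<open>From a rich prefix the next pair enlarges the matching with probability at least 2g.
  Pairs already offered are removed because they cannot come again.\<close>

definition rich :: "real \<Rightarrow> 'a set list \<Rightarrow> bool" where
  "rich g xs \<longleftrightarrow> g * (real n)\<^sup>2 \<le> real (card (augmenting_pairs V (process_graph V xs) - set xs))"

lemma hits_augmenting_le:
  assumes es: "es \<in> edge_orders V" and t: "t \<le> card (nsets V 2)"
    and S: "\<And>xs. S xs \<subseteq> augmenting_pairs V (process_graph V xs)"
  shows "hits S t es \<le> nu V (take t es)"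
  using t
proof (induction t)
  case 0
  then show ?case by (simp add: hits_def)
next
  case (Suc t)
  have len: "length es = card (nsets V 2)" using permutation_prefix es by blast
  have tk: "take (Suc t) es = take t es @ [es ! t]"
    using Suc.prems len by (simp add: take_Suc_conv_app_nth)
  have mono: "nu V (take t es) \<le> nu V (take (Suc t) es)"
    using nu_take_mono[OF finV es] by simp
  have set_eq: "{i. i < Suc t \<and> es ! i \<in> S (take i es)} =
    (if es ! t \<in> S (take t es) then insert t {i. i < t \<and> es ! i \<in> S (take i es)}
     else {i. i < t \<and> es ! i \<in> S (take i es)})"
    by (auto simp: less_Suc_eq)
  show ?case
  proof (cases "es ! t \<in> S (take t es)")
    case True
    then have "nu V (take (Suc t) es) = Suc (nu V (take t es))"
      unfolding tk using nu_augment[OF finV permutation_prefix(2)[OF es]] S by blast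
    moreover have "hits S (Suc t) es = Suc (hits S t es)"
      using True set_eq by (simp add: hits_def)
    ultimately show ?thesis using Suc by simp
  next
    case False
    then have "hits S (Suc t) es = hits S t es" using set_eq by (simp add: hits_def)
    then show ?thesis using Suc mono by simp
  qed
qed

text \<open>With n/g rich steps the expected number of augmentations is at least 2n, while only n/2
  are possible. The tilt z = 1/e, with 1 - 1/e >= 1/2, gives the exponent -n + n/2.\<close>

lemma prob_many_rich:
  assumes t: "t \<le> T" and g: "g > 0"
  shows "edge_prob V {es. real n \<le> g * real (card {i. i < t \<and> rich g (take i es)})} \<le> exp (- real n / 2)"
proof -
  let ?S = "\<lambda>xs. if rich g xs then augmenting_pairs V (process_graph V xs) else {}"
  let ?p = "\<lambda>xs. if rich g xs then 2 * g else 0"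
  have "edge_prob V {es. real n \<le> g * real (card {i. i < t \<and> rich g (take i es)})}
      \<le> exp (- (1 - exp (-1)) * (2 * real n)) / exp (-1) ^ (n div 2)"
  proof (rule prob_lower[of t _ _ ?p ?S])
    fix xs assume "prefix_of V t xs"
    have "augmenting_pairs V (process_graph V xs) \<inter> (fresh V xs) =
        augmenting_pairs V (process_graph V xs) - set xs" by (auto simp: augmenting_pairs_def)
    then show "0 \<le> ?p xs \<and> ?p xs * ((real n)\<^sup>2 / 2) \<le> real (card (?S xs \<inter> (fresh V xs)))"
      using g by (auto simp: rich_def)
  next
    fix es assume es: "es \<in> edge_orders V"
      "es \<in> {es. real n \<le> g * real (card {i. i < t \<and> rich g (take i es)})}"
    have "hits ?S t es \<le> nu V (take t es)"
      using t T_le es by (intro hits_augmenting_le) auto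
    then have "hits ?S t es \<le> n div 2" using nu_take_le[OF finV es(1), of t] card_V by simp
    moreover have "(\<Sum>i<t. ?p (take i es)) = 2 * g * real (card {i. i < t \<and> rich g (take i es)})"
      by (subst sum.If_cases) (auto intro!: arg_cong[of _ _ card])
    ultimately show "hits ?S t es \<le> n div 2 \<and> 2 * real n \<le> (\<Sum>i<t. ?p (take i es))"
      using es(2) by simp
  qed (use t in auto)
  also have "\<dots> = exp (- (1 - exp (-1)) * (2 * real n) + real (n div 2))"
  proof -
    have "exp (-1 :: real) ^ (n div 2) = exp (- real (n div 2))"
      by (simp flip: exp_of_nat_mult)
    then show ?thesis by (simp only: exp_diff[symmetric] diff_minus_eq_add)
  qed
  also have "\<dots> \<le> exp (- real n / 2)"
  proof -
    have "exp (-1) \<le> (1::real) / 2" using exp_ge_add_one_self[of 1] by (simp add: exp_minus field_simps)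
    then have "exp (-1) * real n \<le> 1 / 2 * real n" by (intro mult_right_mono) auto
    moreover have "real (n div 2) \<le> real n / 2" by simp
    ultimately show ?thesis by (simp add: algebra_simps)
  qed
  finally show ?thesis .
qed

end

section \<open>Comparing the running cover with a fixed candidate\<close>

lemma card_pairs_meeting:
  assumes W: "finite W" and A: "A \<subseteq> W"
  shows "real (card A) * (real (card W) - 1) / 2 \<le> real (card {e \<in> nsets W 2. e \<inter> A \<noteq> {}})"
proof -
  have aw: "card A \<le> card W" using A W card_mono by blast
  \<comment> \<open>The complement is easier to count: the pairs missing \<open>A\<close> are those
    inside \<open>W - A\<close>.\<close>
  have "nsets W 2 = {e \<in> nsets W 2. e \<inter> A \<noteq> {}} \<union> nsets (W - A) 2"
    by (auto simp: nsets_def)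
  then have "card (nsets W 2) \<le> card {e \<in> nsets W 2. e \<inter> A \<noteq> {}} + card (nsets (W - A) 2)"
    by (metis card_Un_le)
  then have "real (card (nsets W 2)) \<le> real (card {e \<in> nsets W 2. e \<inter> A \<noteq> {}}) + real (card (nsets (W - A) 2))"
    by linarith
  moreover have "card (W - A) = card W - card A"
    using A W by (meson card_Diff_subset finite_subset)
  then have "real (card (W - A)) = real (card W) - real (card A)" using aw by simp
  moreover have "real (card A) * real (card A) \<le> real (card A) * real (card W)"
    using aw by (intro mult_left_mono) auto
  ultimately show ?thesis by (simp add: real_choose_two field_simps)
qed

text \<open>\<open>C\<close> is a candidate for the final cover that has survived until
  \<open>t\<close> although the running cover had many vertices outside it in total. The degree
  clause keeps enough pairs unoffered, each of which would have destroyed \<open>C\<close>.\<close>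

definition drifting :: "'a set \<Rightarrow> nat \<Rightarrow> nat \<Rightarrow> 'a set list \<Rightarrow> 'a set \<Rightarrow> bool" where
  "drifting V n t es C \<longleftrightarrow> 2 * card C \<le> n \<and> is_vertex_cover V (process_graph V (take t es)) C \<and>
      max_degree_le V (take t es) (real n / 16) \<and>
      8 * (real n)\<^sup>2 \<le> (\<Sum>i<t. real (card (canonical_cover V (take i es) - C)))"

text \<open>Among the pairs meeting \<open>C\<close>, only those meeting C minus the running cover
  can be rejected, so these hits bound the missing pairs. The threshold is 7/4 times the mean bound
  4B/n, plus 2n to outweigh the number of candidates.\<close>

definition often_touched :: "'a set \<Rightarrow> nat \<Rightarrow> nat \<Rightarrow> real \<Rightarrow> 'a set list \<Rightarrow> 'a set \<Rightarrow> bool" where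
  "often_touched V n t B es C \<longleftrightarrow> (\<Sum>i<t. real (card (C - canonical_cover V (take i es)))) \<le> B \<and>
      7 * B / real n + 2 * real n \<le> real (hits (\<lambda>xs. {e. e \<inter> (C - canonical_cover V xs) \<noteq> {}}) t es)"

context horizon
begin

text \<open>There are 2^n <= e^n candidates, so the union bound costs 1 in the exponential
  rate.\<close>

lemma edge_prob_subsets:
  assumes "\<And>C. C \<subseteq> V \<Longrightarrow> edge_prob V {es. R C es} \<le> exp (- b * real n)"
  shows "edge_prob V {es. \<exists>C\<subseteq>V. R C es} \<le> exp (- (b - 1) * real n)"
proof -
  have "{es. \<exists>C\<subseteq>V. R C es} = (\<Union>C\<in>Pow V. {es. R C es})" by auto
  then have "edge_prob V {es. \<exists>C\<subseteq>V. R C es} \<le> real (card (Pow V)) * exp (- b * real n)"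
    using assms finV by (simp only:) (rule edge_prob_UN_le, auto)
  also have "real (card (Pow V)) = 2 ^ n" using finV card_V by (simp add: card_Pow)
  also have "2 ^ n * exp (- b * real n) \<le> exp 1 ^ n * exp (- b * real n)"
    using exp_ge_add_one_self[of 1] by (intro mult_right_mono power_mono) auto
  also have "\<dots> = exp (real n + - b * real n)"
    unfolding exp_add by (simp flip: exp_of_nat2_mult)
  finally show ?thesis by (simp add: algebra_simps)
qed

lemma sum_from: "(\<Sum>i<t. if m \<le> i then x else 0) = x * real (t - m)" for x :: real
proof -
  have "(\<Sum>i<t. if m \<le> i then x else 0) = (\<Sum>i\<in>{m..<t}. x)"
    by (rule sum.mono_neutral_cong_right) auto
  then show ?thesis by simp
qed

lemma prefix_length: "es \<in> edge_orders V \<Longrightarrow> i \<le> T \<Longrightarrow> length (take i es) = i"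
  using permutation_prefix(3)[of es V] T_le by simp

lemma finite_avail: "finite (S \<inter> (fresh V xs))"
  using finite_edges[OF finV] by blast

text \<open>Outside \<open>C\<close> there are at least n/2 vertices, so at least |A| (n/2 - 1)/2
  pairs miss \<open>C\<close> and meet \<open>A\<close>. At most |A| n/16 of them have been offered,
  and n >= 8 leaves |A| n/8.\<close>

lemma cover_drift_count:
  assumes xs: "set xs \<subseteq> nsets V 2" and C: "C \<subseteq> V" "2 * card C \<le> n"
    and md: "max_degree_le V xs (real n / 16)"
    and A: "A \<subseteq> V" "A \<inter> C = {}"
  shows "real (card A) * real n / 8 \<le>
    real (card ({e. e \<inter> C = {} \<and> e \<inter> A \<noteq> {}} \<inter> (fresh V xs)))"
proof -
  let ?Q = "{e. e \<inter> C = {} \<and> e \<inter> A \<noteq> {}}"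
  have fC: "finite C" "finite A" using C A finV finite_subset by blast+
  have "card (V - C) = n - card C" using C fC card_V by (simp add: card_Diff_subset)
  then have w: "real n / 2 \<le> real (card (V - C))" using C by simp
  have "real (card {e \<in> set xs. e \<inter> A \<noteq> {}}) \<le> real (card A) * (real n / 16)"
    using md A fC by (intro card_incident_le) (auto simp: max_degree_le_def)
  moreover have "{e \<in> nsets (V - C) 2. e \<inter> A \<noteq> {}} \<subseteq> (?Q \<inter> (fresh V xs)) \<union> {e \<in> set xs. e \<inter> A \<noteq> {}}"
    by (auto simp: nsets_def)
  then have "card {e \<in> nsets (V - C) 2. e \<inter> A \<noteq> {}} \<le> card ((?Q \<inter> (fresh V xs)) \<union> {e \<in> set xs. e \<inter> A \<noteq> {}})"
    using finite_avail by (intro card_mono) auto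
  then have "card {e \<in> nsets (V - C) 2. e \<inter> A \<noteq> {}} \<le> card (?Q \<inter> (fresh V xs)) + card {e \<in> set xs. e \<inter> A \<noteq> {}}"
    using card_Un_le order_trans by blast
  then have "real (card {e \<in> nsets (V - C) 2. e \<inter> A \<noteq> {}}) \<le> real (card (?Q \<inter> (fresh V xs))) + real (card {e \<in> set xs. e \<inter> A \<noteq> {}})"
    by linarith
  moreover have "real (card A) * (real (card (V - C)) - 1) / 2 \<le> real (card {e \<in> nsets (V - C) 2. e \<inter> A \<noteq> {}})"
    using A finV by (intro card_pairs_meeting) auto
  moreover have "real (card A) * (real n / 2 - 1) \<le> real (card A) * (real (card (V - C)) - 1)"
    using w by (intro mult_left_mono) auto
  moreover have "real (card A) * 8 \<le> real (card A) * real n"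
    using n8 by (intro mult_left_mono) auto
  ultimately show ?thesis by (simp add: algebra_simps)
qed

text \<open>Since the future cover is unknown when the edges are revealed, the estimate is proved for
  every fixed candidate and the at most \<open>2\<^sup>n\<close> candidates are summed over.\<close>

lemma prob_cover_drift:
  assumes t: "t \<le> T"
  shows "edge_prob V {es. \<exists>C\<subseteq>V. drifting V n t es C}
    \<le> exp (- (2 - 1) * real n)"
proof (rule edge_prob_subsets)
  fix C assume C: "C \<subseteq> V"
  let ?A = "\<lambda>xs. canonical_cover V xs - C"
  let ?S = "\<lambda>xs. if max_degree_le V xs (real n / 16) \<and> 2 * card C \<le> n then {e. e \<inter> C = {} \<and> e \<inter> ?A xs \<noteq> {}} else {}"
  let ?p = "\<lambda>xs. if max_degree_le V xs (real n / 16) \<and> 2 * card C \<le> n then real (card (?A xs)) / (4 * real n) else 0"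
  \<comment> \<open>A surviving candidate allows no hit, hence z = 0 and D = 0. The rate |A|/(4n)
    summed over the steps is at least 8n^2/(4n) = 2n.\<close>
  have "edge_prob V {es. drifting V n t es C}
    \<le> exp (- (1 - 0) * (2 * real n)) / 0 ^ 0"
  proof (rule prob_lower[of t _ _ ?p ?S])
    fix xs assume "prefix_of V t xs"
    then have xs: "set xs \<subseteq> nsets V 2" by (simp add: prefix_of_def)
    show "0 \<le> ?p xs \<and> ?p xs * ((real n)\<^sup>2 / 2) \<le> real (card (?S xs \<inter> (fresh V xs)))"
    proof (cases "max_degree_le V xs (real n / 16) \<and> 2 * card C \<le> n")
      case True
      have "?A xs \<subseteq> V" "?A xs \<inter> C = {}" using canonical_cover(2)[OF finV xs] by auto
      then have "real (card (?A xs)) * real n / 8 \<le> real (card (?S xs \<inter> (fresh V xs)))"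
        using cover_drift_count[OF xs C, of "?A xs"] True by simp
      moreover have "?p xs * ((real n)\<^sup>2 / 2) = real (card (?A xs)) * real n / 8"
        using True n8 by (simp add: power2_eq_square)
      moreover have "0 \<le> ?p xs" by simp
      ultimately show ?thesis by (intro conjI; linarith)
    qed auto
  next
    fix es assume es: "es \<in> edge_orders V" "es \<in> {es. drifting V n t es C}"
    then have dr: "2 * card C \<le> n \<and> is_vertex_cover V (process_graph V (take t es)) C \<and>
      max_degree_le V (take t es) (real n / 16) \<and>
      8 * (real n)\<^sup>2 \<le> (\<Sum>i<t. real (card (canonical_cover V (take i es) - C)))" by (simp add: drifting_def)
    have "es ! i \<notin> ?S (take i es)" if i: "i < t" for i
    proof
      assume a: "es ! i \<in> ?S (take i es)"
      have "es ! i \<in> process_graph V (take t es)"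
      proof (rule accepted_in_later[OF finV es(1) i])
        show "is_optimal_vertex_cover V (process_graph V (take i es)) (canonical_cover V (take i es))"
          by (rule canonical_cover[OF finV permutation_prefix(2)[OF es(1)]])
      qed (use a t T_le in \<open>auto split: if_splits\<close>)
      then show False using a dr by (auto simp: is_vertex_cover_def split: if_splits)
    qed
    then have "hits ?S t es = 0" by (auto simp: hits_def)
    moreover have "(\<Sum>i<t. ?p (take i es)) = (\<Sum>i<t. real (card (?A (take i es)))) / (4 * real n)"
      using dr max_degree_le_take[of V t es] unfolding sum_divide_distrib
      by (intro sum.cong) auto
    moreover have "2 * real n \<le> (\<Sum>i<t. real (card (?A (take i es)))) / (4 * real n)"
      using dr n8 by (simp add: field_simps power2_eq_square)
    ultimately show "hits ?S t es \<le> 0 \<and> 2 * real n \<le> (\<Sum>i<t. ?p (take i es))"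
      by (intro conjI; linarith)
  qed (use t in auto)
  then show "edge_prob V {es. drifting V n t es C} \<le> exp (- 2 * real n)"
    by simp
qed

text \<open>Fixing the candidate first makes C minus the running cover predictable, although the
  true final cover is not. Its vertices lie in at most n pairs each, which gives the rate 4/n per
  vertex.\<close>

lemma prob_touching:
  assumes t: "t \<le> T"
  shows "edge_prob V {es. \<exists>C\<subseteq>V. often_touched V n t B es C}
    \<le> exp (- (2 - 1) * real n)"
proof (rule edge_prob_subsets)
  fix C assume C: "C \<subseteq> V"
  let ?B = "\<lambda>xs. C - canonical_cover V xs"
  let ?S = "\<lambda>xs. {e. e \<inter> ?B xs \<noteq> {}}"
  let ?p = "\<lambda>xs. 4 * real (card (?B xs)) / real n"
  have "edge_prob V {es. often_touched V n t B es C}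
    \<le> exp (7 * B / real n - 1 * (7 * B / real n + 2 * real n))"
  proof (rule prob_upper[of t 1 ?p ?S])
    fix xs assume "prefix_of V t xs"
    have fB: "finite (?B xs)" using C finV finite_subset by blast
    have "card (?S xs \<inter> (fresh V xs)) \<le> card {e \<in> nsets V 2. e \<inter> ?B xs \<noteq> {}}"
      using finite_edges[OF finV] by (intro card_mono) auto
    moreover have "real (card {e \<in> nsets V 2. e \<inter> ?B xs \<noteq> {}}) \<le> real (card (?B xs)) * real n"
      using card_edges_at_le[OF finV] card_V finite_edges[OF finV] fB by (intro card_incident_le) auto
    ultimately show "0 \<le> ?p xs \<and> real (card (?S xs \<inter> (fresh V xs))) \<le> ?p xs * ((real n)\<^sup>2 / 4)"
      using n8 by (simp add: power2_eq_square)
  next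
    fix es assume "es \<in> {es. often_touched V n t B es C}"
    then have es: "(\<Sum>i<t. real (card (?B (take i es)))) \<le> B"
      "7 * B / real n + 2 * real n \<le> real (hits ?S t es)" by (auto simp: often_touched_def)
    have "(\<Sum>i<t. ?p (take i es)) = 4 / real n * (\<Sum>i<t. real (card (?B (take i es))))"
      by (simp add: sum_distrib_left)
    then have "(exp 1 - 1) * (\<Sum>i<t. ?p (take i es)) \<le> 7 / 4 * (\<Sum>i<t. ?p (take i es))"
      using e_less_272 by (intro mult_right_mono sum_nonneg) auto
    also have "\<dots> = 7 / real n * (\<Sum>i<t. real (card (?B (take i es))))"
      by (simp add: sum_distrib_left)
    also have "\<dots> \<le> 7 / real n * B" using es by (intro mult_left_mono) auto
    finally show "7 * B / real n + 2 * real n \<le> real (hits ?S t es) \<and>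
        (exp 1 - 1) * (\<Sum>i<t. ?p (take i es)) \<le> 7 * B / real n" using es by simp
  qed (use t in auto)
  then show "edge_prob V {es. often_touched V n t B es C} \<le> exp (- 2 * real n)" by simp
qed

section \<open>Low-degree vertices and local sparsity\<close>

definition saturated :: "nat \<Rightarrow> real \<Rightarrow> 'a set list \<Rightarrow> bool" where
  "saturated m d xs \<longleftrightarrow> m \<le> length xs \<and> (1 / 2 - d) * real n \<le> real (nu V xs) \<and>
     max_degree_le V xs (d * real n)"

text \<open>Under saturation the cover has at least (1/2 - d) n vertices, of which at most d n lie
  in \<open>S\<close>, and each vertex of \<open>S\<close> has spent at most d n pairs. This leaves
  |S| (1/2 - 3d) n unoffered pairs from \<open>S\<close> into the cover, all accepted if offered;
  dividing by n^2/2 gives the rate |S| (1 - 6d)/n.\<close>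

lemma prob_low_degrees:
  assumes t: "t \<le> T" and S: "S \<subseteq> V" "real (card S) \<le> d * real n" and d: "0 \<le> d" "6 * d \<le> 1"
    and z: "0 < z" "z \<le> 1"
  shows "edge_prob V {es. (\<forall>i<t. m \<le> i \<longrightarrow> saturated m d (take i es)) \<and>
      card {e \<in> process_graph V (take t es). e \<inter> S \<noteq> {}} \<le> D}
    \<le> exp (- (1 - z) * (real (card S) * (1 - 6 * d) / real n * real (t - m))) / z ^ D"
proof -
  let ?C = "canonical_cover V"
  let ?S = "\<lambda>xs. if saturated m d xs then {e. \<exists>v\<in>S. \<exists>c\<in>?C xs - S. e = {v, c}} else {}"
  let ?p = "\<lambda>xs. if saturated m d xs then real (card S) * (1 - 6 * d) / real n else 0"
  have fS: "finite S" using S finV finite_subset by blast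
  show ?thesis
  proof (rule prob_lower[of t z D ?p ?S])
    fix xs assume "prefix_of V t xs"
    then have xs: "set xs \<subseteq> nsets V 2" by (simp add: prefix_of_def)
    show "0 \<le> ?p xs \<and> ?p xs * ((real n)\<^sup>2 / 2) \<le> real (card (?S xs \<inter> (fresh V xs)))"
    proof (cases "saturated m d xs")
      case True
      let ?Q = "{e. \<exists>v\<in>S. \<exists>c\<in>?C xs - S. e = {v, c}}"
      have CV: "?C xs \<subseteq> V" "card (?C xs) = nu V xs" using canonical_cover[OF finV xs] by auto
      then have fC: "finite (?C xs)" using finV finite_subset by blast
      have "card (?C xs) \<le> card (?C xs - S) + card S"
        using card_Un_le[of "?C xs - S" S] card_mono[of "?C xs - S \<union> S" "?C xs"] fC fS by auto
      then have cC: "(1 / 2 - 2 * d) * real n \<le> real (card (?C xs - S))"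
        using True S(2) CV by (auto simp: saturated_def algebra_simps)
      have Qs: "?Q \<subseteq> (?Q \<inter> (fresh V xs)) \<union> {e \<in> set xs. e \<inter> S \<noteq> {}}"
        using S CV by auto
      have "card ?Q \<le> card ((?Q \<inter> (fresh V xs)) \<union> {e \<in> set xs. e \<inter> S \<noteq> {}})"
        using finite_avail by (intro card_mono[OF _ Qs]) auto
      then have "card ?Q \<le> card (?Q \<inter> (fresh V xs)) + card {e \<in> set xs. e \<inter> S \<noteq> {}}"
        using card_Un_le order_trans by blast
      moreover have "card ?Q = card S * card (?C xs - S)"
        using fS fC by (intro card_pairs_between) auto
      ultimately have "real (card S * card (?C xs - S)) \<le> real (card (?Q \<inter> (fresh V xs)) + card {e \<in> set xs. e \<inter> S \<noteq> {}})"
        by (simp only: of_nat_le_iff)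
      then have "real (card S) * real (card (?C xs - S)) \<le> real (card (?Q \<inter> (fresh V xs))) + real (card {e \<in> set xs. e \<inter> S \<noteq> {}})"
        by (simp only: of_nat_mult of_nat_add)
      moreover have "real (card {e \<in> set xs. e \<inter> S \<noteq> {}}) \<le> real (card S) * (d * real n)"
        using True S fS by (intro card_incident_le) (auto simp: saturated_def max_degree_le_def)
      moreover have "real (card S) * ((1 / 2 - 2 * d) * real n) \<le> real (card S) * real (card (?C xs - S))"
        using cC by (intro mult_left_mono) auto
      ultimately have "real (card S) * (1 - 6 * d) * real n / 2 \<le> real (card (?Q \<inter> (fresh V xs)))"
        by (simp add: algebra_simps)
      moreover have "real (card S) * (1 - 6 * d) / real n * ((real n)\<^sup>2 / 2) = real (card S) * (1 - 6 * d) * real n / 2"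
        using n8 by (simp add: power2_eq_square)
      ultimately show ?thesis using True d by simp
    qed simp
  next
    fix es assume es: "es \<in> edge_orders V"
      "es \<in> {es. (\<forall>i<t. m \<le> i \<longrightarrow> saturated m d (take i es)) \<and>
        card {e \<in> process_graph V (take t es). e \<inter> S \<noteq> {}} \<le> D}"
    have len: "t \<le> length es" using t T_le permutation_prefix(3)[OF es(1)] by simp
    have acc: "es ! i \<in> process_graph V (take t es)" if "i < t" "es ! i \<in> ?S (take i es)" for i
      by (rule accepted_in_later[OF finV es(1) that(1) _ canonical_cover(1)[OF finV permutation_prefix(2)[OF es(1)]]])
        (use that t T_le in \<open>auto split: if_splits\<close>)
    have sub: "{e. \<exists>i<t. e = es ! i \<and> es ! i \<in> ?S (take i es)} \<subseteq> {e \<in> process_graph V (take t es). e \<inter> S \<noteq> {}}"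
    proof clarify
      fix i assume i: "i < t" "es ! i \<in> ?S (take i es)"
      then have "es ! i \<inter> S \<noteq> {}" by (auto split: if_splits)
      then show "es ! i \<in> process_graph V (take t es) \<and> es ! i \<inter> S \<noteq> {}" using acc[OF i] by blast
    qed
    have "finite (process_graph V (take t es))"
      using process_graph_subset finite_subset by blast
    then have "hits ?S t es \<le> card {e \<in> process_graph V (take t es). e \<inter> S \<noteq> {}}"
      using hits_eq_card_images[of es t ?S] es(1) len card_mono[OF _ sub]
      by (simp add: permutations_of_set_def)
    moreover have "(\<Sum>i<t. ?p (take i es)) = real (card S) * (1 - 6 * d) / real n * real (t - m)"
      unfolding sum_from[symmetric] using es(2) prefix_length[OF es(1)] t by (intro sum.cong) (auto simp: saturated_def)
    ultimately show "hits ?S t es \<le> D \<and>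
        real (card S) * (1 - 6 * d) / real n * real (t - m) \<le> (\<Sum>i<t. ?p (take i es))"
      using es(2) by simp
  qed (use t z in auto)
qed

text \<open>The tilt \<open>u\<close> is left free because the union over all sets needs one that
  depends on |A|. The rate is |A|^2/2 pairs over n^2/4.\<close>

lemma prob_dense:
  assumes t: "t \<le> T" and A: "A \<subseteq> V" and u: "u \<ge> 0"
  shows "edge_prob V {es. h * real (card A) \<le> real (card {e \<in> set (take t es). e \<subseteq> A})}
    \<le> exp ((exp u - 1) * (2 * (real (card A))\<^sup>2 * real t / (real n)\<^sup>2) - u * (h * real (card A)))"
proof (rule prob_upper[of t u "\<lambda>_. 2 * (real (card A))\<^sup>2 / (real n)\<^sup>2" "\<lambda>_. {e. e \<subseteq> A}"])
  fix xs assume "prefix_of V t xs"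
  have fA: "finite A" using A finV finite_subset by blast
  have "card ({e. e \<subseteq> A} \<inter> (fresh V xs)) \<le> card (nsets A 2)"
    using fA by (intro card_mono finite_imp_finite_nsets) (auto simp: nsets_def)
  then have "real (card ({e. e \<subseteq> A} \<inter> (fresh V xs))) \<le> real (card A) * (real (card A) - 1) / 2"
    by (simp add: flip: real_choose_two)
  also have "\<dots> \<le> (real (card A))\<^sup>2 / 2" by (simp add: power2_eq_square mult_left_mono)
  finally show "0 \<le> 2 * (real (card A))\<^sup>2 / (real n)\<^sup>2 \<and> real (card ({e. e \<subseteq> A} \<inter> (fresh V xs)))
      \<le> 2 * (real (card A))\<^sup>2 / (real n)\<^sup>2 * ((real n)\<^sup>2 / 4)"
    using n8 by simp
next
  fix es assume es: "es \<in> edge_orders V"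
    "es \<in> {es. h * real (card A) \<le> real (card {e \<in> set (take t es). e \<subseteq> A})}"
  then show "h * real (card A) \<le> real (hits (\<lambda>_. {e. e \<subseteq> A}) t es) \<and>
      (exp u - 1) * (\<Sum>i<t. 2 * (real (card A))\<^sup>2 / (real n)\<^sup>2)
      \<le> (exp u - 1) * (2 * (real (card A))\<^sup>2 * real t / (real n)\<^sup>2)"
    using hits_const[of es t "{e. e \<subseteq> A}"] permutation_prefix(3)[OF es(1)] t T_le
    by (auto simp: permutations_of_set_def algebra_simps)
qed (use t u in auto)

text \<open>Since at most \<open>T\<close> pairs have been offered, at least \<open>q\<close> pairs
  of \<open>Q\<close> remain available throughout the window. No hit is allowed, so again z = 0 and
  D = 0.\<close>

lemma prob_avoid:
  assumes t: "t \<le> T" and Q: "Q \<subseteq> nsets V 2" "q + real T \<le> real (card Q)" "0 \<le> q"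
  shows "edge_prob V {es. \<forall>i. m \<le> i \<longrightarrow> i < t \<longrightarrow> es ! i \<notin> Q} \<le> exp (- 2 * q * real (t - m) / (real n)\<^sup>2)"
proof -
  let ?S = "\<lambda>xs. if m \<le> length xs then Q else {}"
  let ?p = "\<lambda>xs. if m \<le> length xs then 2 * q / (real n)\<^sup>2 else 0"
  have "edge_prob V {es. \<forall>i. m \<le> i \<longrightarrow> i < t \<longrightarrow> es ! i \<notin> Q}
    \<le> exp (- (1 - 0) * (2 * q / (real n)\<^sup>2 * real (t - m))) / 0 ^ 0"
  proof (rule prob_lower[of t _ _ ?p ?S])
    fix xs assume xs: "prefix_of V t xs"
    have fQ: "finite Q" using Q(1) finite_edges[OF finV] finite_subset by blast
    have "Q \<subseteq> (Q \<inter> (fresh V xs)) \<union> set xs" using Q(1) by auto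
    then have "card Q \<le> card ((Q \<inter> (fresh V xs)) \<union> set xs)"
      using finite_avail by (intro card_mono) auto
    also have "\<dots> \<le> card (Q \<inter> (fresh V xs)) + card (set xs)" by (rule card_Un_le)
    finally have "real (card Q) \<le> real (card (Q \<inter> (fresh V xs))) + real (length xs)"
      using xs by (simp add: prefix_of_def distinct_card flip: of_nat_add)
    then have "q \<le> real (card (Q \<inter> (fresh V xs)))"
      using Q xs t by (auto simp: prefix_of_def)
    then show "0 \<le> ?p xs \<and> ?p xs * ((real n)\<^sup>2 / 2) \<le> real (card (?S xs \<inter> (fresh V xs)))"
      using Q(3) n8 by simp
  next
    fix es assume es: "es \<in> edge_orders V" "es \<in> {es. \<forall>i. m \<le> i \<longrightarrow> i < t \<longrightarrow> es ! i \<notin> Q}"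
    have "hits ?S t es = 0" using es prefix_length[OF es(1)] t by (auto simp: hits_def)
    moreover have "(\<Sum>i<t. ?p (take i es)) = 2 * q / (real n)\<^sup>2 * real (t - m)"
      unfolding sum_from[symmetric] using prefix_length[OF es(1)] t by (intro sum.cong) auto
    ultimately show "hits ?S t es \<le> 0 \<and> 2 * q / (real n)\<^sup>2 * real (t - m) \<le> (\<Sum>i<t. ?p (take i es))"
      by simp
  qed (use t in auto)
  then show ?thesis by simp
qed

end

text \<open>The bound (e n/a)^a, obtained by keeping one term of (1 + q)^n <= exp(q n) at q =
  a/n.\<close>

lemma choose_le_exp:
  assumes "1 \<le> a" "a \<le> n"
  shows "real (n choose a) \<le> exp (real a * (1 + ln (real n / real a)))"
proof -
  have n: "real n > 0" "real a > 0" using assms by auto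
  define q where "q = real a / real n"
  have q: "q > 0" using n by (simp add: q_def)
  have "real (n choose a) * q ^ a \<le> (\<Sum>k\<le>n. real (n choose k) * q ^ k * 1 ^ (n - k))"
    using member_le_sum[of a "{..n}" "\<lambda>k. real (n choose k) * q ^ k * 1 ^ (n - k)"] assms q by auto
  also have "\<dots> = (q + 1) ^ n" by (rule binomial_ring[symmetric])
  also have "\<dots> \<le> exp q ^ n"
    using exp_ge_add_one_self[of q] q by (intro power_mono) (auto simp: add.commute)
  also have "\<dots> = exp (real a)" using n by (simp add: q_def flip: exp_of_nat_mult)
  finally have "real (n choose a) \<le> exp (real a) / q ^ a"
    using q by (simp add: field_simps)
  also have "q ^ a = exp (real a * ln q)" using q by (simp add: exp_of_nat_mult)
  also have "exp (real a) / exp (real a * ln q) = exp (real a * (1 + ln (real n / real a)))"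
    using n by (simp add: q_def ln_div algebra_simps flip: exp_diff)
  finally show ?thesis .
qed

context horizon
begin

text \<open>A union over all small sets, grouped by size. Small sets have few expected pairs, so a
  large tilt is affordable and beats the entropy of choosing the set. The threshold factor
  \<open>h\<close> is proportional to m/n, so it keeps pace with the growing degrees.\<close>

lemma prob_not_locally_sparse:
  assumes m: "m \<le> T" "64 * real n \<le> c * real m" and c: "0 < c" "c \<le> 1"
  shows "edge_prob V {es. \<not> locally_sparse V (set (take m es))
      (exp (- 2 * (1 - ln (c / 8))) * real n) (c * real m / (4 * real n))}
    \<le> real n * exp (- 6 * ln (real n))"
proof -
  define h where "h = c * real m / (4 * real n)"
  define al where "al = exp (- 2 * (1 - ln (c / 8)))"
  define E where "E A = {es :: 'a set list. h * real (card A) \<le> real (card {e \<in> set (take m es). e \<subseteq> A})}" for A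
  define I where "I = {a \<in> {1..n}. real a \<le> al * real n}"
  have npos: "real n > 0" using n8 by simp
  have h16: "h \<ge> 16" using m npos by (simp add: h_def field_simps)
  have size: "edge_prob V (\<Union>A\<in>{A. A \<subseteq> V \<and> card A = a}. E A) \<le> exp (- 6 * ln (real n))" if a: "a \<in> I" for a
  proof -
    define x where "x = ln (real n / real a)"
    \<comment> \<open>Chosen so that exp(u) = c n/(8a), which makes the compensator at most h a and
      leaves -(u - 1) h a in the exponent. The size limit \<open>al\<close> guarantees u - 1 >=
      x/2.\<close>
    define u where "u = x + ln (c / 8)"
    have a1: "1 \<le> a" "a \<le> n" "real a \<le> al * real n" using a by (auto simp: I_def)
    have "exp (2 * (1 - ln (c / 8))) \<le> real n / real a"
    proof -
      define X where "X = 2 * (1 - ln (c / 8))"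
      have al: "al = exp (- X)" by (simp add: al_def X_def)
      have "exp X * real a \<le> exp X * (exp (- X) * real n)"
        using a1(3) unfolding al by (intro mult_left_mono) auto
      then show ?thesis using a1 unfolding X_def[symmetric] by (simp add: exp_minus field_simps)
    qed
    then have x2: "x \<ge> 2 * (1 - ln (c / 8))"
      unfolding x_def using a1 npos by (subst ln_ge_iff) auto
    have lc: "ln (c / 8) \<le> 0" using c by simp
    have u: "u - 1 \<ge> x / 2" "x \<ge> 1" "u \<ge> 0" using x2 lc by (auto simp: u_def)
    have eu: "exp u = c * real n / (8 * real a)"
      using a1 npos c by (simp add: u_def x_def exp_add mult_ac)
    have ax: "ln (real n) \<le> real a * x"
    proof -
      have "ln (real a) \<le> real a - 1" using a1 by (intro ln_le_minus_one) auto
      also have "\<dots> \<le> (real a - 1) * x" using u a1 mult_left_mono[of 1 x "real a - 1"] by simp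
      finally show ?thesis using a1 npos by (simp add: x_def ln_div algebra_simps)
    qed
    have "edge_prob V (\<Union>A\<in>{A. A \<subseteq> V \<and> card A = a}. E A)
        \<le> real (card {A. A \<subseteq> V \<and> card A = a}) * exp (- 8 * (real a * x))"
    proof (rule edge_prob_UN_le)
      show "finite {A. A \<subseteq> V \<and> card A = a}" using finV by simp
      fix A assume A: "A \<in> {A. A \<subseteq> V \<and> card A = a}"
      then have "edge_prob V (E A) \<le> exp ((exp u - 1) * (2 * (real a)\<^sup>2 * real m / (real n)\<^sup>2) - u * (h * real a))"
        using prob_dense[OF m(1), of A u h] u by (simp add: E_def)
      also have "\<dots> \<le> exp (- 8 * (real a * x))"
      proof -
        have "(exp u - 1) * (2 * (real a)\<^sup>2 * real m / (real n)\<^sup>2) \<le> exp u * (2 * (real a)\<^sup>2 * real m / (real n)\<^sup>2)"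
          by (intro mult_right_mono) auto
        also have "\<dots> = h * real a" using npos a1 by (simp add: eu h_def power2_eq_square field_simps)
        finally have "(exp u - 1) * (2 * (real a)\<^sup>2 * real m / (real n)\<^sup>2) - u * (h * real a) \<le> - ((u - 1) * (h * real a))"
          by (simp add: algebra_simps)
        also have "\<dots> \<le> - (x / 2 * (16 * real a))"
          using u h16 by (intro le_imp_neg_le mult_mono) auto
        finally show ?thesis by (simp add: mult_ac)
      qed
      finally show "edge_prob V (E A) \<le> exp (- 8 * (real a * x))" .
    qed
    also have "card {A. A \<subseteq> V \<and> card A = a} = n choose a"
      using n_subsets[OF finV] card_V by simp
    also have "real (n choose a) * exp (- 8 * (real a * x)) \<le> exp (real a * (1 + x)) * exp (- 8 * (real a * x))"
      using choose_le_exp[OF a1(1,2)] by (intro mult_right_mono) (auto simp: x_def)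
    also have "\<dots> = exp (real a * (1 + x) - 8 * (real a * x))"
      by (simp flip: exp_add)
    \<comment> \<open>As x >= 1, the entropy a (1 + x) is at most 2 a x. The exponent is thus at
      most -6 a x, and a x >= ln n.\<close>
    also have "\<dots> \<le> exp (- 6 * ln (real n))"
    proof -
      have "real a * 1 \<le> real a * x" using u by (intro mult_left_mono) auto
      then show ?thesis using ax by (simp add: algebra_simps)
    qed
    finally show ?thesis .
  qed
  have "edge_prob V {es. \<not> locally_sparse V (set (take m es)) (al * real n) h}
      \<le> edge_prob V (\<Union>a\<in>I. \<Union>A\<in>{A. A \<subseteq> V \<and> card A = a}. E A)"
  proof (rule edge_prob_mono[OF finV])
    fix es assume "es \<in> {es. \<not> locally_sparse V (set (take m es)) (al * real n) h}"
    then obtain A where A: "A \<subseteq> V" "A \<noteq> {}" "real (card A) \<le> al * real n" "es \<in> E A"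
      by (auto simp: locally_sparse_def E_def not_less)
    have "card A \<in> I" using A finV card_V card_mono[OF finV A(1)] finite_subset[OF A(1)]
      by (auto simp: I_def Suc_le_eq card_gt_0_iff)
    then show "es \<in> (\<Union>a\<in>I. \<Union>A\<in>{A. A \<subseteq> V \<and> card A = a}. E A)" using A by blast
  qed
  also have "\<dots> \<le> real (card I) * exp (- 6 * ln (real n))"
    using size by (intro edge_prob_UN_le) (auto simp: I_def)
  also have "\<dots> \<le> real n * exp (- 6 * ln (real n))"
  proof -
    have "card I \<le> card {1..n}" by (intro card_mono) (auto simp: I_def)
    then show ?thesis by (intro mult_right_mono) auto
  qed
  finally show ?thesis by (simp add: al_def h_def)
qed

text \<open>A set of \<open>s\<close> low vertices meets at most s y accepted edges. The logarithm
  of the number of such sets is at most s (1 + ln (n/s)), so all terms scale with \<open>s\<close>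
  and the sign of the bracket decides.\<close>

lemma prob_many_low:
  assumes t: "t \<le> T" and s: "1 \<le> s" "real s \<le> d * real n" "s \<le> n" and d: "0 \<le> d" "6 * d \<le> 1"
    and z: "0 < z" "z \<le> 1" and y: "0 \<le> y"
  shows "edge_prob V {es. (\<forall>i<t. m \<le> i \<longrightarrow> saturated m d (take i es)) \<and>
      s \<le> card (low_vertices V (process_graph V (take t es)) y)}
    \<le> exp (real s * (1 + ln (real n / real s) + ln (1 / z) * y - (1 - z) * (1 - 6 * d) * (real (t - m) / real n)))"
proof -
  let ?x = "ln (1 / z) * y - (1 - z) * (1 - 6 * d) * (real (t - m) / real n)"
  define D where "D = nat \<lfloor>real s * y\<rfloor>"
  define E where "E S = {es. (\<forall>i<t. m \<le> i \<longrightarrow> saturated m d (take i es)) \<and>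
      card {e \<in> process_graph V (take t es). e \<inter> S \<noteq> {}} \<le> D}" for S
  have "edge_prob V {es. (\<forall>i<t. m \<le> i \<longrightarrow> saturated m d (take i es)) \<and>
      s \<le> card (low_vertices V (process_graph V (take t es)) y)}
    \<le> edge_prob V (\<Union>S\<in>{S. S \<subseteq> V \<and> card S = s}. E S)"
  proof (rule edge_prob_mono[OF finV])
    fix es assume es: "es \<in> {es. (\<forall>i<t. m \<le> i \<longrightarrow> saturated m d (take i es)) \<and>
      s \<le> card (low_vertices V (process_graph V (take t es)) y)}"
    let ?G = "process_graph V (take t es)"
    obtain S where S: "S \<subseteq> low_vertices V ?G y" "card S = s"
      using obtain_subset_with_card_n[of s "low_vertices V ?G y"] es by auto
    have SV: "S \<subseteq> V" using S by (auto simp: low_vertices_def)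
    have "finite ?G" using process_graph_subset finite_subset by blast
    then have "real (card {e \<in> ?G. e \<inter> S \<noteq> {}}) \<le> real (card S) * y"
      using S SV finV finite_subset by (intro card_incident_le) (auto simp: low_vertices_def intro: less_imp_le)
    then have "card {e \<in> ?G. e \<inter> S \<noteq> {}} \<le> D"
      using S unfolding D_def by (simp add: le_nat_floor)
    then show "es \<in> (\<Union>S\<in>{S. S \<subseteq> V \<and> card S = s}. E S)" using SV S es by (auto simp: E_def)
  qed
  also have "\<dots> \<le> real (card {S. S \<subseteq> V \<and> card S = s}) *
      exp (real s * ?x)"
  proof (rule edge_prob_UN_le)
    show "finite {S. S \<subseteq> V \<and> card S = s}" using finV by simp
    fix S assume S: "S \<in> {S. S \<subseteq> V \<and> card S = s}"
    have "edge_prob V (E S) \<le> exp (- (1 - z) * (real s * (1 - 6 * d) / real n * real (t - m))) / z ^ D"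
      using prob_low_degrees[OF t, of S d z m D] S s d z by (simp add: E_def)
    also have "\<dots> \<le> exp (- (1 - z) * (real s * (1 - 6 * d) / real n * real (t - m))) * exp (real s * y * ln (1 / z))"
    proof -
      have l: "ln (1 / z) \<ge> 0" using z by simp
      have "1 / z ^ D = exp (real D * ln (1 / z))" using z by (simp add: exp_of_nat_mult power_one_over)
      also have "\<dots> \<le> exp (real s * y * ln (1 / z))"
        using l y unfolding D_def by (simp add: mult_right_mono)
      finally have "exp (- (1 - z) * (real s * (1 - 6 * d) / real n * real (t - m))) * (1 / z ^ D) \<le>
         exp (- (1 - z) * (real s * (1 - 6 * d) / real n * real (t - m))) * exp (real s * y * ln (1 / z))"
        by (intro mult_left_mono) auto
      then show ?thesis by simp
    qed
    also have "\<dots> = exp (- (1 - z) * (real s * (1 - 6 * d) / real n * real (t - m)) + real s * y * ln (1 / z))"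
      by (rule exp_add[symmetric])
    also have "\<dots> = exp (real s * ?x)"
      by (simp add: algebra_simps add_divide_distrib diff_divide_distrib)
    finally show "edge_prob V (E S) \<le> exp (real s * ?x)" .
  qed
  also have "card {S. S \<subseteq> V \<and> card S = s} = n choose s"
    using n_subsets[OF finV] card_V by simp
  also have "real (n choose s) * exp (real s * ?x)
    \<le> exp (real s * (1 + ln (real n / real s))) * exp (real s * ?x)"
    using choose_le_exp[OF s(1,3)] by (intro mult_right_mono) auto
  also have "\<dots> = exp (real s * (1 + ln (real n / real s) + ln (1 / z) * y - (1 - z) * (1 - 6 * d) * (real (t - m) / real n)))"
    unfolding exp_add[symmetric] by (simp add: algebra_simps)
  finally show ?thesis .
qed

end

section \<open>From few low-degree vertices to a perfect matching\<close>

lemma sum_exp_geometric: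
  assumes "n > 0"
  shows "(\<Sum>m<t. exp (- real m / (4 * real n))) \<le> 4 * real n + 1"
proof -
  define y where "y = 1 / (4 * real n)"
  have y: "y > 0" using assms by (simp add: y_def)
  define q where "q = exp (- y)"
  have q: "0 < q" "q < 1" using y by (auto simp: q_def)
  have "(\<Sum>m<t. exp (- real m / (4 * real n))) = (\<Sum>m<t. q ^ m)"
    by (simp add: q_def y_def flip: exp_of_nat_mult)
  also have "\<dots> = (1 - q ^ t) / (1 - q)" using q by (simp add: sum_gp_strict)
  also have "\<dots> \<le> 1 / (1 - q)" using q by (intro divide_right_mono) auto
  also have "\<dots> \<le> 4 * real n + 1"
  proof -
    have "q \<le> 1 / (1 + y)" using exp_ge_add_one_self[of y] y
      by (simp add: q_def exp_minus field_simps)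
    then have "(1 - q) * (1 + y) \<ge> y" using y by (simp add: field_simps)
    then have "1 / (1 - q) \<le> (1 + y) / y" using y q by (simp add: field_simps)
    also have "\<dots> = 4 * real n + 1" using assms by (simp add: y_def field_simps)
    finally show ?thesis .
  qed
  finally show ?thesis .
qed

lemma locally_sparse_subset:
  assumes "locally_sparse V F a h" "E \<subseteq> F" "finite F" shows "locally_sparse V E a h"
  unfolding locally_sparse_def
proof (intro allI impI)
  fix A assume A: "A \<subseteq> V" "A \<noteq> {}" "real (card A) \<le> a"
  have "card {e \<in> E. e \<subseteq> A} \<le> card {e \<in> F. e \<subseteq> A}" using assms by (intro card_mono) auto
  moreover have "real (card {e \<in> F. e \<subseteq> A}) < h * real (card A)"
    using assms(1) A by (auto simp: locally_sparse_def)
  ultimately show "real (card {e \<in> E. e \<subseteq> A}) < h * real (card A)" by linarith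
qed

context horizon
begin

lemma richI:
  assumes "length xs \<le> T" "g * (real n)\<^sup>2 + real T \<le> real (card (augmenting_pairs V (process_graph V xs)))"
  shows "rich g xs"
proof -
  let ?A = "augmenting_pairs V (process_graph V xs)"
  have "card ?A \<le> card (?A - set xs) + card (set xs)"
    using card_Un_le[of "?A - set xs" "set xs"] card_mono[of "(?A - set xs) \<union> set xs" ?A]
      finite_augmenting[OF finV] by auto
  then have "card ?A \<le> card (?A - set xs) + T"
    using card_length[of xs] assms(1) by linarith
  then show ?thesis using assms(2) by (simp add: rich_def)
qed

text \<open>If the deficiency were still above 2 d n at time \<open>m0\<close>, the unmatched
  vertices alone would make all \<open>m0\<close> earlier prefixes rich, which is more than the n/g
  that can occur.\<close>

lemma saturated_after:
  assumes es: "es \<in> edge_orders V" and m0: "m0 \<le> t" "t \<le> T"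
    and md: "max_degree_le V (take T es) (d * real n)" and d: "0 < d"
    and few: "g * real (card {i. i < t \<and> rich g (take i es)}) < real n"
    and g: "0 < g" "real n \<le> g * real m0"
    and num: "g * (real n)\<^sup>2 + real T \<le> (2 * d * real n) * (2 * d * real n - 1) / 2"
    and i: "m0 \<le> i" "i \<le> T"
  shows "saturated m0 d (take i es)"
proof -
  have "(1 / 2 - d) * real n \<le> real (nu V (take m0 es))"
  proof (rule ccontr)
    assume neg: "\<not> ?thesis"
    have "rich g (take j es)" if j: "j < m0" for j
    proof (rule richI)
      show "length (take j es) \<le> T" using j m0 by simp
      have le: "real (nu V (take j es)) < (1 / 2 - d) * real n"
        using nu_take_mono[OF finV es, of j m0] j neg by linarith
      define k where "k = n - 2 * nu V (take j es)"
      have k: "2 * d * real n \<le> real k" using le nu_take_le[OF finV es, of j] card_V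
        by (simp add: k_def of_nat_diff algebra_simps)
      have "0 \<le> g * (real n)\<^sup>2 + real T" using g by simp
      with num have "0 \<le> (2 * d * real n) * (2 * d * real n - 1)" by linarith
      moreover have "0 < 2 * d * real n" using d n8 by simp
      ultimately have "1 \<le> 2 * d * real n" by (simp add: zero_le_mult_iff)
      then have "(2 * d * real n) * (2 * d * real n - 1) \<le> real k * (real k - 1)"
        using k by (intro mult_mono) auto
      also have "real k * (real k - 1) = 2 * real (k choose 2)" by (simp add: real_choose_two)
      finally have "(2 * d * real n) * (2 * d * real n - 1) / 2 \<le> real (k choose 2)" by simp
      moreover have "k choose 2 \<le> card (augmenting_pairs V (process_graph V (take j es)))"
        using augmenting_pairs_unmatched[OF finV process_graph_edges[OF permutation_prefix(2)[OF es]]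
            process_graph_konig[OF finV]] card_V by (simp add: k_def)
      ultimately show "g * (real n)\<^sup>2 + real T \<le> real (card (augmenting_pairs V (process_graph V (take j es))))"
        using num by linarith
    qed
    then have "{..<m0} \<subseteq> {i. i < t \<and> rich g (take i es)}" using m0 by auto
    then have "m0 \<le> card {i. i < t \<and> rich g (take i es)}"
      using card_mono[of "{i. i < t \<and> rich g (take i es)}" "{..<m0}"] by simp
    then have "g * real m0 \<le> g * real (card {i. i < t \<and> rich g (take i es)})"
      using g by (intro mult_left_mono) auto
    then show False using few g by linarith
  qed
  then show ?thesis
    using nu_take_mono[OF finV es i(1)] prefix_length[OF es i(2)] i max_degree_le_take[OF md i(2)]
    by (simp add: saturated_def)
qed

text \<open>The contrapositive of \<open>many_augmenting_pairs\<close> with b = al n/2: a prefix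
  that is not rich has at most 2|J| + 1 unmatched vertices, where \<open>J\<close> is the set of low
  vertices.\<close>

lemma unmatched_le_low:
  assumes xs: "set xs \<subseteq> nsets V 2" "length xs \<le> T"
    and sp: "locally_sparse V (set xs) (al * real n) (y / 4)" and y: "y > 0" and al: "al > 0"
    and low: "real (card (low_vertices V (process_graph V xs) y)) \<le> al * real n / 8"
    and num: "g * (real n)\<^sup>2 + real T \<le> (al * real n / 2)\<^sup>2 / 2"
    and poor: "\<not> rich g xs"
  shows "n < 2 * nu V xs + 2 * card (low_vertices V (process_graph V xs) y) + 2"
proof (rule ccontr)
  assume neg: "\<not> ?thesis"
  have "(al * real n / 2)\<^sup>2 / 2 \<le> real (card (augmenting_pairs V (process_graph V xs)))"
  proof (rule many_augmenting_pairs[OF finV process_graph_edges[OF xs(1)] process_graph_konig[OF finV]])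
    show "locally_sparse V (process_graph V xs) (2 * (al * real n / 2)) (y / 4)"
      using locally_sparse_subset[OF sp process_graph_subset] by simp
    show "4 * real (card (low_vertices V (process_graph V xs) y)) \<le> al * real n / 2"
      using low by simp
    show "2 * nu V xs + 2 * card (low_vertices V (process_graph V xs) y) + 2 \<le> card V"
      using neg card_V by simp
  qed (use y al in auto)
  then have "rich g xs" using num xs(2) by (intro richI) auto
  then show False using poor by simp
qed

text \<open>Saturation is an antecedent, so the event fails exactly when the conjunction bounded in
  \<open>prob_many_low\<close> occurs. Saturation itself is supplied deterministically by
  \<open>saturated_after\<close>.\<close>

definition few_low :: "nat \<Rightarrow> real \<Rightarrow> real \<Rightarrow> real \<Rightarrow> nat \<Rightarrow> 'a set list \<Rightarrow> bool" where
  "few_low m0 d y x t es \<longleftrightarrow> (\<forall>i<t. m0 \<le> i \<longrightarrow> saturated m0 d (take i es)) \<longrightarrow>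
      real (card (low_vertices V (process_graph V (take t es)) y)) < x"

text \<open>All randomness is in the hypotheses. At time \<open>t'\<close> no low vertices remain,
  so until the matching is perfect every later prefix is rich, and the gap between \<open>t'\<close>
  and \<open>t\<close> is too long for that. The second conclusion charges \<open>n\<close> to each
  early or rich step and 2|J| + 1 to every other step.\<close>

lemma matching_phase:
  assumes es: "es \<in> edge_orders V" and ev: "even n"
    and times: "m0 \<le> m1" "m1 \<le> t'" "t' \<le> t" "t \<le> T" "0 < m1"
    and md: "max_degree_le V (take T es) (d * real n)" and d: "0 < d"
    and few: "g * real (card {i. i < t \<and> rich g (take i es)}) < real n"
    and g: "0 < g" "real n \<le> g * real m0" "real n \<le> g * real (t - t')"
    and num1: "g * (real n)\<^sup>2 + real T \<le> (2 * d * real n) * (2 * d * real n - 1) / 2"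
    and num2: "g * (real n)\<^sup>2 + real T \<le> (al * real n / 2)\<^sup>2 / 2"
    and al: "0 < al" "exp (- real m1 / (4 * real n)) \<le> al / 8" and c: "0 < c"
    and sparse: "\<And>m. m1 \<le> m \<Longrightarrow> m < t \<Longrightarrow>
       locally_sparse V (set (take m es)) (al * real n) (c * real m / (4 * real n))"
    and low: "\<And>m. m1 \<le> m \<Longrightarrow> m < t \<Longrightarrow>
       few_low m0 d (c * real m / real n) (real n * exp (- real m / (4 * real n))) m es"
    and low_end: "few_low m0 d (c * real t / real n) 1 t' es"
  shows "2 * nu V (take t es) = n"
    "(\<Sum>m<t. real n - 2 * real (nu V (take m es)))
      \<le> real n * real m1 + real n * real n / g + (2 * real n * (4 * real n + 1) + real t)"
proof -
  have npos: "real n > 0" using n8 by simp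
  have sat: "saturated m0 d (take i es)" if "m0 \<le> i" "i < t" for i
    using saturated_after[OF es _ times(4) md d few g(1,2) num1, of i] that times by linarith
  have nu2: "2 * nu V (take m es) \<le> n" for m using nu_take_le[OF finV es] card_V by simp
  let ?J = "\<lambda>m. low_vertices V (process_graph V (take m es)) (c * real m / real n)"
  have J: "real (card (?J m)) < real n * exp (- real m / (4 * real n))" if "m1 \<le> m" "m < t" for m
    using low[OF that] sat that times unfolding few_low_def by (meson less_trans)
  have unm: "n < 2 * nu V (take m es) + 2 * card (?J m) + 2"
    if m: "m1 \<le> m" "m < t" "\<not> rich g (take m es)" for m
  proof (rule unmatched_le_low[OF permutation_prefix(2)[OF es] _ _ _ al(1) _ num2 m(3)])
    have "exp (- real m / (4 * real n)) \<le> exp (- real m1 / (4 * real n))"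
      using m npos by (simp add: divide_right_mono)
    then have "exp (- real m / (4 * real n)) \<le> al / 8" using al(2) by (rule order_trans)
    then have "real n * exp (- real m / (4 * real n)) \<le> real n * (al / 8)"
      by (intro mult_left_mono) auto
    then have "real (card (?J m)) \<le> real n * (al / 8)"
      using J[OF m(1,2)] by linarith
    then show "real (card (?J m)) \<le> al * real n / 8"
      by (simp add: mult.commute)
    show "locally_sparse V (set (take m es)) (al * real n) (c * real m / real n / 4)"
      using sparse[OF m(1,2)] by (simp add: mult.commute)
  qed (use m times c npos in auto)
  show "2 * nu V (take t es) = n"
  proof (rule ccontr)
    assume neg: "2 * nu V (take t es) \<noteq> n"
    have "rich g (take m es)" if m: "t' \<le> m" "m < t" for m
    proof (rule ccontr)
      assume poor: "\<not> rich g (take m es)"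
      let ?G = "\<lambda>m. process_graph V (take m es)"
      \<comment> \<open>Degrees only grow, and the threshold for \<open>t\<close> is the largest.
        One estimate at \<open>t'\<close> with that threshold therefore covers all times up to
        \<open>t\<close>.\<close>
      have "low_vertices V (?G m) (c * real m / real n) \<subseteq> low_vertices V (?G t') (c * real t / real n)"
      proof
        fix v assume v: "v \<in> low_vertices V (?G m) (c * real m / real n)"
        have "finite (?G m)" using process_graph_subset finite_subset by blast
        then have "card {e \<in> ?G t'. v \<in> e} \<le> card {e \<in> ?G m. v \<in> e}"
          using process_graph_take_mono[OF m(1), of V es] by (intro card_mono) auto
        moreover have "c * real m / real n \<le> c * real t / real n"
          using c m by (intro divide_right_mono mult_left_mono) auto
        ultimately show "v \<in> low_vertices V (?G t') (c * real t / real n)"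
          using v by (auto simp: low_vertices_def)
      qed
      also have "\<dots> = {}" using low_end sat times finite_low[OF finV] by (auto simp: few_low_def)
      finally have "n < 2 * nu V (take m es) + 2" using unm[OF _ m(2) poor] m times by auto
      moreover have "nu V (take m es) \<le> nu V (take t es)"
        using nu_take_mono[OF finV es, of m t] m by simp
      \<comment> \<open>Parity enters here: fewer than two unmatched vertices means none, because
        \<open>n\<close> is even.\<close>
      ultimately show False using neg nu2[of t] ev by presburger
    qed
    then have "{t'..<t} \<subseteq> {i. i < t \<and> rich g (take i es)}" by auto
    then have "t - t' \<le> card {i. i < t \<and> rich g (take i es)}"
      using card_mono[of "{i. i < t \<and> rich g (take i es)}" "{t'..<t}"] by simp
    then have "g * real (t - t') \<le> g * real (card {i. i < t \<and> rich g (take i es)})"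
      using g by (intro mult_left_mono) auto
    then show False using few g by linarith
  qed
  have bound: "real n - 2 * real (nu V (take m es)) \<le> (if m < m1 then real n else 0)
      + (if rich g (take m es) then real n else 0) + (2 * real n * exp (- real m / (4 * real n)) + 1)"
    if m: "m < t" for m
  proof (cases "m < m1 \<or> rich g (take m es)")
    case True
    define x where "x = 2 * real n * exp (- real m / (4 * real n))"
    have "x \<ge> 0" by (simp add: x_def)
    then show ?thesis using True npos unfolding x_def[symmetric]
      by (cases "m < m1"; cases "rich g (take m es)") simp_all
  next
    case False
    then have f: "m1 \<le> m" "\<not> rich g (take m es)" by auto
    then show ?thesis using J[OF f(1) m] unm[OF f(1) m f(2)] by simp
  qed
  have s0: "(\<Sum>m<t. real n - 2 * real (nu V (take m es))) \<le> (\<Sum>m<t. (if m < m1 then real n else 0)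
      + (if rich g (take m es) then real n else 0) + (2 * real n * exp (- real m / (4 * real n)) + 1))"
    using bound by (intro sum_mono) auto
  have s1: "(\<Sum>m<t. (if m < m1 then real n else 0)
      + (if rich g (take m es) then real n else 0) + (2 * real n * exp (- real m / (4 * real n)) + 1))
      = (\<Sum>m<t. if m < m1 then real n else 0) + (\<Sum>m<t. if rich g (take m es) then real n else 0)
      + (2 * real n * (\<Sum>m<t. exp (- real m / (4 * real n))) + real t)"
    by (simp add: sum.distrib sum_distrib_left)
  have s2: "(\<Sum>m<t. if m < m1 then real n else 0) \<le> real n * real m1"
  proof -
    have "(\<Sum>m<t. if m < m1 then real n else 0) \<le> (\<Sum>m<t. if m \<in> {..<m1} then real n else 0)" by simp
    also have "\<dots> = real n * real (card ({..<t} \<inter> {..<m1}))"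
      by (subst sum.If_cases) (auto simp: lessThan_def)
    also have "\<dots> \<le> real n * real m1"
      using card_mono[of "{..<m1}" "{..<t} \<inter> {..<m1}"] by (intro mult_left_mono) auto
    finally show ?thesis .
  qed
  have s3: "(\<Sum>m<t. if rich g (take m es) then real n else 0) \<le> real n * real n / g"
  proof -
    have "(\<Sum>m<t. if rich g (take m es) then real n else 0) = real n * real (card {i. i < t \<and> rich g (take i es)})"
      by (subst sum.If_cases) (auto intro!: arg_cong[of _ _ card])
    also have "\<dots> \<le> real n * (real n / g)"
      using few g by (intro mult_left_mono) (auto simp: field_simps)
    finally show ?thesis by simp
  qed
  have s4: "2 * real n * (\<Sum>m<t. exp (- real m / (4 * real n))) \<le> 2 * real n * (4 * real n + 1)"
    using n8 by (intro mult_left_mono sum_exp_geometric) auto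
  show "(\<Sum>m<t. real n - 2 * real (nu V (take m es)))
      \<le> real n * real m1 + real n * real n / g + (2 * real n * (4 * real n + 1) + real t)"
    using s0 s1 s2 s3 s4 by linarith
qed

end

context horizon
begin

text \<open>The number of low vertices is compared with x = n exp(-m/(4n)), a decay far slower than
  the true rate. The slack pays for the entropy and makes the failure probability exp(-x) at most.
  For m up to 3/2 n ln n this is at most exp(-n^(5/8)), small enough for a union over all
  times.\<close>

lemma prob_low_middle:
  assumes m: "m \<le> T" "10 * m0 \<le> m" "4 * n \<le> m" "real m \<le> 3 / 2 * real n * ln (real n)"
    and d: "0 < d" "6 * d \<le> 1" and z: "0 < z" "z \<le> 1"
    and zd: "9 / 10 \<le> (1 - z) * (1 - 6 * d)" and c: "0 \<le> c" "ln (1 / z) * c \<le> 1 / 48"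
    and small: "exp (- real m / (4 * real n)) \<le> d / 2" "1 \<le> d * real n / 2"
  shows "edge_prob V {es. \<not> few_low m0 d (c * real m / real n) (real n * exp (- real m / (4 * real n))) m es}
    \<le> exp (- (real n * exp (- (3 / 8) * ln (real n))))"
proof -
  define x where "x = real n * exp (- real m / (4 * real n))"
  define s where "s = nat \<lceil>x\<rceil>"
  define w where "w = real m / real n"
  have npos: "real n > 0" using n8 by simp
  have xpos: "x > 0" using npos by (simp add: x_def)
  have s1: "1 \<le> s" "x \<le> real s" "real s \<le> x + 1" using xpos by (auto simp: s_def, linarith+)
  have xd: "x \<le> d * real n / 2"
    using mult_left_mono[OF small(1), of "real n"] npos by (simp add: x_def mult.commute)
  then have sd: "real s \<le> d * real n" using s1 small by simp
  also have "\<dots> \<le> 1 * real n" using d by (intro mult_right_mono) auto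
  finally have sn: "s \<le> n" by simp
  have w4: "w \<ge> 4" using m(3) npos by (simp add: w_def field_simps flip: of_nat_mult of_nat_le_iff)
  have "edge_prob V {es. \<not> few_low m0 d (c * real m / real n) x m es}
    \<le> edge_prob V {es. (\<forall>i<m. m0 \<le> i \<longrightarrow> saturated m0 d (take i es)) \<and>
      s \<le> card (low_vertices V (process_graph V (take m es)) (c * real m / real n))}"
    by (rule edge_prob_mono[OF finV]) (auto simp: few_low_def s_def nat_le_iff ceiling_le_iff not_less)
  also have "\<dots> \<le> exp (real s * (1 + ln (real n / real s) + ln (1 / z) * (c * real m / real n)
      - (1 - z) * (1 - 6 * d) * (real (m - m0) / real n)))"
    using prob_many_low[OF m(1) s1(1) sd sn _ d(2) z, of "c * real m / real n" m0] d c by simp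
  also have "\<dots> \<le> exp (- x)"
  proof -
    have "ln (real n / real s) \<le> ln (real n / x)"
      using npos xpos s1 by (intro ln_mono divide_left_mono) auto
    also have "\<dots> = w / 4" using npos by (simp add: x_def w_def ln_div ln_mult)
    finally have 1: "ln (real n / real s) \<le> w / 4" .
    have "ln (1 / z) * (c * real m / real n) = (ln (1 / z) * c) * w" by (simp add: w_def)
    also have "\<dots> \<le> 1 / 48 * w" using c w4 by (intro mult_right_mono) auto
    finally have 2: "ln (1 / z) * (c * real m / real n) \<le> w / 48" by simp
    have 3: "9 / 10 * w \<le> real (m - m0) / real n"
      using m(2) npos by (simp add: w_def field_simps of_nat_diff)
    then have "9 / 10 * (9 / 10 * w) \<le> (1 - z) * (1 - 6 * d) * (real (m - m0) / real n)"
      using w4 by (intro mult_mono[OF zd 3] order_trans[OF _ zd]) auto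
    \<comment> \<open>With w = m/n the bracket is at most 1 + w/4 + w/48 - 81w/100, which is below
      -1 once w >= 4. The factor 9/10 occurs twice: for the rate and for the loss of the first
      \<open>m0\<close> steps.\<close>
    then have "1 + ln (real n / real s) + ln (1 / z) * (c * real m / real n)
        - (1 - z) * (1 - 6 * d) * (real (m - m0) / real n) \<le> - 1"
      using 1 2 w4 by linarith
    then have "real s * (1 + ln (real n / real s) + ln (1 / z) * (c * real m / real n)
        - (1 - z) * (1 - 6 * d) * (real (m - m0) / real n)) \<le> real s * (- 1)"
      by (intro mult_left_mono) auto
    then show ?thesis using s1 by simp
  qed
  also have "\<dots> \<le> exp (- (real n * exp (- (3 / 8) * ln (real n))))"
  proof -
    have "w \<le> 3 / 2 * ln (real n)" using m(4) npos by (simp add: w_def field_simps)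
    then have "exp (- (3 / 8) * ln (real n)) \<le> exp (- real m / (4 * real n))"
      by (simp add: w_def mult.commute)
    then have "real n * exp (- (3 / 8) * ln (real n)) \<le> x"
      unfolding x_def by (intro mult_left_mono) auto
    then show ?thesis by simp
  qed
  finally show ?thesis by (simp add: x_def)
qed

lemma prob_low_end:
  assumes t: "t \<le> T" and d: "0 < d" "6 * d \<le> 1" "1 \<le> d * real n" and z: "0 < z" "z \<le> 1" and y: "0 \<le> y"
  shows "edge_prob V {es. \<not> few_low m0 d y 1 t es}
    \<le> exp (1 + ln (real n) + ln (1 / z) * y - (1 - z) * (1 - 6 * d) * (real (t - m0) / real n))"
proof -
  have "edge_prob V {es. \<not> few_low m0 d y 1 t es}
    \<le> edge_prob V {es. (\<forall>i<t. m0 \<le> i \<longrightarrow> saturated m0 d (take i es)) \<and>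
      1 \<le> card (low_vertices V (process_graph V (take t es)) y)}"
    by (intro edge_prob_mono[OF finV]) (auto simp: few_low_def)
  also have "\<dots> \<le> exp (1 + ln (real n) + ln (1 / z) * y - (1 - z) * (1 - 6 * d) * (real (t - m0) / real n))"
    using prob_many_low[OF t, of 1 d z y m0] d z y n8 by simp
  finally show ?thesis .
qed

end

section \<open>Asymptotics: choice of times and constants\<close>

lemma real_nat_floor: "x \<ge> 0 \<Longrightarrow> real (nat \<lfloor>x\<rfloor>) \<le> x" "x - 1 \<le> real (nat \<lfloor>x\<rfloor>)"
  by linarith+

definition t_max :: "nat \<Rightarrow> nat" where "t_max n = nat \<lfloor>4 * real n * ln (real n)\<rfloor>"

lemma t_max_le: "n \<ge> 1 \<Longrightarrow> real (t_max n) \<le> 4 * real n * ln (real n)"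
  unfolding t_max_def by (rule real_nat_floor) simp

lemma eventually_horizon:
  assumes "vertex_sets V"
  shows "\<forall>\<^sub>F n in at_top. even n \<longrightarrow> horizon (V n) n (t_max n)"
proof -
  have "\<forall>\<^sub>F n :: nat in at_top. 8 * (4 * real n * ln (real n)) \<le> (real n)\<^sup>2" by real_asymp
  moreover have "\<forall>\<^sub>F n :: nat in at_top. 8 \<le> n" by (rule eventually_ge_at_top)
  ultimately show ?thesis
  proof eventually_elim
    case (elim n)
    have "8 * real (t_max n) \<le> (real n)\<^sup>2" using t_max_le[of n] elim by linarith
    then have "real (8 * t_max n) \<le> real (n\<^sup>2)" by simp
    then have "8 * t_max n \<le> n\<^sup>2" by (simp only: of_nat_le_iff)
    then show ?case using elim assms by (auto simp: vertex_sets_def horizon_def)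
  qed
qed

lemma whp_horizon:
  assumes V: "vertex_sets V" and r: "r \<longlonglongrightarrow> 0"
    and "\<forall>\<^sub>F n in at_top. horizon (V n) n (t_max n) \<longrightarrow> edge_prob (V n) {es. \<not> Q n es} \<le> r n"
  shows "whp V Q"
proof (rule whpI[OF _ r])
  show "\<forall>\<^sub>F n in at_top. even n \<longrightarrow> edge_prob (V n) {es. \<not> Q n es} \<le> r n"
    using eventually_horizon[OF V] assms(3) by eventually_elim auto
qed

lemma whp_max_degree:
  assumes V: "vertex_sets V" and d: "d > 0"
  shows "whp V (\<lambda>n es. max_degree_le (V n) (take (t_max n) es) (d * real n))"
proof (rule whp_horizon[OF V])
  show "(\<lambda>n. real n * exp (28 * ln (real n) - d * real n)) \<longlonglongrightarrow> 0" using d by real_asymp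
  show "\<forall>\<^sub>F n in at_top. horizon (V n) n (t_max n) \<longrightarrow>
      edge_prob (V n) {es. \<not> max_degree_le (V n) (take (t_max n) es) (d * real n)}
      \<le> real n * exp (28 * ln (real n) - d * real n)"
    using eventually_ge_at_top[of 1]
  proof eventually_elim
    case (elim n)
    have "7 * real (t_max n) / real n \<le> 28 * ln (real n)"
      using t_max_le[of n] elim by (simp add: field_simps)
    then have "real n * exp (7 * real (t_max n) / real n - d * real n) \<le> real n * exp (28 * ln (real n) - d * real n)"
      by (intro mult_left_mono) auto
    then show ?case using horizon.prob_max_degree[of "V n" n "t_max n" "d * real n"] by force
  qed
qed

lemma whp_few_rich:
  assumes V: "vertex_sets V" and g: "g > 0" and t: "\<forall>\<^sub>F n in at_top. t n \<le> t_max n"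
  shows "whp V (\<lambda>n es. g * real (card {i. i < t n \<and> horizon.rich (V n) n g (take i es)}) < real n)"
proof (rule whp_horizon[OF V])
  show "(\<lambda>n. exp (- real n / 2)) \<longlonglongrightarrow> 0" by real_asymp
  show "\<forall>\<^sub>F n in at_top. horizon (V n) n (t_max n) \<longrightarrow>
      edge_prob (V n) {es. \<not> g * real (card {i. i < t n \<and> horizon.rich (V n) n g (take i es)}) < real n}
      \<le> exp (- real n / 2)"
    using t
  proof eventually_elim
    case (elim n)
    then show ?case using horizon.prob_many_rich[of "V n" n "t_max n" "t n" g] g by (simp add: not_less)
  qed
qed

text \<open>At most 4 n ln n times are involved, so each single failure probability must be smaller
  than this by a factor tending to infinity.\<close>

lemma whp_all_times:
  assumes V: "vertex_sets V" and t: "\<forall>\<^sub>F n in at_top. t n \<le> t_max n"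
    and r: "\<And>n. 0 \<le> r n" "(\<lambda>n. 4 * real n * ln (real n) * r n) \<longlonglongrightarrow> 0"
    and P: "\<forall>\<^sub>F n in at_top. horizon (V n) n (t_max n) \<longrightarrow>
      (\<forall>m\<in>{k * n..<t n}. edge_prob (V n) {es. \<not> P n m es} \<le> r n)"
  shows "whp V (\<lambda>n es. \<forall>m\<in>{k * n..<t n}. P n m es)"
proof (rule whp_horizon[OF V r(2)])
  show "\<forall>\<^sub>F n in at_top. horizon (V n) n (t_max n) \<longrightarrow>
      edge_prob (V n) {es. \<not> (\<forall>m\<in>{k * n..<t n}. P n m es)} \<le> 4 * real n * ln (real n) * r n"
    using t P eventually_ge_at_top[of 1]
  proof eventually_elim
    case (elim n)
    show ?case
    proof
      assume "horizon (V n) n (t_max n)"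
      then have "edge_prob (V n) (\<Union>m\<in>{k * n..<t n}. {es. \<not> P n m es}) \<le> real (card {k * n..<t n}) * r n"
        using elim(2) by (intro edge_prob_UN_le) auto
      also have "\<dots> \<le> 4 * real n * ln (real n) * r n"
      proof (rule mult_right_mono[OF _ r(1)])
        have "real (card {k * n..<t n}) \<le> real (t_max n)" using elim(1) by simp
        then show "real (card {k * n..<t n}) \<le> 4 * real n * ln (real n)"
          using t_max_le[OF elim(3)] by linarith
      qed
      also have "(\<Union>m\<in>{k * n..<t n}. {es. \<not> P n m es}) = {es. \<not> (\<forall>m\<in>{k * n..<t n}. P n m es)}" by auto
      finally show "edge_prob (V n) {es. \<not> (\<forall>m\<in>{k * n..<t n}. P n m es)} \<le> 4 * real n * ln (real n) * r n" .
    qed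
  qed
qed

lemma whp_sparse:
  assumes V: "vertex_sets V" and c: "0 < c" "c \<le> 1" "64 / c \<le> real k" and t: "\<forall>\<^sub>F n in at_top. t n \<le> t_max n"
  shows "whp V (\<lambda>n es. \<forall>m\<in>{k * n..<t n}. locally_sparse (V n) (set (take m es))
      (exp (- 2 * (1 - ln (c / 8))) * real n) (c * real m / (4 * real n)))"
proof (rule whp_all_times[OF V t])
  show "(\<lambda>n. 4 * real n * ln (real n) * (real n * exp (- 6 * ln (real n)))) \<longlonglongrightarrow> 0" by real_asymp
  show "\<forall>\<^sub>F n in at_top. horizon (V n) n (t_max n) \<longrightarrow> (\<forall>m\<in>{k * n..<t n}.
      edge_prob (V n) {es. \<not> locally_sparse (V n) (set (take m es))
      (exp (- 2 * (1 - ln (c / 8))) * real n) (c * real m / (4 * real n))} \<le> real n * exp (- 6 * ln (real n)))"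
    using t
  proof (eventually_elim, intro impI ballI)
    fix n m assume n: "t n \<le> t_max n" and h: "horizon (V n) n (t_max n)" and m: "m \<in> {k * n..<t n}"
    have "64 * real n \<le> c * real k * real n" using c by (intro mult_right_mono) (auto simp: field_simps)
    also have "\<dots> \<le> c * real m" using m c by (simp add: mult.assoc flip: of_nat_mult)
    finally show "edge_prob (V n) {es. \<not> locally_sparse (V n) (set (take m es))
      (exp (- 2 * (1 - ln (c / 8))) * real n) (c * real m / (4 * real n))} \<le> real n * exp (- 6 * ln (real n))"
      using m n c by (intro horizon.prob_not_locally_sparse[OF h]) auto
  qed
qed simp

lemma whp_low_middle:
  assumes V: "vertex_sets V" and t: "\<forall>\<^sub>F n in at_top. t n \<le> t_max n"
    "\<forall>\<^sub>F n in at_top. real (t n) \<le> 3 / 2 * real n * ln (real n)"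
    and d: "0 < d" "6 * d \<le> 1" and z: "0 < z" "z \<le> 1"
    and zd: "9 / 10 \<le> (1 - z) * (1 - 6 * d)" and c: "0 \<le> c" "ln (1 / z) * c \<le> 1 / 48"
    and k: "10 * k0 \<le> k" "4 \<le> k" "exp (- real k / 4) \<le> d / 2"
  shows "whp V (\<lambda>n es. \<forall>m\<in>{k * n..<t n}.
    horizon.few_low (V n) n (k0 * n) d (c * real m / real n) (real n * exp (- real m / (4 * real n))) m es)"
proof (rule whp_all_times[OF V t(1)])
  show "(\<lambda>n. 4 * real n * ln (real n) * exp (- (real n * exp (- (3 / 8) * ln (real n))))) \<longlonglongrightarrow> 0" by real_asymp
  show "\<forall>\<^sub>F n in at_top. horizon (V n) n (t_max n) \<longrightarrow> (\<forall>m\<in>{k * n..<t n}. edge_prob (V n)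
      {es. \<not> horizon.few_low (V n) n (k0 * n) d (c * real m / real n) (real n * exp (- real m / (4 * real n))) m es}
      \<le> exp (- (real n * exp (- (3 / 8) * ln (real n)))))"
    using t eventually_ge_at_top[of "nat \<lceil>2 / d\<rceil>"]
  proof (eventually_elim, intro impI ballI)
    fix n m assume n: "t n \<le> t_max n" "real (t n) \<le> 3 / 2 * real n * ln (real n)" "nat \<lceil>2 / d\<rceil> \<le> n"
      and h: "horizon (V n) n (t_max n)" and m: "m \<in> {k * n..<t n}"
    have npos: "real n > 0" using horizon.n8[OF h] by simp
    have "10 * k0 * n \<le> k * n" by (rule mult_le_mono1[OF k(1)])
    then have "10 * (k0 * n) \<le> m" using m by (simp only: mult.assoc atLeastLessThan_iff) linarith
    moreover have "4 * n \<le> m" using m mult_le_mono1[OF k(2), of n] unfolding atLeastLessThan_iff by linarith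
    moreover have "exp (- real m / (4 * real n)) \<le> d / 2"
    proof -
      have "real k * real n \<le> real m" using m by (simp flip: of_nat_mult)
      then have "real k / 4 \<le> real m / (4 * real n)" using npos by (simp add: field_simps)
      then have "exp (- real m / (4 * real n)) \<le> exp (- real k / 4)" by simp
      then show ?thesis using k by linarith
    qed
    moreover have "2 / d \<le> real n" using n(3) by linarith
    then have "1 \<le> d * real n / 2" using d by (simp add: field_simps)
    moreover have "m \<le> t_max n" "real m \<le> 3 / 2 * real n * ln (real n)" using m n by auto
    ultimately show "edge_prob (V n)
      {es. \<not> horizon.few_low (V n) n (k0 * n) d (c * real m / real n) (real n * exp (- real m / (4 * real n))) m es}
      \<le> exp (- (real n * exp (- (3 / 8) * ln (real n))))"
      using d z zd c by (intro horizon.prob_low_middle[OF h]) auto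
  qed
qed simp

lemma whp_low_end:
  assumes V: "vertex_sets V" and t: "\<forall>\<^sub>F n in at_top. t n \<le> t_max n"
    and d: "0 < d" "6 * d \<le> 1" and z: "0 < z" "z \<le> 1" and y: "\<And>n. 0 \<le> y n"
    and r: "r \<longlonglongrightarrow> 0"
      "\<forall>\<^sub>F n in at_top. exp (1 + ln (real n) + ln (1 / z) * y n - (1 - z) * (1 - 6 * d) * (real (t n - k0 * n) / real n)) \<le> r n"
  shows "whp V (\<lambda>n es. horizon.few_low (V n) n (k0 * n) d (y n) 1 (t n) es)"
proof (rule whp_horizon[OF V r(1)])
  show "\<forall>\<^sub>F n in at_top. horizon (V n) n (t_max n) \<longrightarrow> edge_prob (V n)
      {es. \<not> horizon.few_low (V n) n (k0 * n) d (y n) 1 (t n) es} \<le> r n"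
    using t r(2) eventually_ge_at_top[of "nat \<lceil>1 / d\<rceil>"]
  proof eventually_elim
    case (elim n)
    show ?case
    proof
      assume h: "horizon (V n) n (t_max n)"
      have "1 / d \<le> real n" using elim by linarith
      then have "1 \<le> d * real n" using d by (simp add: field_simps)
      then show "edge_prob (V n) {es. \<not> horizon.few_low (V n) n (k0 * n) d (y n) 1 (t n) es} \<le> r n"
        using horizon.prob_low_end[OF h elim(1) d _ z, where y = "y n" and ?m0.0 = "k0 * n"] y[of n] elim(2)
        by (meson order_trans)
    qed
  qed
qed

definition t_match :: "real \<Rightarrow> nat \<Rightarrow> nat" where
  "t_match eps n = nat \<lfloor>(1 + eps) * real n * ln (real n)\<rfloor>"

lemma t_match_bounds:
  assumes "n \<ge> 1" "eps \<ge> 0"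
  shows "real (t_match eps n) \<le> (1 + eps) * real n * ln (real n)"
    "(1 + eps) * real n * ln (real n) - 1 \<le> real (t_match eps n)"
  unfolding t_match_def using assms by (intro real_nat_floor; simp)+

lemma t_match_mono: "n \<ge> 1 \<Longrightarrow> eps \<le> eps' \<Longrightarrow> t_match eps n \<le> t_match eps' n"
  unfolding t_match_def by (intro nat_mono floor_mono mult_right_mono) auto

lemma t_match_le_max: "n \<ge> 1 \<Longrightarrow> eps \<le> 3 \<Longrightarrow> t_match eps n \<le> t_max n"
  unfolding t_match_def t_max_def by (intro nat_mono floor_mono mult_right_mono) auto

text \<open>The constant is chosen before the vertex sets and depends on \<open>eps\<close> only, so
  a fixed \<open>eps\<close> yields an absolute constant.\<close>

lemma whp_matching_phase:
  assumes eps: "0 < eps" "eps \<le> 1 / 2"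
  shows "\<exists>K. \<forall>V :: nat \<Rightarrow> 'a set. vertex_sets V \<longrightarrow> whp V (\<lambda>n es.
    2 * nu (V n) (take (t_match eps n) es) = n \<and>
    (\<Sum>m<t_match eps n. real n - 2 * real (nu (V n) (take m es))) \<le> K * (real n)\<^sup>2)"
proof -
  \<comment> \<open>\<open>d\<close> bounds deficiency and degree as fractions of \<open>n\<close>,
    and \<open>z\<close> is the tilt with ln(1/z) = \<open>l\<close>. Both are small enough that q =
    (1-z)(1-6d) satisfies q (1 + eps/2) >= 1 + eps/4. The choice of \<open>c\<close> makes the cost
    of the degree threshold l c = eps/24. \<open>g\<close> takes at most half of each available
    count of augmenting pairs; the other half absorbs the offered pairs.\<close>
  define d z l where "d = eps / 100" and "z = eps / 16" and "l = ln (16 / eps)"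
  define c where "c = eps / (24 * l)"
  define al where "al = exp (- 2 * (1 - ln (c / 8)))"
  define g where "g = min (d\<^sup>2) (al\<^sup>2 / 16)"
  define k0 where "k0 = nat \<lceil>1 / g\<rceil>"
  define k where "k = max (10 * k0) (max 4 (max (nat \<lceil>64 / c\<rceil>) (nat \<lceil>- 4 * ln (min (d / 2) (al / 8))\<rceil>)))"
  define q where "q = (1 - z) * (1 - 6 * d)"
  have l1: "l \<ge> 1"
  proof -
    have "eps * exp 1 \<le> 1 / 2 * (3 :: real)" using eps exp_le by (intro mult_mono) auto
    then have "exp 1 \<le> (16 / eps :: real)" using eps by (simp add: field_simps)
    then show ?thesis unfolding l_def using eps by (subst ln_ge_iff) auto
  qed
  have c: "0 < c" "c \<le> 1" "l * c = eps / 24" using eps l1 by (auto simp: c_def field_simps)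
  have al: "0 < al" by (simp add: al_def)
  have d: "0 < d" "6 * d \<le> 1" and z: "0 < z" "z \<le> 1" using eps by (auto simp: d_def z_def)
  have lz: "ln (1 / z) = l" by (simp add: z_def l_def)
  have g: "0 < g" "g \<le> d\<^sup>2" "g \<le> al\<^sup>2 / 16" using d al by (auto simp: g_def)
  have "1 / g \<le> real k0" unfolding k0_def by linarith
  then have k0: "1 \<le> g * real k0" using g(1) by (simp add: field_simps)
  have k: "10 * k0 \<le> k" "4 \<le> k" "64 / c \<le> real k" "exp (- real k / 4) \<le> d / 2" "exp (- real k / 4) \<le> al / 8"
  proof -
    show "10 * k0 \<le> k" "4 \<le> k" unfolding k_def le_max_iff_disj by blast+
    have "nat \<lceil>64 / c\<rceil> \<le> k" "nat \<lceil>- 4 * ln (min (d / 2) (al / 8))\<rceil> \<le> k"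
      unfolding k_def le_max_iff_disj by blast+
    then show "64 / c \<le> real k" by linarith
    have "- 4 * ln (min (d / 2) (al / 8)) \<le> real k"
      using \<open>nat \<lceil>- 4 * ln (min (d / 2) (al / 8))\<rceil> \<le> k\<close> by linarith
    then have "exp (- real k / 4) \<le> exp (ln (min (d / 2) (al / 8)))" by simp
    also have "\<dots> = min (d / 2) (al / 8)" using d al by (intro exp_ln) auto
    finally show "exp (- real k / 4) \<le> d / 2" "exp (- real k / 4) \<le> al / 8" by auto
  qed
  have q1: "q \<le> 1" "9 / 10 \<le> q" "1 + eps / 4 \<le> q * (1 + eps / 2)"
  proof -
    have q: "q = 1 - 49 * eps / 400 + 3 * eps\<^sup>2 / 800"
      by (simp add: q_def z_def d_def field_simps power2_eq_square)
    have e2: "0 \<le> eps\<^sup>2" "eps\<^sup>2 \<le> eps / 2" "0 \<le> eps * eps\<^sup>2"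
      using eps by (auto simp: power2_eq_square mult_left_mono[of eps "1/2" eps])
    show "q \<le> 1" "9 / 10 \<le> q" using q e2 eps by linarith+
    have "q * (1 + eps / 2) = 1 + 151 * eps / 400 - 46 * eps\<^sup>2 / 800 + 3 * (eps * eps\<^sup>2) / 1600"
      unfolding q by (simp add: field_simps power2_eq_square)
    then show "1 + eps / 4 \<le> q * (1 + eps / 2)" using e2 eps by linarith
  qed
  let ?t = "t_match eps" and ?t' = "t_match (eps / 2)"
  have tmax: "\<forall>\<^sub>F n in at_top. ?t n \<le> t_max n" "\<forall>\<^sub>F n in at_top. ?t' n \<le> t_max n"
    using eventually_ge_at_top[of 1] by (eventually_elim, use eps in \<open>simp add: t_match_le_max\<close>)+
  have t32: "\<forall>\<^sub>F n in at_top. real (?t n) \<le> 3 / 2 * real n * ln (real n)"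
    using eventually_ge_at_top[of 1]
  proof eventually_elim
    case (elim n)
    have "(1 + eps) * (real n * ln (real n)) \<le> 3 / 2 * (real n * ln (real n))"
      using eps elim by (intro mult_right_mono) auto
    then show ?case using t_match_bounds[OF elim, of eps] eps by (simp add: mult.assoc)
  qed
  define y where "y n = c * real (?t n) / real n" for n
  define r where "r n = exp (2 + real k0 - 3 * eps / 16 * ln (real n))" for n
  have r0: "r \<longlonglongrightarrow> 0" unfolding r_def using eps by real_asymp
  have r: "\<forall>\<^sub>F n in at_top. exp (1 + ln (real n) + ln (1 / z) * y n - (1 - z) * (1 - 6 * d) * (real (?t' n - k0 * n) / real n)) \<le> r n"
    using eventually_ge_at_top[of 1]
  proof eventually_elim
    case (elim n)
    have npos: "real n > 0" "ln (real n) \<ge> 0" using elim by auto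
    have "ln (1 / z) * y n = (l * c) * (real (?t n) / real n)" by (simp add: lz y_def)
    also have "\<dots> = eps / 24 * (real (?t n) / real n)" unfolding c(3) ..
    also have "\<dots> \<le> eps / 24 * ((1 + eps) * ln (real n))"
      using t_match_bounds(1)[OF elim, of eps] eps npos by (intro mult_left_mono) (auto simp: field_simps)
    also have "\<dots> \<le> eps / 24 * (3 / 2 * ln (real n))"
      using eps npos by (intro mult_left_mono mult_right_mono) auto
    finally have 1: "ln (1 / z) * y n \<le> eps / 16 * ln (real n)" by simp
    have "(1 + eps / 2) * real n * ln (real n) - 1 - real k0 * real n \<le> real (?t' n - k0 * n)"
    proof -
      have "?t' n \<le> (?t' n - k0 * n) + k0 * n" by simp
      then have "real (?t' n) \<le> real ((?t' n - k0 * n) + k0 * n)" by (simp only: of_nat_le_iff)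
      then have "real (?t' n) \<le> real (?t' n - k0 * n) + real k0 * real n"
        by (simp only: of_nat_add of_nat_mult)
      then show ?thesis using t_match_bounds(2)[OF elim, of "eps / 2"] eps by linarith
    qed
    then have "((1 + eps / 2) * real n * ln (real n) - 1 - real k0 * real n) / real n \<le> real (?t' n - k0 * n) / real n"
      using npos by (intro divide_right_mono) auto
    moreover have "((1 + eps / 2) * real n * ln (real n) - 1 - real k0 * real n) / real n = (1 + eps / 2) * ln (real n) - 1 / real n - real k0"
      using npos by (simp add: field_simps)
    moreover have "1 / real n \<le> 1" using elim by simp
    ultimately have "(1 + eps / 2) * ln (real n) - (1 + real k0) \<le> real (?t' n - k0 * n) / real n" by linarith
    then have "q * ((1 + eps / 2) * ln (real n) - (1 + real k0)) \<le> q * (real (?t' n - k0 * n) / real n)"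
      using q1 by (intro mult_left_mono) auto
    moreover have "(1 + eps / 4) * ln (real n) \<le> q * (1 + eps / 2) * ln (real n)"
      using q1 npos by (intro mult_right_mono) auto
    moreover have "q * (1 + real k0) \<le> 1 * (1 + real k0)" using q1 by (intro mult_right_mono) auto
    ultimately have 2: "(1 + eps / 4) * ln (real n) - (1 + real k0) \<le> q * (real (?t' n - k0 * n) / real n)"
      by (simp add: algebra_simps)
    \<comment> \<open>The net coefficient of ln n is 1 + eps/16 - (1 + eps/4) = -3 eps/16.\<close>
    have "1 + ln (real n) + ln (1 / z) * y n - q * (real (?t' n - k0 * n) / real n) \<le> 2 + real k0 - 3 * eps / 16 * ln (real n)"
      using 1 2 by (simp add: algebra_simps)
    then show ?case unfolding r_def q_def by simp
  qed
  have num: "\<forall>\<^sub>F n :: nat in at_top. 4 * real n * ln (real n) + d * real n \<le> d\<^sup>2 * (real n)\<^sup>2"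
    "\<forall>\<^sub>F n :: nat in at_top. 4 * real n * ln (real n) \<le> al\<^sup>2 / 16 * (real n)\<^sup>2"
    "\<forall>\<^sub>F n :: nat in at_top. real n / g \<le> eps / 2 * real n * ln (real n) - 1"
    "\<forall>\<^sub>F n :: nat in at_top. real k * real n \<le> (1 + eps / 2) * real n * ln (real n) - 1"
    using d al g eps by real_asymp+
  have lzc: "ln (1 / z) * c \<le> 1 / 48" using c lz eps by simp
  have y0: "0 \<le> y n" for n using c by (simp add: y_def)
  \<comment> \<open>The early steps contribute k n^2, the rich ones n^2/g, and the geometric sum
    with the lower-order terms at most 11 n^2.\<close>
  define K where "K = real k + 1 / g + 11"
  show ?thesis
  proof (intro exI[of _ K] allI impI)
    fix V :: "nat \<Rightarrow> 'a set" assume V: "vertex_sets V"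
    note whps = whp_conj[OF whp_conj[OF whp_max_degree[OF V d(1)] whp_few_rich[OF V g(1) tmax(1)]]
      whp_conj[OF whp_sparse[OF V c(1,2) k(3) tmax(1)]
        whp_conj[OF whp_low_middle[OF V tmax(1) t32 d z q1(2)[unfolded q_def] less_imp_le[OF c(1)] lzc k(1,2,4)]
          whp_low_end[OF V tmax(2) d z y0 r0 r]]]]
    show "whp V (\<lambda>n es. 2 * nu (V n) (take (?t n) es) = n \<and>
      (\<Sum>m<?t n. real n - 2 * real (nu (V n) (take m es))) \<le> K * (real n)\<^sup>2)"
    proof (rule whp_mono[OF V whps], use eventually_horizon[OF V] tmax(1) num eventually_ge_at_top[of 1] in eventually_elim)
      case (elim n)
      show ?case
      proof (intro impI ballI, elim conjE)
        fix es assume ev: "even n" and es: "es \<in> edge_orders (V n)"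
          and md: "max_degree_le (V n) (take (t_max n) es) (d * real n)"
          and few: "g * real (card {i. i < ?t n \<and> horizon.rich (V n) n g (take i es)}) < real n"
          and sp: "\<forall>m\<in>{k * n..<?t n}. locally_sparse (V n) (set (take m es))
           (exp (- 2 * (1 - ln (c / 8))) * real n) (c * real m / (4 * real n))"
          and low: "\<forall>m\<in>{k * n..<?t n}. horizon.few_low (V n) n (k0 * n) d (c * real m / real n)
            (real n * exp (- real m / (4 * real n))) m es"
          and low_end: "horizon.few_low (V n) n (k0 * n) d (y n) 1 (?t' n) es"
        interpret horizon "V n" n "t_max n" using elim ev by blast
        have npos: "real n > 0" using n8 by simp
        have tm: "real (t_max n) \<le> 4 * real n * ln (real n)" using t_max_le n8 by simp
        have t'k: "k * n \<le> ?t' n"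
        proof -
          have "real k * real n \<le> real (?t' n)"
            using t_match_bounds(2)[of n "eps / 2"] elim eps by linarith
          then show ?thesis by (simp only: of_nat_le_iff flip: of_nat_mult)
        qed
        have gap: "real n \<le> g * real (?t n - ?t' n)"
        proof -
          have "(1 + eps) * real n * ln (real n) - 1 - (1 + eps / 2) * real n * ln (real n) \<le> real (?t n) - real (?t' n)"
            using t_match_bounds(2)[of n eps] t_match_bounds(1)[of n "eps / 2"] n8 eps by simp
          also have "\<dots> \<le> real (?t n - ?t' n)" by simp
          finally have "(1 + eps) * real n * ln (real n) - 1 - (1 + eps / 2) * real n * ln (real n)
            \<le> real (?t n - ?t' n)" .
          moreover have "(1 + eps) * real n * ln (real n) - 1 - (1 + eps / 2) * real n * ln (real n)
            = eps / 2 * real n * ln (real n) - 1" by (simp add: algebra_simps)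
          ultimately have "real n / g \<le> real (?t n - ?t' n)" using elim by linarith
          then show ?thesis using g(1) by (simp add: field_simps)
        qed
        have a: "k0 * n \<le> k * n" "?t' n \<le> ?t n" "0 < k * n" "real n \<le> g * real (k0 * n)"
          "exp (- real (k * n) / (4 * real n)) \<le> al / 8"
          using k(1,2,5) eps n8 npos mult_right_mono[OF k0, of "real n"]
          by (simp_all add: t_match_mono)
        have gg: "g * (real n)\<^sup>2 \<le> d\<^sup>2 * (real n)\<^sup>2" "g * (real n)\<^sup>2 \<le> al\<^sup>2 / 16 * (real n)\<^sup>2"
          using g by (intro mult_right_mono; simp)+
        have e1: "2 * d * real n * (2 * d * real n - 1) / 2 = 2 * (d\<^sup>2 * (real n)\<^sup>2) - d * real n"
          by (simp add: power2_eq_square field_simps)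
        have e2: "(al * real n / 2)\<^sup>2 / 2 = 2 * (al\<^sup>2 / 16 * (real n)\<^sup>2)"
          by (simp add: power2_eq_square)
        have b: "g * (real n)\<^sup>2 + real (t_max n) \<le> 2 * d * real n * (2 * d * real n - 1) / 2"
          "g * (real n)\<^sup>2 + real (t_max n) \<le> (al * real n / 2)\<^sup>2 / 2"
          unfolding e1 e2 using gg tm elim by linarith+
        have sp': "locally_sparse (V n) (set (take m es)) (al * real n) (c * real m / (4 * real n))"
          if "k * n \<le> m" "m < ?t n" for m using sp that unfolding al_def by auto
        have low': "few_low (k0 * n) d (c * real m / real n) (real n * exp (- real m / (4 * real n))) m es"
          if "k * n \<le> m" "m < ?t n" for m using low that by auto
        note mp = matching_phase[OF es ev a(1) t'k a(2) elim(2) a(3) md d(1) few g(1) a(4) gap b al a(5) c(1),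
            OF sp' low' low_end[unfolded y_def]]
        have mp1: "2 * nu (V n) (take (?t n) es) = n" by (rule mp(1))
        have mp2: "(\<Sum>m<?t n. real n - 2 * real (nu (V n) (take m es)))
          \<le> real n * real (k * n) + real n * real n / g + (2 * real n * (4 * real n + 1) + real (?t n))"
          by (rule mp(2))
        have "real n * real (k * n) + real n * real n / g + (2 * real n * (4 * real n + 1) + real (?t n))
          \<le> K * (real n)\<^sup>2"
        proof -
          have "real (?t n) \<le> real (t_max n)" using elim by simp
          moreover have "8 * real (t_max n) \<le> (real n)\<^sup>2" using T by (simp flip: of_nat_power of_nat_mult)
          moreover have "8 * real n \<le> real n * real n" using n8 by (intro mult_right_mono) auto
          ultimately have "2 * real n + real (?t n) \<le> 3 * (real n)\<^sup>2"
            by (simp add: power2_eq_square)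
          then show ?thesis by (simp add: K_def power2_eq_square algebra_simps)
        qed
        then show "2 * nu (V n) (take (?t n) es) = n \<and>
          (\<Sum>m<?t n. real n - 2 * real (nu (V n) (take m es))) \<le> K * (real n)\<^sup>2"
          using mp1 mp2 by linarith
      qed
    qed
  qed
qed

section \<open>The optimal vertex cover\<close>

definition forced_out :: "'a set \<Rightarrow> 'a set set \<Rightarrow> 'a set" where
  "forced_out V E = {v \<in> V. \<forall>C. is_optimal_vertex_cover V E C \<longrightarrow> v \<notin> C}"

definition flexible :: "'a set \<Rightarrow> 'a set set \<Rightarrow> 'a \<Rightarrow> bool" where
  "flexible V E v \<longleftrightarrow> (\<exists>C. is_optimal_vertex_cover V E C \<and> v \<in> C) \<and>
     (\<exists>C. is_optimal_vertex_cover V E C \<and> v \<notin> C)"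

text \<open>A window of length 1600 n is linear, hence negligible against n log n, yet long enough
  to beat the union over all subsets.\<close>

definition avoids_inside :: "'a set \<Rightarrow> nat \<Rightarrow> nat \<Rightarrow> 'a set list \<Rightarrow> bool" where
  "avoids_inside S n t es \<longleftrightarrow> real n / 20 \<le> real (card S) \<and>
      (\<forall>i. t \<le> i \<longrightarrow> i < t + 1600 * n \<longrightarrow> es ! i \<notin> nsets S 2)"

definition avoids_between :: "'a set \<Rightarrow> 'a set \<Rightarrow> nat \<Rightarrow> nat \<Rightarrow> 'a set list \<Rightarrow> bool" where
  "avoids_between S R n t es \<longleftrightarrow> S \<inter> R = {} \<and> real n / 20 \<le> real (card S) \<and> real n / 4 \<le> real (card R) \<and>
      (\<forall>i. t \<le> i \<longrightarrow> i < t + 1600 * n \<longrightarrow> es ! i \<notin> {e. \<exists>a\<in>S. \<exists>b\<in>R. e = {a, b}})"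

text \<open>The clauses at time \<open>m\<close> persist afterwards: the matching stays perfect and,
  since optimal covers only disappear, \<open>forced_out\<close> can only grow.\<close>

definition stays_flexible :: "'a set \<Rightarrow> nat \<Rightarrow> nat \<Rightarrow> nat \<Rightarrow> 'a set list \<Rightarrow> 'a \<Rightarrow> bool" where
  "stays_flexible V n m t es v \<longleftrightarrow> 2 * nu V (take m es) = n \<and>
      2 / 5 * real n \<le> real (card (forced_out V (process_graph V (take m es)))) \<and>
      max_degree_le V (take t es) (1 / 20 * real n) \<and> flexible V (process_graph V (take t es)) v"

context horizon
begin

abbreviation optimal_at :: "'a set list \<Rightarrow> nat \<Rightarrow> 'a set \<Rightarrow> bool" where
  "optimal_at es i C \<equiv> is_optimal_vertex_cover V (process_graph V (take i es)) C"

lemma perfect_after: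
  assumes "es \<in> edge_orders V" "2 * nu V (take t es) = n" "t \<le> i"
  shows "2 * nu V (take i es) = n"
  using nu_take_mono[OF finV assms(1,3)] nu_take_le[OF finV assms(1), of i] assms(2) card_V by linarith

text \<open>Once the matching is perfect the cover number no longer grows, so optimal covers can only
  disappear.\<close>

lemma optimal_at_earlier:
  assumes es: "es \<in> edge_orders V" and perf: "2 * nu V (take t es) = n"
    and i: "t \<le> i" "i \<le> j" and C: "optimal_at es j C"
  shows "optimal_at es i C"
proof (rule optimal_cover_same_number[OF finV _ process_graph_take_mono[OF i(2)] _ C])
  have "nu V (take i es) = nu V (take j es)"
    using perfect_after[OF es perf, of i] perfect_after[OF es perf, of j] i by linarith
  then show "vertex_cover_number V (process_graph V (take i es)) = vertex_cover_number V (process_graph V (take j es))"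
    using process_graph_konig[OF finV, of "take i es"] process_graph_konig[OF finV, of "take j es"]
    by (simp add: konig_graph_def)
qed (rule process_graph_edges[OF permutation_prefix(2)[OF es]])

lemma optimal_at_card: "optimal_at es i C \<Longrightarrow> C \<subseteq> V \<and> card C = nu V (take i es)"
  using process_graph_konig[OF finV, of "take i es"]
  by (auto simp: is_optimal_vertex_cover_def is_vertex_cover_def konig_graph_def)

lemma optimal_at_covers: "optimal_at es j C \<Longrightarrow> e \<in> process_graph V (take i es) \<Longrightarrow> i \<le> j \<Longrightarrow> e \<inter> C \<noteq> {}"
  using process_graph_take_mono[of i j V es] by (auto simp: is_optimal_vertex_cover_def is_vertex_cover_def)

text \<open>A pair is rejected only if it misses every optimal cover of the current graph. From time
  \<open>t\<close> on \<open>C\<close> is one of them: up to \<open>t2\<close> because optimality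
  passes to earlier times, and afterwards because any optimal cover was already optimal at
  \<open>t2\<close> and so equals \<open>C\<close>. Missing pairs meeting \<open>C\<close> were thus
  rejected before \<open>t\<close>, while missing the running cover.\<close>

lemma missing_pairs_le_hits:
  assumes es: "es \<in> edge_orders V" and perf: "2 * nu V (take t es) = n"
    and t: "t \<le> t2" "t2 \<le> T"
    and uniq: "\<And>D. optimal_at es t2 D \<longleftrightarrow> D = C"
  shows "card {p \<in> nsets V 2. p \<inter> C \<noteq> {} \<and> p \<notin> process_graph V es}
    \<le> hits (\<lambda>xs. {e. e \<inter> (C - canonical_cover V xs) \<noteq> {}}) t es"
proof -
  let ?S = "\<lambda>xs. {e. e \<inter> (C - canonical_cover V xs) \<noteq> {}}"
  have len: "length es = card (nsets V 2)" using permutation_prefix es by blast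

  have sub: "{p \<in> nsets V 2. p \<inter> C \<noteq> {} \<and> p \<notin> process_graph V es} \<subseteq> {e. \<exists>i<t. e = es ! i \<and> es ! i \<in> ?S (take i es)}"
  proof
    fix p assume "p \<in> {p \<in> nsets V 2. p \<inter> C \<noteq> {} \<and> p \<notin> process_graph V es}"
    then have p: "p \<in> nsets V 2" "p \<inter> C \<noteq> {}" "p \<notin> process_graph V es" by auto
    have "p \<in> set es" using p(1) es by (simp add: permutations_of_set_def)
    then obtain i where i: "i < length es" "p = es ! i" by (auto simp: in_set_conv_nth)
    have rej: "p \<inter> D = {}" if D: "optimal_at es i D" for D
    proof (rule ccontr)
      assume "p \<inter> D \<noteq> {}"
      then have "es ! i \<in> process_graph V (take (length es) es)"
        using i(2) len by (intro accepted_in_later[OF finV es i(1) _ D]) auto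
      then show False using p(3) i(2) by simp
    qed
    have "i < t"
    proof (rule ccontr)
      assume it: "\<not> i < t"
      obtain D where D: "optimal_at es i D"
        using canonical_cover(1)[OF finV permutation_prefix(2)[OF es]] by blast
      have "optimal_at es i C"
      proof (cases "i \<le> t2")
        case True
        then show ?thesis using optimal_at_earlier[OF es perf, of i t2 C] it uniq by simp
      next
        case False
        then have "optimal_at es t2 D" using optimal_at_earlier[OF es perf t(1), of i D] D by simp
        then show ?thesis using uniq D by simp
      qed
      then show False using rej p(2) by blast
    qed
    moreover have "p \<inter> canonical_cover V (take i es) = {}"
      by (rule rej canonical_cover(1)[OF finV permutation_prefix(2)[OF es]])+
    ultimately show "p \<in> {e. \<exists>i<t. e = es ! i \<and> es ! i \<in> ?S (take i es)}" using p(2) i(2) by auto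
  qed
  have "finite {e. \<exists>i<t. e = es ! i \<and> es ! i \<in> ?S (take i es)}"
    by (rule finite_subset[of _ "(!) es ` {..<t}"]) auto
  then have "card {p \<in> nsets V 2. p \<inter> C \<noteq> {} \<and> p \<notin> process_graph V es} \<le> card {e. \<exists>i<t. e = es ! i \<and> es ! i \<in> ?S (take i es)}"
    using sub by (rule card_mono)
  also have "\<dots> = hits ?S t es"
    using hits_eq_card_images[of es t ?S] es t T_le len by (simp add: permutations_of_set_def)
  finally show ?thesis .
qed

text \<open>\<open>C\<close> has n/2 vertices and the running cover as many as the matching number,
  so the two one-sided differences differ by half the deficiency. The drift estimate thereby also
  controls the side that matters for rejections.\<close>

lemma sum_missing_cover:
  assumes es: "es \<in> edge_orders V" and C: "C \<subseteq> V" "2 * card C = n"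
  shows "(\<Sum>i<t. real (card (C - canonical_cover V (take i es)))) =
    (\<Sum>i<t. real n - 2 * real (nu V (take i es))) / 2 + (\<Sum>i<t. real (card (canonical_cover V (take i es) - C)))"
proof -
  have "real (card (C - canonical_cover V (take i es))) =
    (real n - 2 * real (nu V (take i es))) / 2 + real (card (canonical_cover V (take i es) - C))" for i
  proof -
    let ?D = "canonical_cover V (take i es)"
    have D: "?D \<subseteq> V" "card ?D = nu V (take i es)"
      using canonical_cover(2,3)[OF finV permutation_prefix(2)[OF es]] by auto
    have fin: "finite C" "finite ?D" using C D finV finite_subset by blast+
    have "real (card C) = real (card (C \<inter> ?D)) + real (card (C - ?D))"
      unfolding card_Int_Diff[OF fin(1), of ?D] by simp
    moreover have "real (card ?D) = real (card (C \<inter> ?D)) + real (card (?D - C))"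
      unfolding card_Int_Diff[OF fin(2), of C] by (simp add: Int_commute)
    moreover have "real n = 2 * real (card C)" using C(2) by (simp flip: of_nat_mult)
    ultimately show ?thesis unfolding D(2)[symmetric] by (simp add: field_simps)
  qed
  then show ?thesis by (simp add: sum.distrib sum_divide_distrib)
qed

text \<open>The differences of a fixed optimal cover \<open>C\<^sub>0\<close> with all other optimal covers have no
  neighbours outside \<open>C\<^sub>0\<close> except their partners in a perfect matching, so their union cannot
  become large in the window \<open>{t..<m}\<close>.\<close>

lemma many_forced_out:
  assumes es: "es \<in> edge_orders V" and perf: "2 * nu V (take t es) = n"
    and t: "t \<le> m" "m \<le> T" and n: "80 \<le> n"
    and inner: "\<And>S. S \<subseteq> V \<Longrightarrow> real n / 20 \<le> real (card S) \<Longrightarrow> \<exists>i. t \<le> i \<and> i < m \<and> es ! i \<in> nsets S 2"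
    and outer: "\<And>S R. S \<subseteq> V \<Longrightarrow> R \<subseteq> V \<Longrightarrow> S \<inter> R = {} \<Longrightarrow> real n / 20 \<le> real (card S) \<Longrightarrow>
      real n / 4 \<le> real (card R) \<Longrightarrow> \<exists>i. t \<le> i \<and> i < m \<and> (\<exists>a\<in>S. \<exists>b\<in>R. es ! i = {a, b})"
  shows "2 / 5 * real n \<le> real (card (forced_out V (process_graph V (take m es))))"
proof -
  let ?G = "process_graph V (take m es)"
  define C0 where "C0 = canonical_cover V (take m es)"
  have GE: "?G \<subseteq> nsets V 2" by (rule process_graph_edges[OF permutation_prefix(2)[OF es]])
  have K: "konig_graph V ?G" by (rule process_graph_konig[OF finV])
  have perfm: "2 * nu V (take m es) = n" by (rule perfect_after[OF es perf t(1)])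
  have C0: "optimal_at es m C0" unfolding C0_def
    by (rule canonical_cover(1)[OF finV permutation_prefix(2)[OF es]])
  have cV: "C \<subseteq> V" "2 * card C = n" "finite C" if "optimal_at es m C" for C
    using optimal_at_card[OF that] perfm finite_subset[OF _ finV] by auto
  have accepted: "es ! i \<in> ?G" if "t \<le> i" "i < m" "es ! i \<inter> C0 \<noteq> {}" for i
    by (rule accepted_in_later[OF finV es that(2) _ optimal_at_earlier[OF es perf that(1) _ C0] that(3)])
      (use that t T_le in auto)
  have covers: "e \<inter> C \<noteq> {}" if "e \<in> ?G" "optimal_at es m C" for e C
    using optimal_at_covers[OF that(2,1)] by simp
  \<comment> \<open>A pair inside C0 minus C offered in the window would be accepted, as it meets
    the optimal cover \<open>C0\<close>, and would then be uncovered by \<open>C\<close>.\<close>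
  have small_one: "real (card (C0 - C)) < real n / 20" if C: "optimal_at es m C" for C
  proof (rule ccontr)
    assume "\<not> ?thesis"
    then obtain i where i: "t \<le> i" "i < m" "es ! i \<in> nsets (C0 - C) 2"
      using inner[of "C0 - C"] cV(1)[OF C0] by auto
    then have "es ! i \<inter> C0 \<noteq> {}" "es ! i \<inter> C = {}"
      using nsets_2_nonempty by (auto simp: nsets_def)
    then show False using covers[OF accepted[OF i(1,2)] C] by blast
  qed
  obtain M where M: "is_matching ?G M" "card M = matching_number ?G"
    using maximum_matching_exists[OF finite_subset[OF GE finite_edges[OF finV]]] by blast
  interpret M: konig_matching V ?G C0 M using finV GE K C0 M by unfold_locales
  have mates: "card (\<Union>C\<in>\<D>. C - C0) \<le> card (\<Union>C\<in>\<D>. C0 - C)"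
    if \<D>: "finite \<D>" "\<And>C. C \<in> \<D> \<Longrightarrow> optimal_at es m C" for \<D>
  proof -
    have "\<exists>c. c \<in> (\<Union>C\<in>\<D>. C0 - C) \<and> {c, w} \<in> M" if w: "w \<in> (\<Union>C\<in>\<D>. C - C0)" for w
    proof -
      obtain C where C: "C \<in> \<D>" "w \<in> C" "w \<notin> C0" using w by blast
      interpret C: konig_matching V ?G C M using finV GE K \<D>(2)[OF C(1)] M by unfold_locales
      obtain x where x: "{w, x} \<in> M" "x \<notin> C" using C.mate_exists[OF C(2)] by blast
      have "{w, x} \<inter> C0 \<noteq> {}" using M.M_subset M.cover_edge x(1) by blast
      then show ?thesis using C x by (auto simp: insert_commute)
    qed
    then obtain f where f: "f w \<in> (\<Union>C\<in>\<D>. C0 - C) \<and> {f w, w} \<in> M" if "w \<in> (\<Union>C\<in>\<D>. C - C0)" for w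
      using that[of "\<lambda>w. SOME c. c \<in> (\<Union>C\<in>\<D>. C0 - C) \<and> {c, w} \<in> M"] by (meson someI_ex)
    show ?thesis
    proof (rule card_inj_on_le[of f])
      show "inj_on f (\<Union>C\<in>\<D>. C - C0)"
      proof (rule inj_onI)
        fix v w assume v: "v \<in> (\<Union>C\<in>\<D>. C - C0)" and w: "w \<in> (\<Union>C\<in>\<D>. C - C0)" and eq: "f v = f w"
        show "v = w" using f[OF v] f[OF w] M.mate_unique'[of "f v" v w] unfolding eq by simp
      qed
      show "f ` (\<Union>C\<in>\<D>. C - C0) \<subseteq> (\<Union>C\<in>\<D>. C0 - C)" using f by blast
      show "finite (\<Union>C\<in>\<D>. C0 - C)" using \<D>(1) cV(3)[OF C0] by auto
    qed
  qed
  \<comment> \<open>A union of medium size leaves at least n/4 vertices \<open>R\<close> outside all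
    the covers concerned. A pair from the union to \<open>R\<close> is offered in the window and
    accepted, but some cover in the family contains neither endpoint.\<close>
  have not_medium: "\<not> (real n / 20 \<le> real (card (\<Union>C\<in>\<D>. C0 - C)) \<and> real (card (\<Union>C\<in>\<D>. C0 - C)) \<le> real n / 10)"
    if \<D>: "finite \<D>" "\<And>C. C \<in> \<D> \<Longrightarrow> optimal_at es m C" for \<D>
  proof
    let ?S = "\<Union>C\<in>\<D>. C0 - C"
    let ?N = "\<Union>C\<in>\<D>. C - C0"
    assume S: "real n / 20 \<le> real (card ?S) \<and> real (card ?S) \<le> real n / 10"
    define R where "R = V - C0 - ?N"
    have "card (V - C0) = n - card C0"
      using cV[OF C0] card_V by (simp add: card_Diff_subset)
    then have "real (card (V - C0)) = real n / 2"
      using cV(2)[OF C0] by linarith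
    moreover have fN: "finite ?N" using \<D> cV(3) by auto
    have "card (V - C0) \<le> card R + card ?N"
      using card_Un_le[of R ?N] card_mono[of "R \<union> ?N" "V - C0"] finV fN by (auto simp: R_def)
    ultimately have "real n / 4 \<le> real (card R)" using S mates[OF \<D>] by linarith
    moreover have "?S \<subseteq> V" "R \<subseteq> V" "?S \<inter> R = {}" using cV(1)[OF C0] by (auto simp: R_def)
    ultimately obtain i a b where i: "t \<le> i" "i < m" "a \<in> ?S" "b \<in> R" "es ! i = {a, b}"
      using outer[of ?S R] S by blast
    then obtain C where C: "C \<in> \<D>" "a \<in> C0" "a \<notin> C" by blast
    have "es ! i \<in> ?G" using accepted[OF i(1,2)] C i(5) by blast
    then have "es ! i \<inter> C \<noteq> {}" by (rule covers[OF _ \<D>(2)[OF C(1)]])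
    then have "b \<in> C" using i(5) C(3) by auto
    then show False using i(4) C(1) by (auto simp: R_def)
  qed
  \<comment> \<open>Adding one cover enlarges the union by less than n/20, so the union cannot jump
    across the forbidden range from n/20 to n/10 and stays below it.\<close>
  have small: "real (card (\<Union>C\<in>\<D>. C0 - C)) < real n / 20"
    if "finite \<D>" "\<And>C. C \<in> \<D> \<Longrightarrow> optimal_at es m C" for \<D>
    using that
  proof (induction \<D> rule: finite_induct)
    case empty
    then show ?case using n8 by simp
  next
    case (insert C \<D>)
    have "card (\<Union>C\<in>insert C \<D>. C0 - C) \<le> card (C0 - C) + card (\<Union>C\<in>\<D>. C0 - C)"
      using card_Un_le[of "C0 - C" "\<Union>C\<in>\<D>. C0 - C"] by simp
    moreover have "real (card (\<Union>C\<in>\<D>. C0 - C)) < real n / 20" using insert by blast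
    moreover have "real (card (C0 - C)) < real n / 20" using insert.prems small_one by blast
    ultimately have "real (card (\<Union>C\<in>insert C \<D>. C0 - C)) \<le> real n / 10" by linarith
    then show ?case using not_medium[of "insert C \<D>"] insert.hyps(1) insert.prems by force
  qed
  define \<D> where "\<D> = {C. optimal_at es m C}"
  have "\<D> \<subseteq> Pow V" using cV(1) by (auto simp: \<D>_def)
  then have f\<D>: "finite \<D>" using finV finite_subset by blast
  have opt: "\<And>C. C \<in> \<D> \<Longrightarrow> optimal_at es m C" by (simp add: \<D>_def)
  have fN: "finite (\<Union>C\<in>\<D>. C - C0)" using f\<D> opt cV(3) by auto
  have sub: "V - C0 \<subseteq> forced_out V ?G \<union> (\<Union>C\<in>\<D>. C - C0)"
    by (auto simp: forced_out_def \<D>_def)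
  have "finite (forced_out V ?G)" using finV by (simp add: forced_out_def)
  then have "card (V - C0) \<le> card (forced_out V ?G \<union> (\<Union>C\<in>\<D>. C - C0))"
    using fN sub by (intro card_mono) auto
  also have "\<dots> \<le> card (forced_out V ?G) + card (\<Union>C\<in>\<D>. C - C0)" by (rule card_Un_le)
  finally have "card (V - C0) \<le> card (forced_out V ?G) + card (\<Union>C\<in>\<D>. C0 - C)"
    using mates[OF f\<D> opt] by linarith
  moreover have "card (V - C0) = n - card C0"
    using cV[OF C0] card_V by (simp add: card_Diff_subset)
  ultimately show ?thesis using small[OF f\<D> opt] cV(2)[OF C0] by linarith
qed

text \<open>A pair from a flexible \<open>v\<close> to a forced-out \<open>y\<close> is accepted,
  since some optimal cover contains \<open>v\<close>. Afterwards an optimal cover avoiding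
  \<open>v\<close> would have to contain \<open>y\<close>, which is impossible, so such a pair
  decides \<open>v\<close>. At least (2/5 - 1/20) n = 7n/20 of these pairs are unoffered, which
  gives the rate 7/(10 n).\<close>

lemma prob_flexible:
  assumes t: "m \<le> t" "t \<le> T" and v: "v \<in> V"
  shows "edge_prob V {es. stays_flexible V n m t es v}
    \<le> exp (- (7 / 10) * real (t - m) / real n)"
proof -
  define act where "act xs \<longleftrightarrow> m \<le> length xs \<and> 2 / 5 * real n \<le> real (card (forced_out V (process_graph V xs))) \<and>
      max_degree_le V xs (1 / 20 * real n) \<and> flexible V (process_graph V xs) v" for xs
  let ?Q = "\<lambda>xs. {e. \<exists>a\<in>{v}. \<exists>b\<in>forced_out V (process_graph V xs). e = {a, b}}"
  let ?S = "\<lambda>xs. if act xs then ?Q xs else {}"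
  let ?p = "\<lambda>xs. if act xs then 7 / 10 / real n else 0"
  let ?E = "{es. stays_flexible V n m t es v}"
  have "edge_prob V ?E \<le> exp (- (1 - 0) * (7 / 10 / real n * real (t - m))) / 0 ^ 0"
  proof (rule prob_lower[of t _ _ ?p ?S])
    fix xs assume "prefix_of V t xs"
    show "0 \<le> ?p xs \<and> ?p xs * ((real n)\<^sup>2 / 2) \<le> real (card (?S xs \<inter> (fresh V xs)))"
    proof (cases "act xs")
      case True
      let ?F = "forced_out V (process_graph V xs)"
      have F: "?F \<subseteq> V" "v \<notin> ?F" "finite ?F"
        using True finV by (auto simp: act_def flexible_def forced_out_def)
      have Qs: "?Q xs \<subseteq> (?Q xs \<inter> (fresh V xs)) \<union> {e \<in> set xs. v \<in> e}"
        using F v by auto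
      have "card (?Q xs) \<le> card ((?Q xs \<inter> (fresh V xs)) \<union> {e \<in> set xs. v \<in> e})"
        using finite_avail by (intro card_mono[OF _ Qs]) auto
      also have "\<dots> \<le> card (?Q xs \<inter> (fresh V xs)) + card {e \<in> set xs. v \<in> e}" by (rule card_Un_le)
      also have "card (?Q xs) = card ?F"
        using card_pairs_between[of "{v}" ?F] F by simp
      finally have "real (card ?F) \<le> real (card (?Q xs \<inter> (fresh V xs))) + real (card {e \<in> set xs. v \<in> e})"
        by linarith
      moreover have "real (card {e \<in> set xs. v \<in> e}) \<le> 1 / 20 * real n"
        using True v by (auto simp: act_def max_degree_le_def)
      ultimately have "7 / 20 * real n \<le> real (card (?Q xs \<inter> (fresh V xs)))"
        using True by (simp add: act_def)
      moreover have "7 / 10 / real n * ((real n)\<^sup>2 / 2) = 7 / 20 * real n"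
        using n8 by (simp add: power2_eq_square)
      ultimately show ?thesis using True by simp
    qed simp
  next
    fix es assume es: "es \<in> edge_orders V" "es \<in> ?E"
    then have perf: "2 * nu V (take m es) = n"
      and fo: "2 / 5 * real n \<le> real (card (forced_out V (process_graph V (take m es))))"
      and md: "max_degree_le V (take t es) (1 / 20 * real n)"
      and flex: "flexible V (process_graph V (take t es)) v" by (auto simp: stays_flexible_def)
    have earlier: "optimal_at es i C" if "m \<le> i" "i \<le> j" "optimal_at es j C" for i j C
      using optimal_at_earlier[OF es(1) perf that] .
    \<comment> \<open>On the event the gate is open exactly from time \<open>m\<close> on, because
      the two covers witnessing flexibility at \<open>t\<close> were both optimal at all times
      between.\<close>
    have act: "act (take i es) \<longleftrightarrow> m \<le> i" if i: "i < t" for i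
    proof
      assume mi: "m \<le> i"
      have "forced_out V (process_graph V (take m es)) \<subseteq> forced_out V (process_graph V (take i es))"
        using earlier[of m i] mi by (auto simp: forced_out_def)
      then have "card (forced_out V (process_graph V (take m es))) \<le> card (forced_out V (process_graph V (take i es)))"
        using finV by (intro card_mono) (auto simp: forced_out_def)
      moreover have "flexible V (process_graph V (take i es)) v"
        using flex earlier[of i t] mi i unfolding flexible_def by (meson less_imp_le)
      ultimately show "act (take i es)"
        using fo max_degree_le_take[OF md] prefix_length[OF es(1), of i] mi i t by (auto simp: act_def)
    qed (use prefix_length[OF es(1), of i] i t in \<open>auto simp: act_def\<close>)
    have "es ! i \<notin> ?S (take i es)" if i: "i < t" for i
    proof
      assume "es ! i \<in> ?S (take i es)"
      then have a: "act (take i es)" and "es ! i \<in> ?Q (take i es)" by (auto split: if_splits)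
      then obtain y where y: "y \<in> forced_out V (process_graph V (take i es))" "es ! i = {v, y}" by auto
      obtain C where C: "optimal_at es i C" "v \<in> C" using a by (auto simp: act_def flexible_def)
      have acc: "es ! i \<in> process_graph V (take t es)"
        by (rule accepted_in_later[OF finV es(1) i _ C(1)]) (use y C t T_le in auto)
      obtain D where D: "optimal_at es t D" "v \<notin> D" using flex by (auto simp: flexible_def)
      have "y \<in> D" using optimal_at_covers[OF D(1) acc] y(2) D(2) by auto
      moreover have "optimal_at es i D" using earlier[of i t D] D(1) a act[OF i] i by simp
      ultimately show False using y(1) by (auto simp: forced_out_def)
    qed
    then have "hits ?S t es = 0" by (auto simp: hits_def)
    moreover have "(\<Sum>i<t. ?p (take i es)) = 7 / 10 / real n * real (t - m)"
      unfolding sum_from[symmetric] using act by (intro sum.cong) auto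
    ultimately show "hits ?S t es \<le> 0 \<and> 7 / 10 / real n * real (t - m) \<le> (\<Sum>i<t. ?p (take i es))"
      by simp
  qed (use t in auto)
  then show ?thesis by simp
qed

text \<open>About n^2/800 pairs lie in \<open>S\<close>, of which n^2/1600 stay unoffered. Over 1600
  n steps the exponent is -2n, enough for 2^n sets.\<close>

lemma prob_inner:
  assumes t: "t + 1600 * n \<le> T" and n: "20 \<le> n"
    and num: "(real n)\<^sup>2 / 1600 + real T \<le> (real n / 20) * (real n / 20 - 1) / 2"
  shows "edge_prob V {es. \<exists>S\<subseteq>V. avoids_inside S n t es} \<le> exp (- (2 - 1) * real n)"
proof (rule edge_prob_subsets)
  fix S assume S: "S \<subseteq> V"
  show "edge_prob V {es. avoids_inside S n t es} \<le> exp (- 2 * real n)"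
  proof (cases "real n / 20 \<le> real (card S)")
    case True
    have "(real n / 20) * (real n / 20 - 1) \<le> real (card S) * (real (card S) - 1)"
      using True n by (intro mult_mono) auto
    then have "(real n)\<^sup>2 / 1600 + real T \<le> real (card (nsets S 2))"
      using num by (simp add: real_choose_two)
    then have "edge_prob V {es. \<forall>i. t \<le> i \<longrightarrow> i < t + 1600 * n \<longrightarrow> es ! i \<notin> nsets S 2}
      \<le> exp (- 2 * ((real n)\<^sup>2 / 1600) * real (t + 1600 * n - t) / (real n)\<^sup>2)"
      using t nsets_mono[OF S] by (intro prob_avoid) auto
    then show ?thesis using True n8 by (simp add: avoids_inside_def)
  qed (simp add: avoids_inside_def)
qed

text \<open>Here n^2/80 pairs are available and n^2/160 stay unoffered, so the exponent is -20n.
  Choosing \<open>S\<close> and \<open>R\<close> costs two unions over subsets.\<close>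

lemma prob_outer:
  assumes t: "t + 1600 * n \<le> T" and num: "real T \<le> (real n)\<^sup>2 / 160"
  shows "edge_prob V {es. \<exists>S\<subseteq>V. \<exists>R\<subseteq>V. avoids_between S R n t es} \<le> exp (- (20 - 1 - 1) * real n)"
proof (rule edge_prob_subsets, rule edge_prob_subsets)
  fix S R assume SR: "S \<subseteq> V" "R \<subseteq> V"
  let ?Q = "{e. \<exists>a\<in>S. \<exists>b\<in>R. e = {a, b}}"
  show "edge_prob V {es. avoids_between S R n t es} \<le> exp (- 20 * real n)"
  proof (cases "S \<inter> R = {} \<and> real n / 20 \<le> real (card S) \<and> real n / 4 \<le> real (card R)")
    case True
    have fin: "finite S" "finite R" using SR finV finite_subset by blast+
    have "(real n / 20) * (real n / 4) \<le> real (card S) * real (card R)"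
      using True by (intro mult_mono) auto
    also have "\<dots> = real (card ?Q)"
      using card_pairs_between[OF fin] True by simp
    finally have "(real n)\<^sup>2 / 160 + real T \<le> real (card ?Q)"
      using num by (simp add: power2_eq_square)
    moreover have "?Q \<subseteq> nsets V 2" using SR True by auto
    ultimately have "edge_prob V {es. \<forall>i. t \<le> i \<longrightarrow> i < t + 1600 * n \<longrightarrow> es ! i \<notin> ?Q}
      \<le> exp (- 2 * ((real n)\<^sup>2 / 160) * real (t + 1600 * n - t) / (real n)\<^sup>2)"
      using t by (intro prob_avoid) auto
    then show ?thesis using True n8 by (simp add: avoids_between_def)
  next
    case False
    then have "{es. avoids_between S R n t es} = {}" unfolding avoids_between_def by blast
    then show ?thesis by (simp only: measure_empty exp_ge_zero)
  qed
qed

end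

section \<open>Collecting the high-probability events\<close>

lemma konig_process_eq_take:
  "konig_process V es m = process_graph V (take m es)"
proof (cases "m \<le> length es")
  case False
  then have "m = length es + (m - length es)" by simp
  then show ?thesis using konig_process_ge_length[of V es "m - length es"] False by simp
qed (rule konig_process_take)

lemma whp_not:
  assumes "vertex_sets V" "r \<longlonglongrightarrow> 0"
    "\<forall>\<^sub>F n in at_top. horizon (V n) n (t_max n) \<longrightarrow> edge_prob (V n) {es. R n es} \<le> r n"
  shows "whp V (\<lambda>n es. \<not> R n es)"
  using assms by (intro whp_horizon[of V r]) auto

lemma whp_cover_drift:
  assumes V: "vertex_sets V" and t: "\<forall>\<^sub>F n in at_top. t n \<le> t_max n"
  shows "whp V (\<lambda>n es. \<not> (\<exists>C\<subseteq>V n. drifting (V n) n (t n) es C))"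
proof (rule whp_not[OF V])
  show "(\<lambda>n. exp (- (2 - 1) * real n)) \<longlonglongrightarrow> 0" by real_asymp
qed (use t in eventually_elim, intro impI horizon.prob_cover_drift)

lemma whp_touching:
  assumes V: "vertex_sets V" and t: "\<forall>\<^sub>F n in at_top. t n \<le> t_max n"
  shows "whp V (\<lambda>n es. \<not> (\<exists>C\<subseteq>V n. often_touched (V n) n (t n) (B n) es C))"
proof (rule whp_not[OF V])
  show "(\<lambda>n. exp (- (2 - 1) * real n)) \<longlonglongrightarrow> 0" by real_asymp
qed (use t in eventually_elim, intro impI horizon.prob_touching)

lemma whp_inner:
  assumes V: "vertex_sets V" and t: "\<forall>\<^sub>F n in at_top. t n + 1600 * n \<le> t_max n"
  shows "whp V (\<lambda>n es. \<not> (\<exists>S\<subseteq>V n. avoids_inside S n (t n) es))"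
proof (rule whp_not[OF V])
  show "(\<lambda>n. exp (- (2 - 1) * real n)) \<longlonglongrightarrow> 0" by real_asymp
  have "\<forall>\<^sub>F n :: nat in at_top. (real n)\<^sup>2 / 1600 + 4 * real n * ln (real n) \<le> (real n / 20) * (real n / 20 - 1) / 2"
    by real_asymp
  then have "\<forall>\<^sub>F n in at_top. (real n)\<^sup>2 / 1600 + real (t_max n) \<le> (real n / 20) * (real n / 20 - 1) / 2"
    using eventually_ge_at_top[of 1] by eventually_elim (use t_max_le in force)
  then show "\<forall>\<^sub>F n in at_top. horizon (V n) n (t_max n) \<longrightarrow> edge_prob (V n) {es. \<exists>S\<subseteq>V n. avoids_inside S n (t n) es} \<le> exp (- (2 - 1) * real n)"
    using t eventually_ge_at_top[of 20] by eventually_elim (intro impI horizon.prob_inner)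
qed

lemma whp_outer:
  assumes V: "vertex_sets V" and t: "\<forall>\<^sub>F n in at_top. t n + 1600 * n \<le> t_max n"
  shows "whp V (\<lambda>n es. \<not> (\<exists>S\<subseteq>V n. \<exists>R\<subseteq>V n. avoids_between S R n (t n) es))"
proof (rule whp_not[OF V])
  show "(\<lambda>n. exp (- (20 - 1 - 1) * real n)) \<longlonglongrightarrow> 0" by real_asymp
  have "\<forall>\<^sub>F n :: nat in at_top. 4 * real n * ln (real n) \<le> (real n)\<^sup>2 / 160" by real_asymp
  then have "\<forall>\<^sub>F n in at_top. real (t_max n) \<le> (real n)\<^sup>2 / 160"
    using eventually_ge_at_top[of 1] by eventually_elim (use t_max_le in force)
  then show "\<forall>\<^sub>F n in at_top. horizon (V n) n (t_max n) \<longrightarrow> edge_prob (V n) {es. \<exists>S\<subseteq>V n. \<exists>R\<subseteq>V n. avoids_between S R n (t n) es} \<le> exp (- (20 - 1 - 1) * real n)"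
    using t by eventually_elim (intro impI horizon.prob_outer)
qed

text \<open>About 5/2 n ln n steps remain after the window, so a vertex stays flexible with
  probability of order n^(-7/4) up to factors constant in \<open>n\<close>, and the sum over all
  vertices vanishes.\<close>

lemma whp_not_flexible:
  assumes V: "vertex_sets V" and m: "\<forall>\<^sub>F n in at_top. real (m n) \<le> 3 / 2 * real n * ln (real n) + 1600 * real n"
    "\<forall>\<^sub>F n in at_top. m n \<le> t_max n"
  shows "whp V (\<lambda>n es. \<forall>v\<in>V n. \<not> stays_flexible (V n) n (m n) (t_max n) es v)"
    (is "whp V (\<lambda>n es. \<forall>v\<in>V n. \<not> ?F n es v)")
proof (rule whp_horizon[OF V])
  define r where "r n = real n * exp (- (7 / 10) * ((5 / 2 * real n * ln (real n) - 1 - 1600 * real n) / real n))" for n :: nat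
  show "r \<longlonglongrightarrow> 0" unfolding r_def by real_asymp
  show "\<forall>\<^sub>F n in at_top. horizon (V n) n (t_max n) \<longrightarrow> edge_prob (V n) {es. \<not> (\<forall>v\<in>V n. \<not> ?F n es v)} \<le> r n"
    using m eventually_ge_at_top[of 1]
  proof eventually_elim
    case (elim n)
    show ?case
    proof
      assume h: "horizon (V n) n (t_max n)"
      have "4 * real n * ln (real n) - 1 \<le> real (t_max n)"
        unfolding t_max_def by (rule real_nat_floor)
      then have gap: "5 / 2 * real n * ln (real n) - 1 - 1600 * real n \<le> real (t_max n - m n)"
        using elim by (simp add: of_nat_diff)
      have "edge_prob (V n) (\<Union>v\<in>V n. {es. ?F n es v})
        \<le> real (card (V n)) * exp (- (7 / 10) * ((5 / 2 * real n * ln (real n) - 1 - 1600 * real n) / real n))"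
      proof (rule edge_prob_UN_le)
        show "finite (V n)" by (rule horizon.finV[OF h])
        fix v assume v: "v \<in> V n"
        have "edge_prob (V n) {es. ?F n es v} \<le> exp (- (7 / 10) * real (t_max n - m n) / real n)"
          by (rule horizon.prob_flexible[OF h elim(2) order_refl v])
        also have "\<dots> = exp (- (7 / 10) * (real (t_max n - m n) / real n))" by simp
        also have "\<dots> \<le> exp (- (7 / 10) * ((5 / 2 * real n * ln (real n) - 1 - 1600 * real n) / real n))"
          using divide_right_mono[OF gap of_nat_0_le_iff[of n]] unfolding exp_le_cancel_iff by (rule mult_left_mono_neg) simp
        finally show "edge_prob (V n) {es. ?F n es v} \<le> \<dots>" .
      qed
      also have "(\<Union>v\<in>V n. {es. ?F n es v}) = {es. \<not> (\<forall>v\<in>V n. \<not> ?F n es v)}" by blast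
      finally show "edge_prob (V n) {es. \<not> (\<forall>v\<in>V n. \<not> ?F n es v)} \<le> r n"
        by (simp only: r_def horizon.card_V[OF h])
    qed
  qed
qed

lemma (in horizon) unique_cover_few_missing:
  assumes es: "es \<in> edge_orders V" and perf: "2 * nu V (take t es) = n"
    and t: "t + 1600 * n \<le> T" and n: "80 \<le> n"
    and unmatched: "(\<Sum>m<t. real n - 2 * real (nu V (take m es))) \<le> K * (real n)\<^sup>2"
    and md: "max_degree_le V (take T es) (1 / 20 * real n)"
    and drift: "\<not> (\<exists>C\<subseteq>V. drifting V n t es C)"
    and touching: "\<not> (\<exists>C\<subseteq>V. often_touched V n t ((K / 2 + 8) * (real n)\<^sup>2) es C)"
    and inner: "\<not> (\<exists>S\<subseteq>V. avoids_inside S n t es)"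
    and outer: "\<not> (\<exists>S\<subseteq>V. \<exists>R\<subseteq>V. avoids_between S R n t es)"
    and flex: "\<forall>v\<in>V. \<not> stays_flexible V n (t + 1600 * n) T es v"
  shows "\<exists>C. (\<forall>D. is_optimal_vertex_cover V (process_graph V (take T es)) D \<longleftrightarrow> D = C) \<and>
    real (card {p \<in> nsets V 2. p \<inter> C \<noteq> {} \<and> p \<notin> process_graph V es}) \<le> (7 * (K / 2 + 8) + 2) * real n"
proof -
  define C where "C = canonical_cover V (take T es)"
  have C: "optimal_at es T C" unfolding C_def
    by (rule canonical_cover(1)[OF finV permutation_prefix(2)[OF es]])
  have tT: "t \<le> T" using t by simp
  have "2 / 5 * real n \<le> real (card (forced_out V (process_graph V (take (t + 1600 * n) es))))"
  proof (rule many_forced_out[OF es perf _ t n])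
    show "\<exists>i\<ge>t. i < t + 1600 * n \<and> es ! i \<in> nsets S 2" if "S \<subseteq> V" "real n / 20 \<le> real (card S)" for S
    proof (rule ccontr)
      assume "\<not> ?thesis"
      then have "\<forall>i. t \<le> i \<longrightarrow> i < t + 1600 * n \<longrightarrow> es ! i \<notin> nsets S 2" by simp
      then have "avoids_inside S n t es" unfolding avoids_inside_def by (intro conjI that)
      then show False using inner that by blast
    qed
    show "\<exists>i\<ge>t. i < t + 1600 * n \<and> (\<exists>a\<in>S. \<exists>b\<in>R. es ! i = {a, b})"
      if "S \<subseteq> V" "R \<subseteq> V" "S \<inter> R = {}" "real n / 20 \<le> real (card S)" "real n / 4 \<le> real (card R)" for S R
    proof (rule ccontr)
      assume "\<not> ?thesis"
      then have "\<forall>i. t \<le> i \<longrightarrow> i < t + 1600 * n \<longrightarrow> es ! i \<notin> {e. \<exists>a\<in>S. \<exists>b\<in>R. e = {a, b}}" by simp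
      then have "avoids_between S R n t es" unfolding avoids_between_def by (intro conjI that)
      then show False using outer that by blast
    qed
  qed simp
  \<comment> \<open>Uniqueness follows from this: a vertex in the symmetric difference of two
    optimal covers would be flexible.\<close>
  then have rigid: "\<not> flexible V (process_graph V (take T es)) v" if "v \<in> V" for v
    using flex that md perfect_after[OF es perf, of "t + 1600 * n"] by (auto simp: stays_flexible_def)
  have uniq: "optimal_at es T D \<longleftrightarrow> D = C" for D
  proof
    assume D: "optimal_at es T D"
    show "D = C"
    proof (rule ccontr)
      assume "D \<noteq> C"
      then obtain v where "v \<in> D \<and> v \<notin> C \<or> v \<in> C \<and> v \<notin> D" by blast
      then have "flexible V (process_graph V (take T es)) v" "v \<in> V"
        using C D optimal_at_card by (auto simp: flexible_def)
      then show False using rigid by blast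
    qed
  qed (use C in simp)
  have CV: "C \<subseteq> V" "2 * card C = n"
    using optimal_at_card[OF C] perfect_after[OF es perf tT] by auto
  have Ct: "is_vertex_cover V (process_graph V (take t es)) C"
    using optimal_at_earlier[OF es perf order_refl tT C] by (simp add: is_optimal_vertex_cover_def)
  have "max_degree_le V (take t es) (real n / 16)"
    using max_degree_le_take[OF md tT] unfolding max_degree_le_def by force
  then have d: "(\<Sum>i<t. real (card (canonical_cover V (take i es) - C))) < 8 * (real n)\<^sup>2"
    using drift CV Ct unfolding drifting_def by (meson not_le order_refl eq_imp_le)
  \<comment> \<open>Half the summed deficiency contributes K/2 and the drift contributes 8. The
    touching estimate then turns this total B into 7B/n + 2n missing pairs.\<close>
  have "(\<Sum>i<t. real (card (C - canonical_cover V (take i es)))) \<le> (K / 2 + 8) * (real n)\<^sup>2"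
    unfolding sum_missing_cover[OF es CV] using d unmatched by (simp add: algebra_simps)
  then have "real (hits (\<lambda>xs. {e. e \<inter> (C - canonical_cover V xs) \<noteq> {}}) t es)
      < 7 * ((K / 2 + 8) * (real n)\<^sup>2) / real n + 2 * real n"
    using touching CV unfolding often_touched_def by (meson not_le)
  also have "7 * ((K / 2 + 8) * (real n)\<^sup>2) / real n = 7 * (K / 2 + 8) * real n"
    using n8 by (simp add: power2_eq_square)
  also have "7 * (K / 2 + 8) * real n + 2 * real n = (7 * (K / 2 + 8) + 2) * real n"
    by (rule distrib_right[symmetric])
  finally have "real (card {p \<in> nsets V 2. p \<inter> C \<noteq> {} \<and> p \<notin> process_graph V es}) \<le> (7 * (K / 2 + 8) + 2) * real n"
    using missing_pairs_le_hits[OF es perf tT order_refl uniq] by linarith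
  then show ?thesis using uniq by blast
qed

lemma whp_tendsto_1:
  assumes "whp V Q" shows "((\<lambda>n. edge_prob (V n) {es. Q n es}) \<longlongrightarrow> 1) even_at_top"
proof -
  have "edge_prob (V n) {es. Q n es} = 1 - edge_prob (V n) {es. \<not> Q n es}" for n
  proof -
    have "{es. Q n es} = UNIV - {es. \<not> Q n es}" by auto
    then show ?thesis using measure_pmf.prob_compl[of "{es. \<not> Q n es}" "random_edge_ordering (V n)"] by simp
  qed
  then show ?thesis using tendsto_diff[OF tendsto_const[of 1] assms[unfolded whp_def]] by simp
qed

theorem theorem1p2:
  "\<exists>K::real. \<forall>\<epsilon>::real. \<epsilon> > 0 \<longrightarrow>
     (\<forall>V :: nat \<Rightarrow> 'a set. (\<forall>n. even n \<longrightarrow> finite (V n) \<and> card (V n) = n) \<longrightarrow>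
       ((\<lambda>n. measure_pmf.prob (random_edge_ordering (V n))
          {es. has_perfect_matching (V n)
                 (konig_process (V n) es (nat \<lfloor>(1 + \<epsilon>) * real n * ln (real n)\<rfloor>)) \<and>
               (\<exists>C. (\<forall>D. is_optimal_vertex_cover (V n)
                        (konig_process (V n) es (nat \<lfloor>4 * real n * ln (real n)\<rfloor>)) D \<longleftrightarrow> D = C) \<and>
                    real (card {p \<in> nsets (V n) 2. p \<inter> C \<noteq> {} \<and>
                             p \<notin> konig_process (V n) es (n choose 2)}) \<le> K * real n)})
         \<longlongrightarrow> 1) even_at_top)"
proof -
  obtain K where K: "\<And>V :: nat \<Rightarrow> 'a set. vertex_sets V \<Longrightarrow> whp V (\<lambda>n es.
    2 * nu (V n) (take (t_match (1 / 2) n) es) = n \<and>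
    (\<Sum>m<t_match (1 / 2) n. real n - 2 * real (nu (V n) (take m es))) \<le> K * (real n)\<^sup>2)"
    using whp_matching_phase[of "1 / 2", where 'a = 'a] by auto
  show ?thesis
  proof (intro exI[of _ "7 * (K / 2 + 8) + 2"] allI impI)
    fix \<epsilon> :: real and V :: "nat \<Rightarrow> 'a set"
    assume eps: "\<epsilon> > 0" and "\<forall>n. even n \<longrightarrow> finite (V n) \<and> card (V n) = n"
    then have V: "vertex_sets V" by (simp add: vertex_sets_def)
    \<comment> \<open>The matching result is stated for parameters up to 1/2; for larger \<epsilon>
      the perfect matching found earlier simply persists. The bound in (iii) instead uses the fixed
      instance 1/2, so its constant is independent of \<epsilon>.\<close>
    define e where "e = min \<epsilon> (1 / 2)"
    have e: "0 < e" "e \<le> 1 / 2" "e \<le> \<epsilon>" using eps by (auto simp: e_def)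
    obtain K' where K': "whp V (\<lambda>n es. 2 * nu (V n) (take (t_match e n) es) = n \<and>
      (\<Sum>m<t_match e n. real n - 2 * real (nu (V n) (take m es))) \<le> K' * (real n)\<^sup>2)"
      using whp_matching_phase[OF e(1,2), where 'a = 'a] V by blast
    let ?t = "t_match (1 / 2)"
    have num: "\<forall>\<^sub>F n :: nat in at_top. 3 / 2 * real n * ln (real n) + 1600 * real n \<le> 4 * real n * ln (real n) - 1"
      by real_asymp
    have t32: "real (?t n) \<le> 3 / 2 * real n * ln (real n)" if "1 \<le> n" for n
      using t_match_bounds(1)[OF that, of "1 / 2"] by simp
    \<comment> \<open>Perfect matching time and window together end well before
      \<open>t_max\<close>, because 3/2 < 4 and the window is only linear.\<close>
    have window: "\<forall>\<^sub>F n in at_top. ?t n + 1600 * n \<le> t_max n"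
      using num eventually_ge_at_top[of 1]
    proof eventually_elim
      case (elim n)
      have "4 * real n * ln (real n) - 1 \<le> real (t_max n)"
        unfolding t_max_def by (rule real_nat_floor)
      then have "real (?t n + 1600 * n) \<le> real (t_max n)" using t32[of n] elim by simp
      then show ?case by (simp only: of_nat_le_iff)
    qed
    then have tmax: "\<forall>\<^sub>F n in at_top. ?t n \<le> t_max n" by eventually_elim simp
    have m32: "\<forall>\<^sub>F n in at_top. real (?t n + 1600 * n) \<le> 3 / 2 * real n * ln (real n) + 1600 * real n"
      using eventually_ge_at_top[of 1] by eventually_elim (use t32 in simp)
    have md: "(0::real) < 1 / 20" by simp
    note whps = whp_conj[OF whp_conj[OF K[OF V] K'] whp_conj[OF whp_max_degree[OF V md]
      whp_conj[OF whp_cover_drift[OF V tmax]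
        whp_conj[OF whp_touching[OF V tmax, of "\<lambda>n. (K / 2 + 8) * (real n)\<^sup>2"]
          whp_conj[OF whp_conj[OF whp_inner[OF V window] whp_outer[OF V window]] whp_not_flexible[OF V m32 window]]]]]]
    show "((\<lambda>n. measure_pmf.prob (random_edge_ordering (V n))
          {es. has_perfect_matching (V n)
                 (konig_process (V n) es (nat \<lfloor>(1 + \<epsilon>) * real n * ln (real n)\<rfloor>)) \<and>
               (\<exists>C. (\<forall>D. is_optimal_vertex_cover (V n)
                        (konig_process (V n) es (nat \<lfloor>4 * real n * ln (real n)\<rfloor>)) D \<longleftrightarrow> D = C) \<and>
                    real (card {p \<in> nsets (V n) 2. p \<inter> C \<noteq> {} \<and>
                             p \<notin> konig_process (V n) es (n choose 2)}) \<le> (7 * (K / 2 + 8) + 2) * real n)})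
         \<longlongrightarrow> 1) even_at_top"
    proof (rule whp_tendsto_1, rule whp_mono[OF V whps], use eventually_horizon[OF V] window eventually_ge_at_top[of 80] in eventually_elim)
      case (elim n)
      show ?case
      proof (intro impI ballI, elim conjE, intro conjI)
        fix es assume ev: "even n" and es: "es \<in> edge_orders (V n)"
          and perf: "2 * nu (V n) (take (t_match e n) es) = n"
        interpret horizon "V n" n "t_max n" using elim ev by blast
        have "2 * nu (V n) (take (t_match \<epsilon> n) es) = n"
          using perfect_after[OF es perf] t_match_mono[of n e \<epsilon>] e n8 by simp
        then show "has_perfect_matching (V n) (konig_process (V n) es (nat \<lfloor>(1 + \<epsilon>) * real n * ln (real n)\<rfloor>))"
          using perfect_matching_if_double[OF finV process_graph_edges[OF permutation_prefix(2)[OF es]] process_graph_konig[OF finV]] card_V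
          by (simp add: konig_process_eq_take t_match_def)
      next
        fix es assume ev: "even n" and es: "es \<in> edge_orders (V n)"
        assume A: "2 * nu (V n) (take (?t n) es) = n"
          "(\<Sum>m<?t n. real n - 2 * real (nu (V n) (take m es))) \<le> K * (real n)\<^sup>2"
          "max_degree_le (V n) (take (t_max n) es) (1 / 20 * real n)"
          "\<not> (\<exists>C\<subseteq>V n. drifting (V n) n (?t n) es C)"
          "\<not> (\<exists>C\<subseteq>V n. often_touched (V n) n (?t n) ((K / 2 + 8) * (real n)\<^sup>2) es C)"
          "\<not> (\<exists>S\<subseteq>V n. avoids_inside S n (?t n) es)"
          "\<not> (\<exists>S\<subseteq>V n. \<exists>R\<subseteq>V n. avoids_between S R n (?t n) es)"
          "\<forall>v\<in>V n. \<not> stays_flexible (V n) n (?t n + 1600 * n) (t_max n) es v"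
        interpret horizon "V n" n "t_max n" using elim ev by blast
        have N: "konig_process (V n) es (n choose 2) = process_graph (V n) es"
          using permutation_prefix(3)[OF es] card_V by (simp add: konig_process_eq_take)
        show "\<exists>C. (\<forall>D. is_optimal_vertex_cover (V n)
            (konig_process (V n) es (nat \<lfloor>4 * real n * ln (real n)\<rfloor>)) D \<longleftrightarrow> D = C) \<and>
            real (card {p \<in> nsets (V n) 2. p \<inter> C \<noteq> {} \<and>
               p \<notin> konig_process (V n) es (n choose 2)}) \<le> (7 * (K / 2 + 8) + 2) * real n"
          unfolding N unfolding konig_process_eq_take t_max_def[symmetric]
          by (rule unique_cover_few_missing[OF es A(1) elim(2,3) A(2-8)])
      qed
    qed
  qed
qed

end
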